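(* Let $d \geq 5$ be an integer and let $\alpha,\beta > 0$ be real numbers. If $\alpha\beta > 1$, then for all integers $n_0 \geq 1$ the pair $$\Big(\bigcup_{n \geq n_0} \sqrt{n/\alpha}\, S^{d-1},\ \bigcup_{n \geq n_0} \sqrt{n/\beta}\, S^{d-1}\Big)$$ is a Fourier uniqueness pair for $\mathcal{S}(\mathbb{R}^d)$. If $\alpha\beta = 1$, then this is true for $n_0 = 1$.
   Context: $\mathcal{S}(\mathbb{R}^d)$ is the space of complex-valued Schwartz functions, $\rho S^{d-1} \subset \mathbb{R}^d$ is the sphere of radius $\rho$ centered at the origin, and $n$ ranges over integers. The Fourier transform is $\widehat{f}(\xi) = \int_{\mathbb{R}^d} f(x) e^{-2\pi i \langle x,\xi\rangle}dx$. A pair $(A,B)$ of subsets of $\mathbb{R}^d$ is a Fourier uniqueness pair for a function space $V$ if the restriction map $f \mapsto (f|_A, \widehat{f}|_B)$ is injective on $V$. *)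

theory Defs
  imports "HOL-Analysis.Analysis"
begin

definition partial_deriv :: "'d::finite \<Rightarrow> (real^'d \<Rightarrow> complex) \<Rightarrow> real^'d \<Rightarrow> complex" where
  "partial_deriv i f x = vector_derivative (\<lambda>t. f (x + t *\<^sub>R axis i 1)) (at 0)"

text \<open>
  A mixed partial derivative of order k is given by a list of k coordinate indices, the head of the
  list being the last differentiation carried out.
\<close>

definition mixed_partial :: "'d::finite list \<Rightarrow> (real^'d \<Rightarrow> complex) \<Rightarrow> real^'d \<Rightarrow> complex" where
  "mixed_partial is f = foldr partial_deriv is f"

text \<open>
  Smooth: every mixed partial derivative (including f itself, for the empty list) is
  (totally) differentiable at every point. In particular all of them exist and are continuous.
\<close>

definition smooth :: "(real^'d::finite \<Rightarrow> complex) \<Rightarrow> bool" where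
  "smooth f \<longleftrightarrow> (\<forall>is x. mixed_partial is f differentiable (at x))"

definition schwartz_space :: "(real^'d::finite \<Rightarrow> complex) set" where
  "schwartz_space = {f. smooth f \<and>
     (\<forall>(a :: 'd \<Rightarrow> nat) is. bounded (range (\<lambda>x. (\<Prod>j\<in>UNIV. (x $ j) ^ a j) *\<^sub>R mixed_partial is f x)))}"

definition fourier_transform :: "(real^'d::finite \<Rightarrow> complex) \<Rightarrow> real^'d \<Rightarrow> complex" where
  "fourier_transform f \<xi> =
     (LINT x|lborel. f x * exp (- 2 * complex_of_real pi * \<i> * complex_of_real (x \<bullet> \<xi>)))"

definition fourier_uniqueness_pair ::
    "(real^'d::finite) set \<Rightarrow> (real^'d) set \<Rightarrow> (real^'d \<Rightarrow> complex) set \<Rightarrow> bool" where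
  "fourier_uniqueness_pair A B V \<longleftrightarrow>
     inj_on (\<lambda>f. (restrict f A, restrict (fourier_transform f) B)) V"

end

theory Submission
  imports Defs "HOL-Complex_Analysis.Complex_Analysis" "HOL-Probability.Sinc_Integral" "HOL-Probability.Characteristic_Functions"
begin

text \<open>
  Let \<open>f\<close> vanish on the spheres \<open>|x|\<^sup>2 = n/\<alpha>\<close> and its Fourier transform \<open>g\<close> on the spheres
  \<open>|x|\<^sup>2 = n/\<beta>\<close>, for \<open>n \<ge> n0\<close>. For a fixed vector \<open>w\<close> and every \<open>m\<close> consider the oscillatory Gaussian
  transforms \<open>F t = \<integral> f(x) (x\<bullet>w)\<^sup>m exp(\<i>\<pi>t|x|\<^sup>2) dx\<close> and likewise \<open>G\<close> for \<open>g\<close>. If the transforms of smaller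
  order vanish, comparing leading Taylor coefficients at \<open>0\<close> in a translation parameter turns the
  Fourier transform of a complex Gaussian into \<open>G s = \<kappa>(s) F(-1/s)\<close> with
  \<open>\<kappa>(s) = (\<i>/s)\<^sup>d\<^sup>/\<^sup>2 s\<^sup>-\<^sup>m\<close>. Poisson summation in \<open>|x|\<^sup>2\<close> shows that the sums of \<open>F\<close> over translates by \<open>2\<alpha>\<int>\<close>
  and of \<open>G\<close> over translates by \<open>2\<beta>\<int>\<close> are trigonometric polynomials, which are zero for \<open>n0 = 1\<close>.

  After rescaling both periods to \<open>2a\<close>, \<open>a = sqrt(\<alpha>\<beta>)\<close>, the pair is a fixed point of \<open>H = P - T H\<close>, where \<open>T\<close>
  sums \<open>\<kappa>(z + 2an) H(-1/(z + 2an))\<close> over \<open>n \<noteq> 0\<close>. Since the sum of \<open>1/(|z + 2an|\<^sup>2 - a\<^sup>2)\<close> over \<open>n \<noteq> 0\<close> is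
  at most \<open>1/(a\<^sup>2 - |z|\<^sup>2)\<close> and \<open>|\<kappa>(u)| < |u|\<^sup>-\<^sup>2\<close> for \<open>|u| > 1\<close> (this needs \<open>d \<ge> 5\<close>), \<open>T\<close> contracts the norm
  with weight \<open>a\<^sup>2 - |z|\<^sup>2\<close> by \<open>a\<^sup>-\<^sup>2\<close>. If \<open>a = 1\<close> and \<open>P = 0\<close>, a maximum of the weighted modulus is impossible
  unless \<open>H = 0\<close>. If \<open>a > 1\<close>, the Neumann series extends \<open>H\<close> holomorphically to \<open>|z| < a\<close>; by the functional
  equation \<open>H\<^sup>2\<close> is then entire and tends to \<open>0\<close> at infinity, so \<open>H = 0\<close> whatever \<open>P\<close> is.

  Once all these transforms vanish on the real line, they vanish on the upper half-plane by reflection,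
  and summing over \<open>m\<close> at \<open>t = \<i>N\<close> gives \<open>\<integral> f(x) exp(-\<pi>N|x - w|\<^sup>2) dx = 0\<close> for all \<open>N > 0\<close>, hence \<open>f(w) = 0\<close>.
\<close>

section \<open>The transfer operator\<close>

text \<open>The Gaussian transform of \<open>f\<close> alone sees only the spherical means of
  \<open>f\<close>; the powers of \<open>x \<bullet> w\<close> recover the rest. As
  \<open>(x \<bullet> w) ^ m\<close> is not harmonic, the functional equation of weight
  \<open>d/2 + m\<close> fails for it in general. The correction comes from transforms of lower
  order, which is what forces the induction on \<open>m\<close>. Larger \<open>m\<close> only
  improves the decay of \<open>\<kappa>\<close>, so \<open>m = 0\<close> is the hardest case. The
  centre \<open>x = 0\<close> belongs to \<open>n = 0\<close>, where nothing is known about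
  \<open>f\<close>. There the divisor used in the Poisson summation has a zero of order two,
  harmless because \<open>1 / (norm x)\<^sup>2\<close> is locally integrable in dimension at least
  3. The two regimes draw on different resources. For \<open>a = 1\<close> the factor of
  \<open>T\<close> is 1 and only the strictness of the estimates is left, which needs
  \<open>P = 0\<close>. For \<open>a > 1\<close> the contraction yields convergence but not zero,
  because \<open>P\<close> is unknown; all that is used of \<open>P\<close> is that it is entire,
  and the vanishing comes from complex analysis. The functional equation cannot be continued around
  the origin for \<open>H\<close> itself because of the square root in
  \<open>\<kappa>\<close>.\<close>

lemma two_mult_Suc_ge: "0 < a \<Longrightarrow> 2 * a * real (Suc n) \<ge> 2 * (a :: real)"
  by simp

text \<open>Equality holds for \<open>c = a\<close>, so that the sum over \<open>n\<close> telescopes exactly on the real line.\<close>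

lemma lattice_sum_step:
  fixes x c a :: real
  assumes "0 < c" "c \<le> a" "\<bar>x\<bar> < c"
  defines "r \<equiv> \<lambda>n::nat. (1 / (x + 2*a*real n + c) + 1 / (2*a*real n + c - x)) / (2*c)"
  shows "1 / ((x + 2*a*real (Suc n))\<^sup>2 - c\<^sup>2) + 1 / ((x - 2*a*real (Suc n))\<^sup>2 - c\<^sup>2) \<le> r n - r (Suc n)"
proof -
  have key: "1 / ((y + 2*a*real (Suc n))\<^sup>2 - c\<^sup>2)
      \<le> (1 / (y + 2*a*real n + c) - 1 / (y + 2*a*real (Suc n) + c)) / (2*c)" if "\<bar>y\<bar> < c" for y
  proof -
    define u where "u = y + 2*a*real (Suc n)"
    have u: "y + 2*a*real n = u - 2*a" by (simp add: u_def algebra_simps)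
    have p: "u - 2*a + c > 0" "u - c > 0" "u + c > 0"
      using that assms(1-3) two_mult_Suc_ge[of a n] unfolding u_def by linarith+
    \<comment> \<open>The denominators \<open>u - c\<close> and \<open>u + c\<close> of the partial
      fractions differ by \<open>2 * c\<close>. Widening this to the period \<open>2 * a\<close> is
      the only loss and makes consecutive terms cancel.\<close>
    have "u - 2*a + c \<le> u - c" using assms by simp
    then have le: "1 / (u - c) \<le> 1 / (u - 2*a + c)" using p by (intro divide_left_mono) auto
    have "u\<^sup>2 - c\<^sup>2 = (u - c) * (u + c)" by (simp add: power2_eq_square algebra_simps)
    then have "1 / (u\<^sup>2 - c\<^sup>2) = (1 / (u - c) - 1 / (u + c)) / (2*c)"
      using p assms(1) by (simp add: divide_simps)
    also have "\<dots> \<le> (1 / (u - 2*a + c) - 1 / (u + c)) / (2*c)"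
      using le assms by (intro divide_right_mono) auto
    finally show ?thesis by (simp only: u u_def[symmetric])
  qed
  have e: "(x - 2*a*real (Suc n))\<^sup>2 = (-x + 2*a*real (Suc n))\<^sup>2"
    using power2_commute[of x] by (simp only: uminus_add_conv_diff)
  have "2*a*real k + c - x = -x + 2*a*real k + c" for k by simp
  then show ?thesis
    using key[OF assms(3)] key[of "-x", unfolded abs_minus_cancel, OF assms(3)] unfolding r_def e
    by (simp only: diff_divide_distrib add_divide_distrib)
qed

text \<open>Positive and negative translates always occur in pairs, so \<open>nat\<close> can index
  the nonzero multiples of the period \<open>2 * a\<close>; \<open>Suc\<close> leaves out the zero
  translate.\<close>

definition node :: "real \<Rightarrow> nat \<Rightarrow> complex" where
  "node a n = of_real (2 * a * real (Suc n))"

lemma node_Re: "Re (node a n) = 2 * a * real (Suc n)" and node_Im: "Im (node a n) = 0"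
  unfolding node_def by (rule Re_complex_of_real, rule Im_complex_of_real)

lemma norm_node_ge:
  assumes "a > 0" "norm z < a"
  shows "norm (z + node a n) \<ge> 2 * a * real (Suc n) - norm z"
    and "norm (z - node a n) \<ge> 2 * a * real (Suc n) - norm z"
    and "norm (z + node a n) > a" and "norm (z - node a n) > a"
proof -
  have n: "norm (node a n) = 2 * a * real (Suc n)"
    unfolding node_def using assms by (simp only: norm_of_real) simp
  show 1: "norm (z + node a n) \<ge> 2 * a * real (Suc n) - norm z"
    using norm_triangle_ineq2[of "node a n" "-z"] n by (simp add: add.commute)
  show 2: "norm (z - node a n) \<ge> 2 * a * real (Suc n) - norm z"
    using norm_triangle_ineq2[of "node a n" "z"] n by (simp add: norm_minus_commute)
  have "2 * a * real (Suc n) - norm z > a" using assms two_mult_Suc_ge[of a n] by linarith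
  then show "norm (z + node a n) > a" "norm (z - node a n) > a" using 1 2 by auto
qed

text \<open>Up to a constant, the two reciprocals bound the two summands of the transfer
  operator.\<close>

definition gap :: "real \<Rightarrow> complex \<Rightarrow> nat \<Rightarrow> real" where
  "gap a z n = 1 / ((norm (z + node a n))\<^sup>2 - a\<^sup>2) + 1 / ((norm (z - node a n))\<^sup>2 - a\<^sup>2)"

lemma gap_pos:
  assumes "a > 0" "norm z < a"
  shows "gap a z n > 0"
  using norm_node_ge(3,4)[OF assms, of n] assms unfolding gap_def
  by (intro add_pos_pos divide_pos_pos) (auto intro!: power_strict_mono)

text \<open>Translation leaves \<open>Im z\<close> fixed, so with
  \<open>c\<^sup>2 = a\<^sup>2 - (Im z)\<^sup>2\<close> the terms become those of the real estimate
  at \<open>Re z\<close>. The first value \<open>r 0\<close> of the telescoping sequence is exactly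
  the bound claimed.\<close>

lemma gap_sum_le:
  assumes "a > 0" "norm z < a"
  shows "(\<Sum>n<N. gap a z n) \<le> 1 / (a\<^sup>2 - (norm z)\<^sup>2)"
proof -
  define x y where "x = Re z" and "y = Im z"
  have nz: "(norm z)\<^sup>2 = x\<^sup>2 + y\<^sup>2" by (simp add: cmod_power2 x_def y_def)
  have lt: "x\<^sup>2 + y\<^sup>2 < a\<^sup>2" using power_strict_mono[OF assms(2), of 2] nz by simp
  define c where "c = sqrt (a\<^sup>2 - y\<^sup>2)"
  have c2: "c\<^sup>2 = a\<^sup>2 - y\<^sup>2" using lt zero_le_power2[of x] unfolding c_def
    by (intro real_sqrt_pow2) linarith
  have c0: "c > 0" unfolding c_def using lt zero_le_power2[of x] by (intro real_sqrt_gt_zero) linarith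
  have ca: "c \<le> a" 
  proof (rule power2_le_imp_le)
    show "c\<^sup>2 \<le> a\<^sup>2" using c2 by simp
  qed (use assms in simp)
  have xc: "\<bar>x\<bar> < c" 
  proof (rule power2_less_imp_less)
    show "\<bar>x\<bar>\<^sup>2 < c\<^sup>2" using c2 lt by simp
  qed (use c0 in simp)
  define r where "r = (\<lambda>n::nat. (1 / (x + 2*a*real n + c) + 1 / (2*a*real n + c - x)) / (2*c))"
  have e: "(norm (z + node a n))\<^sup>2 - a\<^sup>2 = (x + 2*a*real (Suc n))\<^sup>2 - c\<^sup>2"
    "(norm (z - node a n))\<^sup>2 - a\<^sup>2 = (x - 2*a*real (Suc n))\<^sup>2 - c\<^sup>2" for n
    unfolding cmod_power2 plus_complex.sel minus_complex.sel node_Re node_Im c2 x_def y_def by simp_all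
  have "gap a z n \<le> r n - r (Suc n)" for n
    unfolding gap_def e r_def using lattice_sum_step[OF c0 ca xc] by simp
  then have "(\<Sum>n<N. gap a z n) \<le> (\<Sum>n<N. r n - r (Suc n))" by (intro sum_mono)
  also have "\<dots> = r 0 - r N" by (rule sum_lessThan_telescope')
  also have "\<dots> \<le> r 0"
  proof -
    have "2 * a * real N \<ge> 0" using assms by simp
    then have "x + 2 * a * real N + c \<ge> 0" "2 * a * real N + c - x \<ge> 0" using xc by linarith+
    then have "0 \<le> r N" unfolding r_def using c0
      by (meson add_nonneg_nonneg divide_nonneg_nonneg less_imp_le zero_le_numeral zero_le_one mult_nonneg_nonneg)
    then show ?thesis by simp
  qed
  also have "r 0 = 1 / (c\<^sup>2 - x\<^sup>2)"
  proof -
    have "c\<^sup>2 - x\<^sup>2 = (c - x) * (c + x)" by (simp add: power2_eq_square algebra_simps)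
    moreover have "c - x > 0" "c + x > 0" using xc by linarith+
    ultimately show ?thesis using c0 unfolding r_def by (simp add: divide_simps)
  qed
  also have "c\<^sup>2 - x\<^sup>2 = a\<^sup>2 - (norm z)\<^sup>2" using nz c2 by simp
  finally show ?thesis .
qed

lemma gap_summable:
  assumes "a > 0" "norm z < a"
  shows "summable (gap a z)"
  using summableI_nonneg_bounded[of "gap a z"] gap_pos[OF assms] gap_sum_le[OF assms]
  by (meson less_imp_le)

lemma gap_suminf_le:
  assumes "a > 0" "norm z < a"
  shows "suminf (gap a z) \<le> 1 / (a\<^sup>2 - (norm z)\<^sup>2)"
  by (intro suminf_le_const gap_summable gap_sum_le assms)

text \<open>A majorant for the whole disc of radius \<open>r\<close>, for use in the Weierstrass
  test. Both moduli are at least \<open>2 * a * real (Suc n) - r\<close>; at the point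
  \<open>r\<close> only the left translate attains this value, whence the factor 2.\<close>

lemma gap_le_real:
  assumes "0 < a" "r < a" "norm z \<le> r"
  shows "gap a z n \<le> 2 * gap a (of_real r) n"
proof -
  have r0: "0 \<le> r" using assms by (meson norm_ge_zero order_trans)
  define B where "B = 2 * a * real (Suc n) - r"
  have Ba: "B > a" unfolding B_def using assms two_mult_Suc_ge[of a n] by linarith
  have d: "B\<^sup>2 - a\<^sup>2 > 0" using power_strict_mono[OF Ba, of 2] assms by simp
  have "norm (of_real r - node a n) = B"
    using Ba assms unfolding B_def node_def
    by (simp only: of_real_diff[symmetric] norm_of_real)
  moreover have "1 / ((norm (of_real r + node a n))\<^sup>2 - a\<^sup>2) \<ge> 0"
    using norm_node_ge(3)[of a "of_real r" n] assms r0
    by (auto intro!: divide_nonneg_nonneg power_mono)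
  ultimately have g: "gap a (of_real r) n \<ge> 1 / (B\<^sup>2 - a\<^sup>2)"
    unfolding gap_def by simp
  have b: "norm (z + node a n) \<ge> B" "norm (z - node a n) \<ge> B"
    using norm_node_ge(1,2)[of a z n] assms unfolding B_def by linarith+
  have "1 / (t\<^sup>2 - a\<^sup>2) \<le> 1 / (B\<^sup>2 - a\<^sup>2)" if "t \<ge> B" for t
  proof (rule divide_left_mono)
    show "B\<^sup>2 - a\<^sup>2 \<le> t\<^sup>2 - a\<^sup>2" using that Ba assms by (simp add: power_mono)
    then show "0 < (t\<^sup>2 - a\<^sup>2) * (B\<^sup>2 - a\<^sup>2)" using d by (intro mult_pos_pos) linarith+
  qed simp
  from this[OF b(1)] this[OF b(2)] g show ?thesis
    unfolding gap_def[of a z] by linarith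
qed

text \<open>
  A square root of \<open>c / z ^ N\<close> is the multiplier of the functional equation relating
  the Gaussian transforms of a function and of its Fourier transform.
\<close>

locale half_weight =
  fixes \<kappa> :: "complex \<Rightarrow> complex" and c :: complex and N :: nat
  assumes sq: "z \<noteq> 0 \<Longrightarrow> (\<kappa> z)\<^sup>2 = c / z ^ N"
    and norm_c: "norm c = 1" and N5: "N \<ge> 5"
    and hol: "\<kappa> holomorphic_on {z. Re z \<noteq> 0}"
begin

lemma norm_sq: "z \<noteq> 0 \<Longrightarrow> (norm (\<kappa> z))\<^sup>2 = 1 / norm z ^ N"
  by (metis sq norm_c norm_divide norm_power)

lemma norm_less: "norm z > 1 \<Longrightarrow> norm (\<kappa> z) < 1 / (norm z)\<^sup>2"
proof -
  assume z: "norm z > 1"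
  have "(norm (\<kappa> z))\<^sup>2 = 1 / norm z ^ N" using z by (intro norm_sq) auto
  also have "\<dots> < 1 / norm z ^ 4"
    using z N5 by (intro divide_strict_left_mono power_strict_increasing mult_pos_pos zero_less_power) auto
  also have "\<dots> = (1 / (norm z)\<^sup>2)\<^sup>2" by (simp add: power_divide flip: power_mult)
  finally show ?thesis by (rule power2_less_imp_less) simp
qed

definition transfer_term :: "real \<Rightarrow> (complex \<Rightarrow> complex) \<Rightarrow> complex \<Rightarrow> nat \<Rightarrow> complex" where
  "transfer_term a G z n = \<kappa> (z + node a n) * G (- 1 / (z + node a n))
     + \<kappa> (z - node a n) * G (- 1 / (z - node a n))"

definition transfer :: "real \<Rightarrow> (complex \<Rightarrow> complex) \<Rightarrow> complex \<Rightarrow> complex" where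
  "transfer a G z = suminf (transfer_term a G z)"

text \<open>The inversion turns the weight \<open>a\<^sup>2 - (norm (1 / u))\<^sup>2\<close> into
  \<open>(a\<^sup>2 * (norm u)\<^sup>2 - 1) / (norm u)\<^sup>2\<close>. The factor
  \<open>(norm u)\<^sup>2\<close> cancels against the bound for \<open>\<kappa>\<close>, and
  \<open>a ^ 4 \<ge> 1\<close> lets a factor \<open>a\<^sup>2\<close> be extracted: this is the
  contraction constant.\<close>

lemma weight_bound:
  assumes "a \<ge> 1" "norm u > a" "K > 0" and G: "norm (G (- 1 / u)) \<le> K / (a\<^sup>2 - (norm (- 1 / u))\<^sup>2)"
  shows "norm (\<kappa> u * G (- 1 / u)) < K / a\<^sup>2 * (1 / ((norm u)\<^sup>2 - a\<^sup>2))"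
proof -
  have u1: "norm u > 1" and u0: "norm u > 0" using assms by auto
  have ua: "(norm u)\<^sup>2 > a\<^sup>2" using assms by (intro power_strict_mono) auto
  have a1: "a\<^sup>2 \<ge> 1" using assms by simp
  have g: "a\<^sup>2 * (norm u)\<^sup>2 - 1 \<ge> a\<^sup>2 * ((norm u)\<^sup>2 - a\<^sup>2)"
    using mult_mono[OF a1 a1] by (simp add: algebra_simps)
  have p: "a\<^sup>2 * ((norm u)\<^sup>2 - a\<^sup>2) > 0" using ua a1 by (intro mult_pos_pos) linarith+
  have G': "norm (G (- 1 / u)) \<le> K * (norm u)\<^sup>2 / (a\<^sup>2 * (norm u)\<^sup>2 - 1)"
  proof -
    have "a\<^sup>2 - (norm (- 1 / u))\<^sup>2 = (a\<^sup>2 * (norm u)\<^sup>2 - 1) / (norm u)\<^sup>2"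
      using u0 by (simp add: norm_divide power_divide diff_divide_distrib)
    with G show ?thesis by simp
  qed
  have pp: "K * (norm u)\<^sup>2 / (a\<^sup>2 * (norm u)\<^sup>2 - 1) > 0"
    using g p assms u0 by (intro divide_pos_pos mult_pos_pos) auto
  have "norm (\<kappa> u * G (- 1 / u)) \<le> norm (\<kappa> u) * (K * (norm u)\<^sup>2 / (a\<^sup>2 * (norm u)\<^sup>2 - 1))"
    unfolding norm_mult using G' by (intro mult_left_mono) auto
  also have "\<dots> < (1 / (norm u)\<^sup>2) * (K * (norm u)\<^sup>2 / (a\<^sup>2 * (norm u)\<^sup>2 - 1))"
    using norm_less[OF u1] pp by (intro mult_strict_right_mono)
  also have "\<dots> = K / (a\<^sup>2 * (norm u)\<^sup>2 - 1)" using u0 by simp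
  also have "\<dots> \<le> K / (a\<^sup>2 * ((norm u)\<^sup>2 - a\<^sup>2))"
    using g p assms ua a1 by (intro divide_left_mono mult_pos_pos) linarith+
  finally show ?thesis by simp
qed

context
  fixes a K :: real and G :: "complex \<Rightarrow> complex"
  assumes a: "a \<ge> 1" and K: "K > 0"
    and G: "\<And>u. norm u > a \<Longrightarrow> norm (G (- 1 / u)) \<le> K / (a\<^sup>2 - (norm (- 1 / u))\<^sup>2)"
begin

lemma transfer_term_less:
  assumes "norm z < a"
  shows "norm (transfer_term a G z n) < K / a\<^sup>2 * gap a z n"
proof -
  have "norm (transfer_term a G z n) \<le> norm (\<kappa> (z + node a n) * G (- 1 / (z + node a n)))
     + norm (\<kappa> (z - node a n) * G (- 1 / (z - node a n)))"
    unfolding transfer_term_def by (rule norm_triangle_ineq)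
  also have "\<dots> < K / a\<^sup>2 * (1 / ((norm (z + node a n))\<^sup>2 - a\<^sup>2))
      + K / a\<^sup>2 * (1 / ((norm (z - node a n))\<^sup>2 - a\<^sup>2))"
    using a K G norm_node_ge(3,4)[of a z n] assms by (intro add_strict_mono weight_bound) auto
  finally show ?thesis by (simp add: gap_def algebra_simps)
qed

lemma transfer_term_summable:
  assumes "norm z < a"
  shows "summable (transfer_term a G z)"
proof (rule summable_comparison_test')
  show "summable (\<lambda>n. K / a\<^sup>2 * gap a z n)" using gap_summable[of a z] assms a by auto
  show "norm (transfer_term a G z n) \<le> K / a\<^sup>2 * gap a z n" if "n \<ge> 0" for n
    using transfer_term_less[OF assms] by (simp add: less_imp_le)
qed

text \<open>Termwise strict inequalities stay strict in the sum, since the differences form a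
  convergent series of positive terms. For \<open>a = 1\<close> this strictness is all the gain
  there is.\<close>

lemma transfer_less:
  assumes "norm z < a"
  shows "norm (transfer a G z) < K / a\<^sup>2 / (a\<^sup>2 - (norm z)\<^sup>2)"
proof -
  have s: "summable (\<lambda>n. K / a\<^sup>2 * gap a z n)" using gap_summable[of a z] assms a by auto
  have sn: "summable (\<lambda>n. norm (transfer_term a G z n))"
    by (rule summable_comparison_test'[OF s, of 0])
      (use transfer_term_less[OF assms] in \<open>simp add: less_imp_le\<close>)
  have "norm (transfer a G z) \<le> (\<Sum>n. norm (transfer_term a G z n))"
    unfolding transfer_def by (rule summable_norm[OF sn])
  also have "\<dots> < (\<Sum>n. K / a\<^sup>2 * gap a z n)"
  proof -
    have "0 < (\<Sum>n. K / a\<^sup>2 * gap a z n - norm (transfer_term a G z n))"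
      using transfer_term_less[OF assms] by (intro suminf_pos summable_diff s sn) simp
    then show ?thesis using suminf_diff[OF s sn] by simp
  qed
  also have "\<dots> = K / a\<^sup>2 * suminf (gap a z)"
    using gap_summable[of a z] assms a by (intro suminf_mult) auto
  also have "\<dots> \<le> K / a\<^sup>2 * (1 / (a\<^sup>2 - (norm z)\<^sup>2))"
    using gap_suminf_le[of a z] assms a K by (intro mult_left_mono) auto
  finally show ?thesis by simp
qed

text \<open>\<open>\<kappa>\<close> is only known to be holomorphic off the imaginary axis. The
  discs of radius \<open>a\<close> around the nodes lie entirely on one side of it, and inversion
  maps them back into \<open>ball 0 a\<close>. Convergence is locally uniform by
  \<open>gap_le_real\<close>.\<close>

lemma transfer_holomorphic:
  assumes hG: "G holomorphic_on ball 0 a"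
  shows "transfer a G holomorphic_on ball 0 a"
proof (rule holomorphic_uniform_sequence)
  have re: "Re (z + node a n) > 0" "Re (z - node a n) < 0" if "norm z < a" for z n
  proof -
    have "\<bar>Re z\<bar> < a" using that abs_Re_le_cmod[of z] by linarith
    then show "Re (z + node a n) > 0" "Re (z - node a n) < 0"
      using a two_mult_Suc_ge[of a n] node_Re[of a n]
      unfolding plus_complex.sel minus_complex.sel by linarith+
  qed
  have inv: "norm (- 1 / u) < a" if "norm u > a" for u :: complex
  proof -
    have "1 < norm u * a" using that a
      using less_1_mult'[of "norm u" a] by linarith
    then show ?thesis using that a by (simp add: norm_divide divide_simps mult.commute)
  qed
  show "(\<lambda>z. \<Sum>i<n. transfer_term a G z i) holomorphic_on ball 0 a" for n
  proof -
    have "(\<lambda>z. \<kappa> (h z) * G (- 1 / h z)) holomorphic_on ball 0 a"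
      if h: "h holomorphic_on ball 0 a" and ne: "\<And>z. norm z < a \<Longrightarrow> Re (h z) \<noteq> 0"
        and big: "\<And>z. norm z < a \<Longrightarrow> a < norm (h z)" for h
    proof (intro holomorphic_on_mult)
      have "h ` ball 0 a \<subseteq> {z. Re z \<noteq> 0}" using ne by auto
      then show "(\<lambda>z. \<kappa> (h z)) holomorphic_on ball 0 a"
        using holomorphic_on_compose_gen[OF h hol] by (simp add: o_def)
      have "h z \<noteq> 0" if "z \<in> ball 0 a" for z using ne[of z] that by auto
      then have "(\<lambda>z. - 1 / h z) holomorphic_on ball 0 a" by (intro holomorphic_intros h)
      moreover have "(\<lambda>z. - 1 / h z) ` ball 0 a \<subseteq> ball 0 a" using inv big by auto
      ultimately show "(\<lambda>z. G (- 1 / h z)) holomorphic_on ball 0 a"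
        using holomorphic_on_compose_gen[OF _ hG] by (auto simp add: o_def)
    qed
    note this[of "\<lambda>z. z + node a n" for n] this[of "\<lambda>z. z - node a n" for n]
    moreover have "Re (z + node a n) \<noteq> 0" "Re (z - node a n) \<noteq> 0" if "norm z < a" for z n
      using re[OF that, of n] by auto
    moreover have "(\<lambda>z. z + node a n) holomorphic_on ball 0 a" "(\<lambda>z. z - node a n) holomorphic_on ball 0 a" for n
      by (intro holomorphic_intros)+
    moreover have "norm (z + node a n) > a" "norm (z - node a n) > a" if "norm z < a" for z n
      using norm_node_ge(3,4)[of a z n] a that by auto
    ultimately show ?thesis unfolding transfer_term_def
      by (intro holomorphic_on_sum holomorphic_on_add) simp_all
  qed
  fix x :: complex assume "x \<in> ball 0 a"
  then have x: "norm x < a" by simp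
  define r where "r = (a + norm x) / 2"
  have r: "norm x < r" "r < a" using x by (auto simp: r_def)
  have sub: "norm z \<le> r" if "z \<in> cball x (r - norm x)" for z
    using that norm_triangle_ineq2[of z x] by (simp add: dist_norm norm_minus_commute)
  have "uniform_limit (cball x (r - norm x)) (\<lambda>n z. \<Sum>i<n. transfer_term a G z i)
      (\<lambda>z. suminf (transfer_term a G z)) sequentially"
  proof (rule Weierstrass_m_test)
    show "summable (\<lambda>n. K / a\<^sup>2 * (2 * gap a (of_real r) n))"
      using gap_summable[of a "of_real r"] r a x
      by (intro summable_mult) (use norm_ge_zero[of x] in \<open>auto simp del: norm_ge_zero\<close>)
    fix n z assume "z \<in> cball x (r - norm x)"
    then have z: "norm z \<le> r" by (rule sub)
    have "norm (transfer_term a G z n) \<le> K / a\<^sup>2 * gap a z n"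
      using transfer_term_less[of z n] z r by (simp add: less_imp_le)
    also have "\<dots> \<le> K / a\<^sup>2 * (2 * gap a (of_real r) n)"
      using gap_le_real[of a r z n] z r a K by (intro mult_left_mono) auto
    finally show "norm (transfer_term a G z n) \<le> K / a\<^sup>2 * (2 * gap a (of_real r) n)" .
  qed
  moreover have "cball x (r - norm x) \<subseteq> ball 0 a" using sub r by (meson in_mono mem_ball_0 order_le_less_trans subsetI)
  ultimately show "\<exists>d>0. cball x d \<subseteq> ball 0 a \<and>
      uniform_limit (cball x d) (\<lambda>n z. \<Sum>i<n. transfer_term a G z i) (transfer a G) sequentially"
    using r unfolding transfer_def by (intro exI[of _ "r - norm x"]) simp
qed simp

end

end

section \<open>The weighted norm and functions on the real line\<close>

context half_weight
begin

text \<open>The weighted supremum norm, given as a predicate on its upper bounds so that no supremum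
  has to be handled.\<close>

definition weighted_bound :: "real \<Rightarrow> real \<Rightarrow> (complex \<Rightarrow> complex) \<Rightarrow> bool" where
  "weighted_bound a K G \<longleftrightarrow> (\<forall>z. norm z < a \<longrightarrow> norm (G z) \<le> K / (a\<^sup>2 - (norm z)\<^sup>2))"

lemma weighted_boundD:
  assumes "weighted_bound a K G" "a \<ge> 1" "norm u > a"
  shows "norm (G (- 1 / u)) \<le> K / (a\<^sup>2 - (norm (- 1 / u))\<^sup>2)"
proof -
  have "1 < norm u * a" using assms less_1_mult'[of "norm u" a] by linarith
  then have "norm (- 1 / u) < a" using assms by (simp add: norm_divide divide_simps mult.commute)
  then show ?thesis using assms(1) unfolding weighted_bound_def by blast
qed

lemma square_gap_pos: "norm z < a \<Longrightarrow> a\<^sup>2 - (norm z)\<^sup>2 > 0" for z :: complex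
  using power_strict_mono[of "norm z" a 2] by simp

lemma weighted_bound_diff:
  assumes "weighted_bound a K G" "weighted_bound a K' G'"
  shows "weighted_bound a (K + K') (\<lambda>z. G z - G' z)"
  unfolding weighted_bound_def
proof (intro allI impI)
  fix z :: complex assume "norm z < a"
  then have "norm (G z) + norm (G' z) \<le> K / (a\<^sup>2 - (norm z)\<^sup>2) + K' / (a\<^sup>2 - (norm z)\<^sup>2)"
    using assms unfolding weighted_bound_def by (intro add_mono) auto
  then show "norm (G z - G' z) \<le> (K + K') / (a\<^sup>2 - (norm z)\<^sup>2)"
    using norm_triangle_ineq4[of "G z" "G' z"] by (simp add: add_divide_distrib)
qed

lemma weighted_bound_transfer:
  assumes "a \<ge> 1" "K > 0" "weighted_bound a K G"
  shows "weighted_bound a (K / a\<^sup>2) (transfer a G)"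
  unfolding weighted_bound_def
  using transfer_less[OF assms(1,2) weighted_boundD[OF assms(3,1)]] by (simp add: less_imp_le)

text \<open>A function known only on the real line is treated as a function of \<open>Re z\<close>,
  so that the estimates for \<open>transfer\<close> apply to it. The weight at \<open>z\<close> is
  at most that at \<open>Re z\<close>, so bounds carry over.\<close>

lemma weighted_bound_real:
  assumes "K > 0" and g: "\<And>t. \<bar>t\<bar> < a \<Longrightarrow> norm (g t) \<le> K / (a\<^sup>2 - t\<^sup>2)"
  shows "weighted_bound a K (\<lambda>z. g (Re z))"
  unfolding weighted_bound_def
proof (intro allI impI)
  fix z :: complex assume z: "norm z < a"
  have r: "\<bar>Re z\<bar> \<le> norm z" by (rule abs_Re_le_cmod)
  have "norm (g (Re z)) \<le> K / (a\<^sup>2 - (Re z)\<^sup>2)" using z r by (intro g) linarith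
  also have "\<dots> \<le> K / (a\<^sup>2 - (norm z)\<^sup>2)"
    using square_gap_pos[OF z] power_mono[OF r, of 2] assms
    by (intro divide_left_mono mult_pos_pos) auto
  finally show "norm (g (Re z)) \<le> K / (a\<^sup>2 - (norm z)\<^sup>2)" .
qed

lemma transfer_diff:
  assumes "a \<ge> 1" "K > 0" "weighted_bound a K G" "K' > 0" "weighted_bound a K' G'" "norm z < a"
  shows "transfer a (\<lambda>z. G z - G' z) z = transfer a G z - transfer a G' z"
proof -
  have "transfer_term a (\<lambda>z. G z - G' z) z = (\<lambda>n. transfer_term a G z n - transfer_term a G' z n)"
    unfolding transfer_term_def by (simp add: fun_eq_iff algebra_simps)
  then show ?thesis unfolding transfer_def
    using suminf_diff[OF transfer_term_summable[OF assms(1,2) weighted_boundD[OF assms(3,1)] assms(6)]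
      transfer_term_summable[OF assms(1,4) weighted_boundD[OF assms(5,1)] assms(6)]] by simp
qed

lemma real_node: "of_real t + node a n = of_real (t + 2 * a * real (Suc n))"
  "of_real t - node a n = of_real (t - 2 * a * real (Suc n))"
  unfolding node_def by (simp_all only: of_real_add of_real_diff)

text \<open>Nodes and inversion preserve the real line, so at real points only the values on the
  real line matter.\<close>

lemma transfer_real:
  "transfer a (\<lambda>z. G (of_real (Re z))) (of_real t) = transfer a G (of_real t)"
proof -
  have "of_real (Re (- 1 / of_real s)) = (- 1 / of_real s :: complex)" for s
    by (metis Re_complex_of_real of_real_divide of_real_minus of_real_1)
  then show ?thesis unfolding transfer_def transfer_term_def real_node by simp
qed

section \<open>Fixed points of the transfer operator\<close>

context
  fixes a :: real and H :: "bool \<Rightarrow> real \<Rightarrow> complex" and P :: "bool \<Rightarrow> complex \<Rightarrow> complex"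
    and \<sigma> :: "bool \<Rightarrow> complex"
  assumes a: "a \<ge> 1"
    and contH: "\<And>b. continuous_on UNIV (H b)"
    and sigma: "\<And>b. norm (\<sigma> b) = 1"
    and fe: "\<And>b t. t \<noteq> 0 \<Longrightarrow> H b t = \<sigma> b * \<kappa> (of_real t) * H (\<not> b) (- 1 / t)"
    and per: "\<And>b t. (\<lambda>n. H b (t + 2 * a * real (Suc n)) + H b (t - 2 * a * real (Suc n)))
        sums (P b (of_real t) - H b t)"
    and holP: "\<And>b. P b holomorphic_on UNIV"
begin

text \<open>The truth values index the two functions, which the functional equation exchanges. It
  turns each nonzero translate in the periodization \<open>per\<close> into a term of
  \<open>transfer\<close>; the zero translate is the one solved for.\<close>

lemma real_transfer_eq:
  assumes "\<bar>t\<bar> < a"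
  shows "H b t = P b (of_real t) - \<sigma> b * transfer a (\<lambda>z. H (\<not> b) (Re z)) (of_real t)"
proof -
  have ne: "t + 2 * a * real (Suc n) \<noteq> 0" "t - 2 * a * real (Suc n) \<noteq> 0" for n
    using assms a two_mult_Suc_ge[of a n] by linarith+
  have re: "Re (- 1 / of_real s) = - 1 / s" for s
    by (metis Re_complex_of_real of_real_divide of_real_minus of_real_1)
  have "\<sigma> b * transfer_term a (\<lambda>z. H (\<not> b) (Re z)) (of_real t) n
      = H b (t + 2 * a * real (Suc n)) + H b (t - 2 * a * real (Suc n))" for n
    unfolding fe[OF ne(1)[of n], of b] fe[OF ne(2)[of n], of b] transfer_term_def real_node re
    by (simp only: distrib_left mult.assoc)
  then have "(\<lambda>n. \<sigma> b * transfer_term a (\<lambda>z. H (\<not> b) (Re z)) (of_real t) n) sums (P b (of_real t) - H b t)"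
    using per[where b=b and t=t] by simp
  moreover have "\<sigma> b \<noteq> 0" using sigma[of b] by auto
  ultimately have "transfer_term a (\<lambda>z. H (\<not> b) (Re z)) (of_real t) sums ((P b (of_real t) - H b t) / \<sigma> b)"
    using sums_divide[of "\<lambda>n. \<sigma> b * transfer_term a (\<lambda>z. H (\<not> b) (Re z)) (of_real t) n" _ "\<sigma> b"] by simp
  then have "transfer a (\<lambda>z. H (\<not> b) (Re z)) (of_real t) = (P b (of_real t) - H b t) / \<sigma> b"
    unfolding transfer_def using sums_unique by metis
  then show ?thesis using \<open>\<sigma> b \<noteq> 0\<close> by simp
qed

text \<open>Inversion moves \<open>\<bar>t\<bar> > 1\<close> into the open unit interval, and
  continuity covers the two endpoints.\<close>

lemma zero_outside:
  assumes "\<And>b t. \<bar>t\<bar> < 1 \<Longrightarrow> H b t = 0"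
  shows "H b t = 0"
proof -
  consider "\<bar>t\<bar> \<le> 1" | "\<bar>t\<bar> > 1" by linarith
  then show ?thesis
  proof cases
    case 1
    then have t: "t \<in> closure {-1<..<1}" by (auto simp: closure_greaterThanLessThan)
    show ?thesis
      by (rule continuous_constant_on_closure[OF continuous_on_subset[OF contH] _ t])
        (use assms in auto)
  next
    case 2
    then have "\<bar>- 1 / t\<bar> < 1" by simp
    then show ?thesis using fe[of t b] 2 assms by auto
  qed
qed

text \<open>The weight \<open>1 - t\<^sup>2\<close> vanishes at both endpoints, so a positive
  maximum \<open>S\<close>, taken over both functions at once, is attained at an interior point.
  There the strict bound of \<open>transfer_less\<close> gives a value below
  \<open>S\<close>.\<close>

theorem critical_uniqueness:
  assumes a1: "a = 1" and P0: "\<And>b z. P b z = 0"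
  shows "H b t = 0"
proof (rule zero_outside)
  define \<phi> where "\<phi> = (\<lambda>b t. (1 - t\<^sup>2) * norm (H b t))"
  have c: "continuous_on {-1..1} (\<phi> b)" for b
    unfolding \<phi>_def by (intro continuous_intros continuous_on_subset[OF contH]) auto
  have "\<exists>x\<in>{-1..1}. \<forall>y\<in>{-1..1}. \<phi> b y \<le> \<phi> b x" for b
    by (rule continuous_attains_sup[OF _ _ c]) auto
  then obtain x where x: "\<And>b. x b \<in> {-1..1}" "\<And>b y. y \<in> {-1..1} \<Longrightarrow> \<phi> b y \<le> \<phi> b (x b)" by metis
  obtain b0 where b0: "\<And>b. \<phi> b (x b) \<le> \<phi> b0 (x b0)"
    using linear[of "\<phi> True (x True)" "\<phi> False (x False)"] by (metis (full_types) order_refl)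
  define S s where "S = \<phi> b0 (x b0)" and "s = x b0"
  have S: "\<phi> b y \<le> S" if "\<bar>y\<bar> \<le> 1" for b y
    unfolding S_def using that by (intro order_trans[OF x(2) b0]) auto
  have "S \<le> 0"
  proof (rule ccontr)
    assume "\<not> S \<le> 0"
    then have S0: "S > 0" by simp
    have s1: "\<bar>s\<bar> \<le> 1" using x(1)[of b0] unfolding s_def by auto
    have "s \<noteq> 1" "s \<noteq> -1" using S0 unfolding S_def s_def[symmetric] \<phi>_def by auto
    then have s: "\<bar>s\<bar> < 1" using s1 by auto
    have wb: "weighted_bound a S (\<lambda>z. H (\<not> b0) (Re z))"
    proof (rule weighted_bound_real[OF S0])
      fix t :: real assume t: "\<bar>t\<bar> < a"
      then have "a\<^sup>2 - t\<^sup>2 > 0" using square_gap_pos[of "of_real t" a] by simp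
      then show "norm (H (\<not> b0) t) \<le> S / (a\<^sup>2 - t\<^sup>2)"
        using S[of t "\<not> b0"] t unfolding \<phi>_def a1 by (simp add: pos_le_divide_eq mult.commute)
    qed
    have "norm (H b0 s) = norm (transfer a (\<lambda>z. H (\<not> b0) (Re z)) (of_real s))"
      using real_transfer_eq[of s b0] s a1 P0 sigma by (simp add: norm_mult)
    also have "\<dots> < S / a\<^sup>2 / (a\<^sup>2 - (norm (of_real s :: complex))\<^sup>2)"
      using s a1 by (intro transfer_less[OF a S0 weighted_boundD[OF wb a]]) auto
    also have "\<dots> = S / (1 - s\<^sup>2)" by (simp add: a1)
    finally have "norm (H b0 s) < S / (1 - s\<^sup>2)" .
    moreover have "1 - s\<^sup>2 > 0" using s by (simp add: abs_square_less_1)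
    ultimately have "(1 - s\<^sup>2) * norm (H b0 s) < S" by (simp add: pos_less_divide_eq mult.commute)
    then show False unfolding S_def s_def \<phi>_def by simp
  qed
  then show "H b t = 0" if "\<bar>t\<bar> < 1" for b t
  proof -
    have "1 - t\<^sup>2 > 0" using that by (simp add: abs_square_less_1)
    moreover have "(1 - t\<^sup>2) * norm (H b t) \<le> 0"
      using S[of t b] \<open>S \<le> 0\<close> that unfolding \<phi>_def by linarith
    ultimately show ?thesis by (simp add: mult_le_0_iff)
  qed
qed

text \<open>Partial sums of the Neumann series, started at 0 rather than at \<open>H\<close>: they
  are holomorphic on the disc, whereas \<open>H\<close> lives on the real line only.\<close>

primrec iterate :: "nat \<Rightarrow> bool \<Rightarrow> complex \<Rightarrow> complex" where
  "iterate 0 b z = 0"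
| "iterate (Suc n) b z = P b z - \<sigma> b * transfer a (iterate n (\<not> b)) z"

lemma weighted_bound_const: "weighted_bound a K G \<Longrightarrow> weighted_bound a K (\<lambda>z. \<sigma> b * G z)"
  unfolding weighted_bound_def by (simp add: norm_mult sigma)

lemma initial_bound:
  obtains K where "K > 0" "\<And>b. weighted_bound a K (P b)"
    "\<And>b t. \<bar>t\<bar> < a \<Longrightarrow> norm (H b t) \<le> K / (a\<^sup>2 - t\<^sup>2)"
proof -
  have "\<exists>K. \<forall>z\<in>cball 0 a. norm (P b z) \<le> K" for b
    using compact_imp_bounded[OF compact_continuous_image[OF _ compact_cball[of 0 a], of "P b"]]
      holomorphic_on_imp_continuous_on[OF holP[of b]]
    by (auto simp: bounded_iff intro: continuous_on_subset)
  then obtain K1 where K1: "\<And>b z. z \<in> cball 0 a \<Longrightarrow> norm (P b z) \<le> K1 b" by metis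
  have "\<exists>K. \<forall>t\<in>{-a..a}. norm (H b t) \<le> K" for b
    using compact_imp_bounded[OF compact_continuous_image[OF _ compact_Icc[of "-a" a], of "H b"]]
      contH[of b] by (auto simp: bounded_iff intro: continuous_on_subset)
  then obtain K2 where K2: "\<And>b t. t \<in> {-a..a} \<Longrightarrow> norm (H b t) \<le> K2 b" by metis
  define M where "M = 1 + \<bar>K1 True\<bar> + \<bar>K1 False\<bar> + \<bar>K2 True\<bar> + \<bar>K2 False\<bar>"
  have M: "K1 b \<le> M" "K2 b \<le> M" for b unfolding M_def by (cases b; simp)+
  have M0: "M > 0" unfolding M_def by simp
  \<comment> \<open>The weight never exceeds \<open>a\<^sup>2\<close>, so a plain bound
    \<open>M\<close> gives the weighted bound \<open>M * a\<^sup>2\<close>.\<close>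
  have le: "x \<le> M * a\<^sup>2 / (a\<^sup>2 - r\<^sup>2)" if "x \<le> M" "\<bar>r\<bar> < a" for x r :: real
  proof -
    have r2: "a\<^sup>2 - r\<^sup>2 > 0" using square_gap_pos[of "of_real r" a] that by simp
    have "M * (a\<^sup>2 - r\<^sup>2) \<le> M * a\<^sup>2" using M0 by simp
    then have "M \<le> M * a\<^sup>2 / (a\<^sup>2 - r\<^sup>2)" using r2 by (simp add: pos_le_divide_eq)
    with that show ?thesis by simp
  qed
  show thesis
  proof (rule that[of "M * a\<^sup>2"])
    show "M * a\<^sup>2 > 0" using M0 a by simp
    show "weighted_bound a (M * a\<^sup>2) (P b)" for b
      unfolding weighted_bound_def using order_trans[OF K1[of _ b] M(1)[of b]] by (intro allI impI le) auto
    show "norm (H b t) \<le> M * a\<^sup>2 / (a\<^sup>2 - t\<^sup>2)" if "\<bar>t\<bar> < a" for b t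
      using K2[of t b] M(2)[of b] that by (intro le) (auto simp: abs_less_iff)
  qed
qed

text \<open>The iterates converge geometrically with ratio \<open>1 / a\<^sup>2\<close> in two
  senses: their successive differences on the complex disc, which makes the limit holomorphic, and
  their distance to \<open>H\<close> on the real interval, which identifies the limit.\<close>

lemma holomorphic_extension:
  assumes a1: "a > 1"
  obtains L where "L holomorphic_on ball 0 a" "\<And>t. \<bar>t\<bar> < a \<Longrightarrow> L (of_real t) = H b t"
proof -
  obtain K where K: "K > 0" "\<And>b. weighted_bound a K (P b)"
    "\<And>b t. \<bar>t\<bar> < a \<Longrightarrow> norm (H b t) \<le> K / (a\<^sup>2 - t\<^sup>2)" using initial_bound by blast
  \<comment> \<open>These bounds may depend on \<open>n\<close>. They serve to make the series
    converge, so that \<open>transfer\<close> is holomorphic and respects differences.\<close>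
  have bd: "\<exists>K'>0. weighted_bound a K' (iterate n b)" for n b
  proof (induction n arbitrary: b)
    case 0
    show ?case using square_gap_pos[of _ a]
      by (intro exI[of _ 1]) (auto simp: weighted_bound_def intro!: less_imp_le)
  next
    case (Suc n)
    then obtain K' where K': "K' > 0" "weighted_bound a K' (iterate n (\<not> b))" by blast
    then have "weighted_bound a (K + K' / a\<^sup>2) (iterate (Suc n) b)"
      using weighted_bound_diff[OF K(2) weighted_bound_const[OF weighted_bound_transfer[OF a K']], of b b]
      by (simp add: weighted_bound_def)
    moreover have "K + K' / a\<^sup>2 > 0" using K(1) K'(1) a by (intro add_pos_pos divide_pos_pos) auto
    ultimately show ?case by blast
  qed
  have hol_it: "iterate n b holomorphic_on ball 0 a" for n b
  proof (induction n arbitrary: b)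
    case 0
    show ?case by simp
  next
    case (Suc n)
    obtain K' where K': "K' > 0" "weighted_bound a K' (iterate n (\<not> b))" using bd by blast
    have "transfer a (iterate n (\<not> b)) holomorphic_on ball 0 a"
      using Suc K' by (intro transfer_holomorphic[OF a K'(1) weighted_boundD[OF K'(2) a]]) auto
    then show ?case using holomorphic_on_subset[OF holP] by (auto intro!: holomorphic_intros)
  qed
  define q where "q = 1 / a\<^sup>2"
  have "a\<^sup>2 > 1" using a1 by (simp add: one_less_power)
  then have q: "0 < q" "q < 1" unfolding q_def by (auto simp: divide_less_eq_1)
  have Kq: "K * q ^ n > 0" for n using K q by simp
  have step: "weighted_bound a (K * q ^ n) (\<lambda>z. iterate (Suc n) b z - iterate n b z)" for n b
  proof (induction n arbitrary: b)
    case 0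
    have "transfer a (iterate 0 b) z = 0" for b z
      unfolding transfer_def transfer_term_def by simp
    then show ?case using K(2)[of b] by (simp add: weighted_bound_def)
  next
    case (Suc n)
    obtain K1 K2 where K12: "K1 > 0" "weighted_bound a K1 (iterate (Suc n) (\<not> b))"
      "K2 > 0" "weighted_bound a K2 (iterate n (\<not> b))" using bd by meson
    have e: "iterate (Suc (Suc n)) b z - iterate (Suc n) b z =
        - \<sigma> b * transfer a (\<lambda>z. iterate (Suc n) (\<not> b) z - iterate n (\<not> b) z) z" if "norm z < a" for z
      unfolding transfer_diff[OF a K12 that] by (simp add: algebra_simps del: iterate.simps add: iterate.simps(2)[of _ b])
    have "weighted_bound a (K * q ^ n / a\<^sup>2) (\<lambda>z. \<sigma> b * transfer a (\<lambda>z. iterate (Suc n) (\<not> b) z - iterate n (\<not> b) z) z)"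
      by (intro weighted_bound_const weighted_bound_transfer a Kq Suc)
    then show ?case unfolding weighted_bound_def using e by (simp add: q_def norm_mult del: iterate.simps)
  qed
  \<comment> \<open>On the real line \<open>H\<close> is a fixed point of the recursion that defines
    the iterates, so each step shrinks the distance by the factor \<open>q\<close>.\<close>
  have close: "norm (H b t - iterate n b (of_real t)) \<le> K * q ^ n / (a\<^sup>2 - t\<^sup>2)" if "\<bar>t\<bar> < a" for n b t
    using that
  proof (induction n arbitrary: b t)
    case 0
    then show ?case using K(3)[of t b] by simp
  next
    case (Suc n)
    define G1 where "G1 = (\<lambda>z. H (\<not> b) (Re z))"
    define G2 where "G2 = (\<lambda>z. iterate n (\<not> b) (of_real (Re z)))"
    have D: "weighted_bound a (K * q ^ n) (\<lambda>z. G1 z - G2 z)"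
      unfolding G1_def G2_def using Suc.IH
      by (intro weighted_bound_real[OF Kq, of _ "\<lambda>t. H (\<not> b) t - iterate n (\<not> b) (of_real t)"]) auto
    obtain K2 where K2: "K2 > 0" "weighted_bound a K2 (iterate n (\<not> b))" using bd by meson
    have G2: "weighted_bound a K2 G2" unfolding G2_def
    proof (rule weighted_bound_real[OF K2(1), of _ "\<lambda>t. iterate n (\<not> b) (of_real t)"])
      show "norm (iterate n (\<not> b) (of_real t)) \<le> K2 / (a\<^sup>2 - t\<^sup>2)" if "\<bar>t\<bar> < a" for t
        using K2(2)[unfolded weighted_bound_def, rule_format, of "of_real t"] that by simp
    qed
    \<comment> \<open>Writing \<open>G1\<close> as \<open>G2 - (G2 - G1)\<close> gives it a bound of
      its own, as \<open>transfer_diff\<close> requires.\<close>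
    have "weighted_bound a (K2 + K * q ^ n) (\<lambda>z. G2 z - (G2 z - G1 z))"
    proof (rule weighted_bound_diff[OF G2])
      show "weighted_bound a (K * q ^ n) (\<lambda>z. G2 z - G1 z)"
        using D by (simp add: weighted_bound_def norm_minus_commute)
    qed
    then have G1: "weighted_bound a (K2 + K * q ^ n) G1" by simp
    have "H b t - iterate (Suc n) b (of_real t) = - \<sigma> b * (transfer a G1 (of_real t) - transfer a G2 (of_real t))"
      using real_transfer_eq[OF Suc.prems, of b] unfolding G1_def G2_def transfer_real by (simp add: algebra_simps)
    also have "transfer a G1 (of_real t) - transfer a G2 (of_real t) = transfer a (\<lambda>z. G1 z - G2 z) (of_real t)"
      using Suc.prems Kq[of n] K2 by (intro transfer_diff[symmetric, OF a _ G1 _ G2]) auto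
    finally have "norm (H b t - iterate (Suc n) b (of_real t)) = norm (transfer a (\<lambda>z. G1 z - G2 z) (of_real t))"
      by (simp add: norm_mult sigma)
    also have "\<dots> \<le> K * q ^ n / a\<^sup>2 / (a\<^sup>2 - (norm (of_real t :: complex))\<^sup>2)"
      using weighted_bound_transfer[OF a Kq D, unfolded weighted_bound_def, rule_format, of "of_real t"]
        Suc.prems by simp
    also have "\<dots> = K * q ^ Suc n / (a\<^sup>2 - t\<^sup>2)" by (simp add: q_def)
    finally show ?case .
  qed
  define L where "L = (\<lambda>z. \<Sum>n. iterate (Suc n) b z - iterate n b z)"
  have ul: "uniform_limit (cball 0 r) (\<lambda>n z. iterate n b z) L sequentially" if r: "0 \<le> r" "r < a" for r
  proof -
    have "uniform_limit (cball 0 r) (\<lambda>n z. \<Sum>i<n. iterate (Suc i) b z - iterate i b z)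
        (\<lambda>z. \<Sum>n. iterate (Suc n) b z - iterate n b z) sequentially"
    proof (rule Weierstrass_m_test)
      have "summable (\<lambda>n. K / (a\<^sup>2 - r\<^sup>2) * q ^ n)" using q by (intro summable_mult summable_geometric) auto
      then show "summable (\<lambda>n. K * q ^ n / (a\<^sup>2 - r\<^sup>2))" by simp
      fix n and z :: complex assume z: "z \<in> cball 0 r"
      then have za: "norm z < a" "norm z \<le> r" using r by auto
      have "norm (iterate (Suc n) b z - iterate n b z) \<le> K * q ^ n / (a\<^sup>2 - (norm z)\<^sup>2)"
        using step[of n b] za unfolding weighted_bound_def by blast
      also have "\<dots> \<le> K * q ^ n / (a\<^sup>2 - r\<^sup>2)"
      proof -
        have "a\<^sup>2 - r\<^sup>2 > 0" using square_gap_pos[of "of_real r" a] r by simp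
        then show ?thesis using square_gap_pos[OF za(1)] power_mono[OF za(2) norm_ge_zero, of 2] Kq[of n]
          by (intro divide_left_mono mult_pos_pos) linarith+
      qed
      finally show "norm (iterate (Suc n) b z - iterate n b z) \<le> K * q ^ n / (a\<^sup>2 - r\<^sup>2)" .
    qed
    moreover have "(\<Sum>i<n. iterate (Suc i) b z - iterate i b z) = iterate n b z" for n z
      using sum_lessThan_telescope[of "\<lambda>i. iterate i b z" n] by (simp only: iterate.simps(1) diff_zero)
    ultimately show ?thesis unfolding L_def by (simp only:)
  qed
  show thesis
  proof (rule that[of L])
    show "L holomorphic_on ball 0 a"
    proof (rule holomorphic_uniform_sequence[OF open_ball hol_it])
      fix x :: complex assume "x \<in> ball 0 a"
      then have x: "norm x < a" by simp
      define r where "r = (a + norm x) / 2"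
      have r: "0 \<le> r" "norm x < r" "r < a" using x a by (auto simp: r_def)
      have sub: "cball x (r - norm x) \<subseteq> cball 0 r"
      proof
        fix z assume "z \<in> cball x (r - norm x)"
        then show "z \<in> cball 0 r" using norm_triangle_ineq2[of z x] by (simp add: dist_norm norm_minus_commute)
      qed
      moreover have "cball (0::complex) r \<subseteq> ball 0 a" using r by auto
      ultimately show "\<exists>d>0. cball x d \<subseteq> ball 0 a \<and> uniform_limit (cball x d) (\<lambda>n. iterate n b) L sequentially"
        using r uniform_limit_on_subset[OF ul[OF r(1,3)] sub]
        by (intro exI[of _ "r - norm x"] conjI) (simp, blast, simp only:)
    qed
    fix t :: real assume t: "\<bar>t\<bar> < a"
    have "(\<lambda>n. iterate n b (of_real t)) \<longlonglongrightarrow> L (of_real t)"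
      using tendsto_uniform_limitI[OF ul[of "\<bar>t\<bar>"], of "of_real t"] t by simp
    moreover have "(\<lambda>n. iterate n b (of_real t)) \<longlonglongrightarrow> H b t"
    proof -
      have "(\<lambda>n. K / (a\<^sup>2 - t\<^sup>2) * q ^ n) \<longlonglongrightarrow> K / (a\<^sup>2 - t\<^sup>2) * 0"
        using q by (intro tendsto_intros LIMSEQ_realpow_zero) auto
      then have "(\<lambda>n. K * q ^ n / (a\<^sup>2 - t\<^sup>2)) \<longlonglongrightarrow> 0" by simp
      then have "(\<lambda>n. H b t - iterate n b (of_real t)) \<longlonglongrightarrow> 0"
        by (rule Lim_null_comparison[OF always_eventually[OF allI[OF close[OF t]]]])
      from tendsto_diff[OF tendsto_const[of "H b t"] this] show ?thesis by simp
    qed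
    ultimately show "L (of_real t) = H b t" by (rule LIMSEQ_unique)
  qed
qed

text \<open>
  The squares of the extensions satisfy a functional equation with a single-valued multiplier,
  hence continue to bounded entire functions vanishing at infinity.
\<close>

theorem supercritical_uniqueness:
  assumes a1: "a > 1"
  shows "H b t = 0"
proof (rule zero_outside)
  have "\<exists>L. L holomorphic_on ball 0 a \<and> (\<forall>t. \<bar>t\<bar> < a \<longrightarrow> L (of_real t) = H b t)" for b
    using holomorphic_extension[OF a1, of b] by metis
  then obtain L where hL: "\<And>b. L b holomorphic_on ball 0 a"
    and L: "\<And>b t. \<bar>t\<bar> < a \<Longrightarrow> L b (of_real t) = H b t" by metis
  have "L b z = 0" if z: "norm z < a" for b z
  proof -
    define E where "E = (\<lambda>z. (L b z)\<^sup>2)"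
    define E' where "E' = (\<lambda>z. (L (\<not> b) z)\<^sup>2)"
    define \<mu> where "\<mu> = (\<sigma> b)\<^sup>2 * c"
    have hE: "E holomorphic_on ball 0 a" and hE': "E' holomorphic_on ball 0 a"
      unfolding E_def E'_def by (intro holomorphic_intros hL)+
    \<comment> \<open>Off this disc the inversion lands in \<open>ball 0 a\<close>. As
      \<open>1 / a < a\<close>, the two domains cover the plane and overlap in an annulus around the
      unit circle.\<close>
    define B where "B = - cball (0::complex) (1 / a)"
    have B: "z \<noteq> 0" "norm (- 1 / z) < a" if "z \<in> B" for z
    proof -
      have n: "1 / a < norm z" using that unfolding B_def by simp
      moreover have "1 / a > 0" using a1 by simp
      ultimately have "norm z > 0" by linarith
      then show "z \<noteq> 0" "norm (- 1 / z) < a"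
        using n a1 by (auto simp: norm_divide divide_simps mult.commute)
    qed
    define R where "R = (\<lambda>z. \<mu> / z ^ N * E' (- 1 / z))"
    have hR: "R holomorphic_on B"
    proof -
      have "(\<lambda>z. - 1 / z) holomorphic_on B" using B(1) by (intro holomorphic_intros) auto
      moreover have "(\<lambda>z. - 1 / z) ` B \<subseteq> ball 0 a" using B(2) by auto
      ultimately have "(\<lambda>z. E' (- 1 / z)) holomorphic_on B"
        using holomorphic_on_compose_gen[OF _ hE'] by (auto simp: o_def)
      then show ?thesis unfolding R_def using B(1) by (intro holomorphic_intros) auto
    qed
    have eq: "E z = R z" if zA: "z \<in> ball 0 a" "z \<in> B" for z
    proof -
      define A where "A = {z::complex. 1 / a < norm (z - 0) \<and> norm (z - 0) < a}"
      define U where "U = (of_real ` {1 / a<..<a} :: complex set)"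
      have A: "A = ball 0 a \<inter> B" unfolding A_def B_def by auto
      have "E z - R z = 0"
      \<comment> \<open>The squared functional equation is known on a real segment around 1. The
        annulus is connected, so the identity spreads to all of it.\<close>
      proof (rule analytic_continuation[where S=A and U=U and \<xi>=1 and f="\<lambda>z. E z - R z"])
        show "(\<lambda>z. E z - R z) holomorphic_on A"
          unfolding A by (intro holomorphic_intros holomorphic_on_subset[OF hE] holomorphic_on_subset[OF hR]) auto
        show "open A" unfolding A B_def by (auto intro!: open_Int)
        show "connected A" unfolding A_def by (rule connected_annulus) simp
        show "z \<in> A" using zA A by auto
        show "1 \<in> A" unfolding A_def using a1 by simp
        show "U \<subseteq> A" unfolding U_def A_def using a1
        proof (clarsimp)
          fix x :: real assume x: "1 / a < x" "x < a"
          moreover have "0 < 1 / a" using a1 by simp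
          ultimately show "1 / a < \<bar>x\<bar> \<and> \<bar>x\<bar> < a" by linarith
        qed
        show "1 islimpt U"
          unfolding islimpt_approachable
        proof (intro allI impI)
          fix e :: real assume e: "e > 0"
          define d where "d = min (e / 2) ((a - 1) / 2)"
          have d: "0 < d" "d < e" "1 + d < a" using e a1 by (auto simp: d_def min_def field_simps)
          have "1 / a < 1" using a1 by simp
          then have "1 / a < 1 + d" using d by linarith
          then have "of_real (1 + d) \<in> U" unfolding U_def using d by (intro imageI) simp
          moreover have "of_real (1 + d) \<noteq> (1::complex)" using d by (auto simp del: of_real_add simp: of_real_eq_1_iff)
          moreover have "dist (of_real (1 + d) :: complex) 1 < e" using d by (simp add: dist_norm)
          ultimately show "\<exists>x'\<in>U. x' \<noteq> 1 \<and> dist x' 1 < e" by blast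
        qed
        fix u assume "u \<in> U"
        then obtain s where s: "u = of_real s" "1 / a < s" "s < a" unfolding U_def by auto
        have "1 / a > 0" using a1 by simp
        then have s0: "s > 0" using s by linarith
        then have s1: "\<bar>- 1 / s\<bar> < a" "\<bar>s\<bar> < a" using s a1 by (auto simp: divide_simps mult.commute)
        have r: "(- 1 / of_real s :: complex) = of_real (- 1 / s)" by simp
        have "E u = (H b s)\<^sup>2" unfolding E_def s(1) L[OF s1(2)] ..
        also have "\<dots> = (\<sigma> b)\<^sup>2 * (\<kappa> (of_real s))\<^sup>2 * (H (\<not> b) (- 1 / s))\<^sup>2"
          using fe[of s b] s0 by (simp add: power_mult_distrib)
        also have "(\<kappa> (of_real s))\<^sup>2 = c / (of_real s) ^ N" using s0 by (intro sq) auto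
        also have "(\<sigma> b)\<^sup>2 * (c / (of_real s) ^ N) * (H (\<not> b) (- 1 / s))\<^sup>2 = R u"
          unfolding R_def \<mu>_def E'_def s(1) r L[OF s1(1)] by simp
        finally show "E u - R u = 0" by simp
      qed
      then show ?thesis by simp
    qed
    define T where "T = (\<lambda>z. if z \<in> ball 0 a then E z else R z)"
    have "T holomorphic_on (ball 0 a \<union> B)"
      unfolding T_def by (rule holomorphic_on_If_Un[OF hE hR]) (auto simp: eq B_def)
    moreover have "ball 0 a \<union> B = UNIV"
    proof -
      have "1 / a < a" using a1 by (smt (verit) divide_less_eq_1_pos)
      then show ?thesis unfolding B_def by auto
    qed
    ultimately have hT: "T holomorphic_on UNIV" by simp
    \<comment> \<open>Far out \<open>T\<close> equals \<open>R\<close>, in which \<open>E'\<close>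
      is evaluated near 0 and the denominator \<open>z ^ N\<close> forces the decay.\<close>
    have lim: "(T \<longlongrightarrow> 0) at_infinity"
    proof -
      have i: "((\<lambda>z::complex. inverse z) \<longlongrightarrow> 0) at_infinity" by (rule tendsto_inverse_0)
      have m: "((\<lambda>z::complex. - 1 / z) \<longlongrightarrow> 0) at_infinity"
        using tendsto_minus[OF i] by (simp add: divide_inverse)
      have "isCont E' 0" using hE' a1
        by (metis at_within_open centre_in_ball continuous_on_eq_continuous_within holomorphic_on_imp_continuous_on less_trans open_ball zero_less_one)
      then have "((\<lambda>z. E' (- 1 / z)) \<longlongrightarrow> E' 0) at_infinity"
        by (rule isCont_tendsto_compose[OF _ m])
      then have "((\<lambda>z. \<mu> * (inverse z) ^ N * E' (- 1 / z)) \<longlongrightarrow> \<mu> * 0 ^ N * E' 0) at_infinity"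
        by (intro tendsto_intros i)
      moreover have "(0::complex) ^ N = 0" using N5 by (simp add: power_0_left)
      ultimately have "(R \<longlongrightarrow> 0) at_infinity" unfolding R_def by (simp add: divide_inverse power_inverse)
      moreover have "\<forall>\<^sub>F z in at_infinity. R z = T z"
        unfolding eventually_at_infinity T_def by (intro exI[of _ a]) auto
      ultimately show ?thesis using tendsto_cong by blast
    qed
    have "T z = 0" by (rule Liouville_weak[OF hT lim])
    then show ?thesis using z unfolding T_def E_def by simp
  qed
  then show "H b t = 0" if "\<bar>t\<bar> < 1" for b t
    using L[of t b] that a1 by (metis less_trans norm_of_real)
qed

end

end

section \<open>Rapidly decaying functions\<close>

lemma sum_Basis_inner: "b \<in> Basis \<Longrightarrow> (\<Sum>b'\<in>Basis. f b' *\<^sub>R b') \<bullet> b = f b" for b :: "'a::euclidean_space"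
  by (simp add: inner_sum_left inner_Basis if_distrib cong: if_cong)

text \<open>Lebesgue measure is the image of a product measure under coordinates. This serves both
  the basic integrable majorant and the Gaussian in several variables.\<close>

lemma
  fixes \<phi> :: "'a::euclidean_space \<Rightarrow> real \<Rightarrow> 'b::{real_normed_field,banach,second_countable_topology}"
  assumes int: "\<And>b. b \<in> Basis \<Longrightarrow> integrable lborel (\<phi> b)"
  shows integrable_lborel_prod: "integrable lborel (\<lambda>x. \<Prod>b\<in>Basis. \<phi> b (x \<bullet> b))"
    and integral_lborel_prod: "(LINT x|lborel. (\<Prod>b\<in>Basis. \<phi> b (x \<bullet> b))) = (\<Prod>b\<in>Basis. LINT t|lborel. \<phi> b t)"
proof -
  interpret product_sigma_finite "\<lambda>_::'a. lborel :: real measure"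
    by standard
  have m: "(\<lambda>x. \<Prod>b\<in>Basis. \<phi> b (x \<bullet> b)) \<in> borel_measurable borel"
  proof (intro borel_measurable_prod)
    fix b :: 'a assume "b \<in> Basis"
    then have [measurable]: "\<phi> b \<in> borel_measurable borel"
      using borel_measurable_integrable[OF int] by simp
    show "(\<lambda>x. \<phi> b (x \<bullet> b)) \<in> borel_measurable borel" by measurable
  qed
  have mm: "(\<lambda>f. \<Sum>b\<in>Basis. f b *\<^sub>R b) \<in> measurable (\<Pi>\<^sub>M b\<in>(Basis::'a set). lborel) (borel :: 'a measure)"
    by measurable
  have e: "(\<Prod>b\<in>Basis. \<phi> b ((\<Sum>b'\<in>Basis. f b' *\<^sub>R b') \<bullet> b)) = (\<Prod>b\<in>Basis. \<phi> b (f b))" for f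
    by (intro prod.cong) (auto simp: sum_Basis_inner)
  show "integrable lborel (\<lambda>x. \<Prod>b\<in>Basis. \<phi> b (x \<bullet> b))"
    unfolding lborel_eq[where 'a='a] integrable_distr_eq[OF mm m] e
    by (intro product_integrable_prod int) auto
  show "(LINT x|lborel. (\<Prod>b\<in>Basis. \<phi> b (x \<bullet> b))) = (\<Prod>b\<in>Basis. LINT t|lborel. \<phi> b t)"
    unfolding lborel_eq[where 'a='a] integral_distr[OF mm m] e
    by (intro product_integral_prod int) auto
qed

text \<open>The exponent is twice the dimension because \<open>(1 + norm x)\<^sup>2\<close>
  dominates \<open>1 + (x \<bullet> b)\<^sup>2\<close> for each basis vector, and the product of the
  reciprocals of the latter is integrable.\<close>

lemma integrable_decay:
  "integrable lborel (\<lambda>x::'a::euclidean_space. 1 / (1 + norm x) ^ (2 * DIM('a)))"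
proof (rule Bochner_Integration.integrable_bound)
  have 1: "integrable lborel (\<lambda>t::real. inverse (1 + t\<^sup>2))"
    using integrable_inverse_1_plus_square by (simp add: set_integrable_def)
  show "integrable lborel (\<lambda>x::'a. \<Prod>b\<in>Basis. inverse (1 + (x \<bullet> b)\<^sup>2))"
    by (rule integrable_lborel_prod[OF 1])
  show "AE x in lborel. norm (1 / (1 + norm x) ^ (2 * DIM('a)))
      \<le> norm (\<Prod>b\<in>Basis. inverse (1 + ((x::'a) \<bullet> b)\<^sup>2))"
  proof (rule AE_I2)
    fix x :: 'a
    have "(\<Prod>b\<in>Basis. 1 + (x \<bullet> b)\<^sup>2) \<le> (\<Prod>b\<in>(Basis::'a set). (1 + norm x)\<^sup>2)"
    proof (rule prod_mono)
      fix b :: 'a assume b: "b \<in> Basis"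
      have "\<bar>x \<bullet> b\<bar>\<^sup>2 \<le> (norm x)\<^sup>2" by (intro power_mono Basis_le_norm[OF b]) auto
      then show "0 \<le> 1 + (x \<bullet> b)\<^sup>2 \<and> 1 + (x \<bullet> b)\<^sup>2 \<le> (1 + norm x)\<^sup>2"
        by (simp add: power2_sum add_increasing2)
    qed
    also have "\<dots> = (1 + norm x) ^ (2 * DIM('a))" by (simp add: power_mult)
    finally have le: "(\<Prod>b\<in>Basis. 1 + (x \<bullet> b)\<^sup>2) \<le> (1 + norm x) ^ (2 * DIM('a))" .
    have pos: "(\<Prod>b\<in>Basis. 1 + (x \<bullet> b)\<^sup>2) > 0"
      by (intro prod_pos) (auto intro: add_pos_nonneg)
    have "1 / (1 + norm x) ^ (2 * DIM('a)) \<le> 1 / (\<Prod>b\<in>Basis. 1 + (x \<bullet> b)\<^sup>2)"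
      using le pos by (intro divide_left_mono mult_pos_pos) auto
    also have "\<dots> = (\<Prod>b\<in>Basis. inverse (1 + (x \<bullet> b)\<^sup>2))"
      using prod_inversef[of "\<lambda>b. 1 + (x \<bullet> b)\<^sup>2" Basis] by (simp add: o_def divide_inverse)
    finally show "norm (1 / (1 + norm x) ^ (2 * DIM('a))) \<le> norm (\<Prod>b\<in>Basis. inverse (1 + (x \<bullet> b)\<^sup>2))"
      by simp
  qed
qed measurable

text \<open>Together with \<open>rapid_lipschitz\<close> this is all that the uniqueness argument
  uses of a Schwartz function and of its Fourier transform. Both properties survive multiplication
  by \<open>x \<bullet> w\<close>.\<close>

definition rapid :: "('a::euclidean_space \<Rightarrow> complex) \<Rightarrow> bool" where
  "rapid u \<longleftrightarrow> continuous_on UNIV u \<and> (\<forall>N::nat. \<exists>C. \<forall>x. norm (u x) * (1 + norm x) ^ N \<le> C)"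

text \<open>Near a sphere on which \<open>u\<close> vanishes this bounds \<open>u\<close> by the
  distance to the sphere, with a rapidly decaying constant; it compensates the simple zeros of the
  divisor in the Poisson summation.\<close>

definition rapid_lipschitz :: "('a::euclidean_space \<Rightarrow> complex) \<Rightarrow> bool" where
  "rapid_lipschitz u \<longleftrightarrow>
     (\<forall>N::nat. \<exists>C. \<forall>x y. norm (y - x) \<le> 1 \<longrightarrow> norm (u y - u x) * (1 + norm x) ^ N \<le> C * norm (y - x))"

lemma rapidE:
  assumes "rapid u"
  obtains C where "C > 0" "\<And>x. norm (u x) * (1 + norm x) ^ N \<le> C"
proof -
  obtain C where C: "\<And>x. norm (u x) * (1 + norm x) ^ N \<le> C" using assms unfolding rapid_def by metis
  show thesis
  proof (rule that[of "\<bar>C\<bar> + 1"])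
    show "norm (u x) * (1 + norm x) ^ N \<le> \<bar>C\<bar> + 1" for x using C[of x] by linarith
  qed simp
qed

lemma rapid_measurable[measurable_dest]: "rapid u \<Longrightarrow> u \<in> borel_measurable borel"
  unfolding rapid_def by (simp add: borel_measurable_continuous_onI)

lemma rapid_continuous: "rapid u \<Longrightarrow> continuous_on S u"
  unfolding rapid_def using continuous_on_subset by blast

lemma integrable_decay_bound:
  fixes g :: "'a::euclidean_space \<Rightarrow> 'b::{banach,second_countable_topology}"
  assumes "g \<in> borel_measurable borel"
    and "\<And>x. norm (g x) * (1 + norm x) ^ (2 * DIM('a)) \<le> C"
  shows "integrable lborel g"
proof (rule Bochner_Integration.integrable_bound)
  show "integrable lborel (\<lambda>x::'a. C * (1 / (1 + norm x) ^ (2 * DIM('a))))"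
    by (intro integrable_mult_right integrable_decay)
  show "g \<in> borel_measurable lborel" using assms(1) by simp
  show "AE x in lborel. norm (g x) \<le> norm (C * (1 / (1 + norm x) ^ (2 * DIM('a))))"
  proof (rule AE_I2)
    fix x :: 'a
    have "norm (g x) \<le> C / (1 + norm x) ^ (2 * DIM('a))"
      using assms(2)[of x] by (subst pos_le_divide_eq) (auto simp: add_pos_nonneg)
    also have "\<dots> \<le> norm (C * (1 / (1 + norm x) ^ (2 * DIM('a))))"
      using abs_ge_self[of "C / (1 + norm x) ^ (2 * DIM('a))"] by simp
    finally show "norm (g x) \<le> norm (C * (1 / (1 + norm x) ^ (2 * DIM('a))))" .
  qed
qed

lemma rapid_integrable: "rapid u \<Longrightarrow> integrable lborel u"
  for u :: "'a::euclidean_space \<Rightarrow> complex"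
  by (rule rapidE[of u "2 * DIM('a)"]) (auto intro!: integrable_decay_bound rapid_measurable)

lemma rapid_integrable_mult:
  fixes u :: "'a::euclidean_space \<Rightarrow> complex"
  assumes "rapid u" "g \<in> borel_measurable borel" "\<And>x. norm (g x) \<le> B"
  shows "integrable lborel (\<lambda>x. u x * g x)"
proof (rule Bochner_Integration.integrable_bound)
  show "integrable lborel (\<lambda>x. B * norm (u x))" by (intro integrable_mult_right integrable_norm rapid_integrable assms)
  show "(\<lambda>x. u x * g x) \<in> borel_measurable lborel" using rapid_measurable[OF assms(1)] assms(2) by simp
  show "AE x in lborel. norm (u x * g x) \<le> norm (B * norm (u x))"
  proof (rule AE_I2)
    fix x
    have "norm (u x * g x) \<le> norm (u x) * B" unfolding norm_mult by (intro mult_left_mono assms) auto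
    also have "\<dots> \<le> norm (B * norm (u x))" by (simp add: abs_mult mult.commute mult_right_mono)
    finally show "norm (u x * g x) \<le> norm (B * norm (u x))" .
  qed
qed

lemma rapid_mult_inner:
  assumes "rapid u"
  shows "rapid (\<lambda>x. u x * of_real (x \<bullet> w))"
  unfolding rapid_def
proof (intro conjI allI)
  show "continuous_on UNIV (\<lambda>x. u x * of_real (x \<bullet> w))"
    by (intro continuous_intros rapid_continuous assms)
  fix N
  obtain C where C: "C > 0" "\<And>x. norm (u x) * (1 + norm x) ^ Suc N \<le> C" using rapidE[OF assms] by blast
  have "norm (u x * of_real (x \<bullet> w)) * (1 + norm x) ^ N \<le> C * norm w" for x
  proof -
    have "\<bar>x \<bullet> w\<bar> \<le> (1 + norm x) * norm w"
      unfolding distrib_right using Cauchy_Schwarz_ineq2[of x w] norm_ge_zero[of w] by linarith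
    then have "norm (u x) * \<bar>x \<bullet> w\<bar> * (1 + norm x) ^ N \<le> norm (u x) * ((1 + norm x) * norm w) * (1 + norm x) ^ N"
      by (intro mult_right_mono mult_left_mono) auto
    also have "\<dots> = (norm (u x) * (1 + norm x) ^ Suc N) * norm w" by (simp add: algebra_simps)
    also have "\<dots> \<le> C * norm w" by (intro mult_right_mono C) auto
    finally show ?thesis by (simp add: norm_mult)
  qed
  then show "\<exists>C. \<forall>x. norm (u x * of_real (x \<bullet> w)) * (1 + norm x) ^ N \<le> C" by blast
qed

lemma rapid_lipschitz_mult_inner:
  assumes "rapid u" "rapid_lipschitz u"
  shows "rapid_lipschitz (\<lambda>x. u x * of_real (x \<bullet> w))"
  unfolding rapid_lipschitz_def
proof (intro allI)
  fix N
  obtain C where C: "C > 0" "\<And>x. norm (u x) * (1 + norm x) ^ N \<le> C" using rapidE[OF assms(1)] by blast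
  obtain D where D: "\<And>x y. norm (y - x) \<le> 1 \<Longrightarrow> norm (u y - u x) * (1 + norm x) ^ Suc N \<le> D * norm (y - x)"
    using assms(2) unfolding rapid_lipschitz_def by metis
  have "norm (u y * of_real (y \<bullet> w) - u x * of_real (x \<bullet> w)) * (1 + norm x) ^ N \<le> (D * norm w + C * norm w) * norm (y - x)"
    if xy: "norm (y - x) \<le> 1" for x y
  proof -
    have "norm y \<le> 1 + norm x" using norm_triangle_ineq2[of y x] xy by linarith
    then have y: "\<bar>y \<bullet> w\<bar> \<le> (1 + norm x) * norm w"
      using Cauchy_Schwarz_ineq2[of y w] by (meson mult_right_mono norm_ge_zero order_trans)
    have "u y * of_real (y \<bullet> w) - u x * of_real (x \<bullet> w)
        = (u y - u x) * of_real (y \<bullet> w) + u x * of_real ((y - x) \<bullet> w)"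
      by (simp add: algebra_simps inner_diff_left)
    then have "norm (u y * of_real (y \<bullet> w) - u x * of_real (x \<bullet> w))
        \<le> norm (u y - u x) * \<bar>y \<bullet> w\<bar> + norm (u x) * \<bar>(y - x) \<bullet> w\<bar>"
      using norm_triangle_ineq by (metis norm_mult norm_of_real)
    also have "\<dots> \<le> norm (u y - u x) * ((1 + norm x) * norm w) + norm (u x) * (norm (y - x) * norm w)"
      using Cauchy_Schwarz_ineq2[of "y - x" w] by (intro add_mono mult_left_mono y) auto
    finally have "norm (u y * of_real (y \<bullet> w) - u x * of_real (x \<bullet> w)) * (1 + norm x) ^ N
       \<le> (norm (u y - u x) * ((1 + norm x) * norm w) + norm (u x) * (norm (y - x) * norm w)) * (1 + norm x) ^ N"
      by (intro mult_right_mono) auto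
    also have "\<dots> = (norm (u y - u x) * (1 + norm x) ^ Suc N) * norm w + (norm (u x) * (1 + norm x) ^ N) * norm (y - x) * norm w"
      by (simp add: algebra_simps)
    also have "\<dots> \<le> (D * norm (y - x)) * norm w + C * norm (y - x) * norm w"
      by (intro add_mono mult_right_mono D xy C) auto
    finally show ?thesis by (simp add: algebra_simps)
  qed
  then show "\<exists>C. \<forall>x y. norm (y - x) \<le> 1 \<longrightarrow>
      norm (u y * of_real (y \<bullet> w) - u x * of_real (x \<bullet> w)) * (1 + norm x) ^ N \<le> C * norm (y - x)" by blast
qed

lemma rapid_mult_inner_power: "rapid u \<Longrightarrow> rapid (\<lambda>x. u x * of_real (x \<bullet> w) ^ m)"
proof (induction m)
  case (Suc m)
  then have "rapid (\<lambda>x. (u x * of_real (x \<bullet> w) ^ m) * of_real (x \<bullet> w))" by (intro rapid_mult_inner) auto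
  then show ?case by (simp add: mult_ac)
qed simp

lemma rapid_lipschitz_mult_inner_power:
  "rapid u \<Longrightarrow> rapid_lipschitz u \<Longrightarrow> rapid_lipschitz (\<lambda>x. u x * of_real (x \<bullet> w) ^ m)"
proof (induction m)
  case (Suc m)
  then have "rapid_lipschitz (\<lambda>x. (u x * of_real (x \<bullet> w) ^ m) * of_real (x \<bullet> w))"
    by (intro rapid_lipschitz_mult_inner rapid_mult_inner_power) auto
  then show ?case by (simp add: mult_ac)
qed simp

lemma power_power_commute: "(x ^ m) ^ n = (x ^ n) ^ m" for x :: "'a::monoid_mult"
  by (simp only: power_mult[symmetric] mult.commute[of m])

text \<open>Dyadic shells: the integral over the k-th one is comparable with the k-th power of \<open>2\<^sup>2 / 2\<^sup>d\<close>.\<close>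

lemma integrable_inverse_square_near_0:
  assumes "DIM('a::euclidean_space) \<ge> 3"
  shows "integrable lborel (\<lambda>x::'a. indicator (ball 0 1) x * (1 / (norm x)\<^sup>2) :: real)"
proof (rule Bochner_Integration.integrable_bound)
  \<comment> \<open>Whole balls take the place of shells, which keeps the integrals elementary: on
    the shell between the radii \<open>(1/2) ^ Suc k\<close> and \<open>(1/2) ^ k\<close> the single
    term \<open>f k\<close> already dominates \<open>1 / (norm x)\<^sup>2\<close>.\<close>
  define f :: "nat \<Rightarrow> 'a \<Rightarrow> real" where "f = (\<lambda>k x. 4 ^ Suc k * indicator (ball 0 ((1/2) ^ k)) x)"
  have fin: "emeasure lborel (ball (0::'a) ((1/2) ^ k)) < \<infinity>" for k
    by (rule emeasure_lborel_ball_finite)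
  have int: "integrable lborel (f k)" for k
    unfolding f_def using fin by (intro integrable_mult_right integrable_real_indicator) auto
  have val: "(LINT x|lborel. norm (f k x)) = 4 * unit_ball_vol (DIM('a)) * (4 / 2 ^ DIM('a)) ^ k" for k
  proof -
    have "(LINT x|lborel. norm (f k x)) = (LINT x|lborel. 4 ^ Suc k * indicator (ball 0 ((1/2) ^ k)) (x::'a))"
      unfolding f_def by (intro Bochner_Integration.integral_cong) auto
    also have "\<dots> = 4 ^ Suc k * measure lborel (ball (0::'a) ((1/2) ^ k))" by simp
    also have "\<dots> = 4 ^ Suc k * (unit_ball_vol (DIM('a)) * ((1/2) ^ k) ^ DIM('a))"
      by (simp add: content_ball)
    also have "((1/2::real) ^ k) ^ DIM('a) = (1 / 2 ^ DIM('a)) ^ k" 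
      by (subst power_power_commute) (simp only: power_one_over)
    also have "4 ^ Suc k * (unit_ball_vol (DIM('a)) * (1 / 2 ^ DIM('a)) ^ k)
        = 4 * unit_ball_vol (DIM('a)) * (4 / 2 ^ DIM('a)) ^ k" by (simp add: power_divide)
    finally show ?thesis .
  qed
  \<comment> \<open>Dimension at least 3 enters here: the ratio of the geometric series is at most
    \<open>4 / 8\<close>.\<close>
  have "(2::real) ^ 3 \<le> 2 ^ DIM('a)" using assms by (intro power_increasing) auto
  then have q: "norm (4 / 2 ^ DIM('a) :: real) < 1" by simp
  have pt: "finite {k. f k x \<noteq> 0}" if "x \<noteq> 0" for x
  proof -
    have "(\<lambda>k. (1/2::real) ^ k) \<longlonglongrightarrow> 0" by (intro LIMSEQ_realpow_zero) auto
    then have "\<forall>\<^sub>F k in sequentially. (1/2::real) ^ k < norm x" using that by (intro order_tendstoD(2)) auto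
    then obtain K where K: "\<And>k. k \<ge> K \<Longrightarrow> (1/2::real) ^ k < norm x" unfolding eventually_sequentially by blast
    have "{k. f k x \<noteq> 0} \<subseteq> {..<K}"
    proof
      fix k assume "k \<in> {k. f k x \<noteq> 0}"
      then have "norm x < (1/2) ^ k" unfolding f_def by (auto simp: indicator_def split: if_splits)
      then show "k \<in> {..<K}" using K[of k] by (meson lessThan_iff less_asym linorder_not_less)
    qed
    then show ?thesis using finite_subset by blast
  qed
  have sm: "summable (\<lambda>k. f k x)" if "x \<noteq> 0" for x
    using summable_finite[OF pt[OF that]] by auto
  have ae: "AE x in (lborel :: 'a measure). x \<noteq> 0"
    by (rule AE_lborel_singleton)
  show "integrable lborel (\<lambda>x. \<Sum>k. f k x)"
  proof (rule integrable_suminf[OF int])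
    have "norm (f k x) = f k x" for k x unfolding f_def by simp
    then show "AE x in lborel. summable (\<lambda>k. norm (f k x))" using ae sm by auto
    show "summable (\<lambda>k. LINT x|lborel. norm (f k x))"
      unfolding val using q by (intro summable_mult summable_geometric)
  qed
  show "AE x in lborel. norm (indicator (ball 0 1) x * (1 / (norm x)\<^sup>2) :: real) \<le> norm (\<Sum>k. f k x)"
    using ae
  proof eventually_elim
    fix x :: 'a assume x: "x \<noteq> 0"
    have f0: "f k x \<ge> 0" for k unfolding f_def by simp
    show "norm (indicator (ball 0 1) x * (1 / (norm x)\<^sup>2) :: real) \<le> norm (\<Sum>k. f k x)"
    proof (cases "norm x < 1")
      case True
      define k where "k = (LEAST k. (1/2::real) ^ Suc k \<le> norm x)"
      have "(\<lambda>k. (1/2::real) ^ k) \<longlonglongrightarrow> 0" by (intro LIMSEQ_realpow_zero) auto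
      then have "\<forall>\<^sub>F k in sequentially. (1/2::real) ^ k < norm x" using x by (intro order_tendstoD(2)) auto
      then obtain K where "\<And>k. k \<ge> K \<Longrightarrow> (1/2::real) ^ k < norm x" unfolding eventually_sequentially by blast
      from this[of "Suc K"] have "(1/2::real) ^ Suc K \<le> norm x" by simp
      then have k: "(1/2::real) ^ Suc k \<le> norm x" unfolding k_def by (rule LeastI)
      have k': "norm x < (1/2) ^ k"
      proof (cases k)
        case 0
        then show ?thesis using True by simp
      next
        case (Suc j)
        then have "\<not> (1/2::real) ^ Suc j \<le> norm x" unfolding k_def by (intro not_less_Least) simp
        then show ?thesis using Suc by simp
      qed
      have "((1/2::real) ^ Suc k)\<^sup>2 \<le> (norm x)\<^sup>2" using k by (intro power_mono) auto
      moreover have "((1/2::real) ^ Suc k)\<^sup>2 = 1 / 4 ^ Suc k"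
        unfolding power_power_commute[of _ "Suc k"] by (simp only: power_one_over) simp
      ultimately have "1 / 4 ^ Suc k \<le> (norm x)\<^sup>2" by (simp only:)
      then have "1 / (norm x)\<^sup>2 \<le> 1 / (1 / 4 ^ Suc k)" using x by (intro divide_left_mono) auto
      then have "1 / (norm x)\<^sup>2 \<le> 4 ^ Suc k" by simp
      also have "\<dots> = f k x" using k' unfolding f_def by simp
      also have "\<dots> \<le> (\<Sum>k. f k x)" using sum_le_suminf[OF sm[OF x], of "{k}"] f0 by simp
      finally show ?thesis using True by simp
    qed simp
  qed
  have "(\<lambda>x::'a. 1 / (norm x)\<^sup>2) \<in> borel_measurable borel" by measurable
  then show "(\<lambda>x::'a. indicator (ball 0 1) x * (1 / (norm x)\<^sup>2) :: real) \<in> borel_measurable lborel"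
    by (intro borel_measurable_times borel_measurable_indicator) auto
qed

section \<open>Poisson summation in the squared radius\<close>

abbreviation chirp :: "complex \<Rightarrow> 'a::euclidean_space \<Rightarrow> complex" where
  "chirp z x \<equiv> exp (\<i> * of_real pi * z * of_real ((norm x)\<^sup>2))"

text \<open>For real \<open>z\<close> this is a Fourier transform in the variable
  \<open>(norm x)\<^sup>2\<close>. The squared radii \<open>n / \<alpha>\<close> are exactly those
  at which the exponential has period \<open>2 * \<alpha>\<close> in \<open>z\<close>.\<close>

definition gaussian_transform :: "('a::euclidean_space \<Rightarrow> complex) \<Rightarrow> complex \<Rightarrow> complex" where
  "gaussian_transform u z = (LINT x|lborel. u x * chirp z x)"

lemma gaussian_transform_real:
  "gaussian_transform u (of_real t) = (LINT x|lborel. u x * cis (pi * t * (norm x)\<^sup>2))"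
  unfolding gaussian_transform_def cis_conv_exp by (simp add: mult.assoc)

section \<open>Elementary bounds on the unit circle\<close>

lemma norm_cis_diff_le: "norm (cis a - cis b) \<le> \<bar>a - b\<bar>"
proof -
  have "cis a - cis b = cis b * (cis (a - b) - 1)"
    by (simp add: algebra_simps cis_mult)
  then have "norm (cis a - cis b) = norm (cis (a - b) - 1)" by (simp add: norm_mult)
  also have "\<dots> \<le> \<bar>a - b\<bar>" using iexp_approx1[of "a - b" 0] by (simp add: cis_conv_exp)
  finally show ?thesis .
qed

text \<open>Up to \<open>pi / 3\<close> the derivative \<open>cos y - 1 / 2\<close> of the
  difference is nonnegative. Beyond that, \<open>sin y\<close> is at least
  \<open>sqrt 3 / 2 \<ge> 0.85\<close>, while \<open>y / 2\<close> stays below 0.8.\<close>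

lemma sin_ge_half:
  assumes "0 \<le> y" "y \<le> pi / 2"
  shows "y / 2 \<le> sin y"
proof (cases "y \<le> pi / 3")
  case True
  have "sin 0 - 0 / 2 \<le> sin y - y / 2"
  proof (rule DERIV_nonneg_imp_nondecreasing[OF assms(1)])
    fix x assume x: "0 \<le> x" "x \<le> y"
    have "cos (pi / 3) \<le> cos x" using x True by (intro cos_monotone_0_pi_le) auto
    then show "\<exists>d. ((\<lambda>y. sin y - y / 2) has_real_derivative d) (at x) \<and> 0 \<le> d"
      by (intro exI[of _ "cos x - 1/2"]) (auto intro!: derivative_eq_intros simp: cos_60)
  qed
  then show ?thesis by simp
next
  case False
  have "sin (pi / 3) \<le> sin y" using False assms by (intro sin_monotone_2pi_le) auto
  moreover have "sqrt 3 \<ge> 1.7" by (intro real_le_rsqrt) (simp add: power2_eq_square)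
  moreover have "pi < 3.2" using pi_approx by simp
  ultimately show ?thesis using assms by (simp add: sin_60)
qed

text \<open>The chord has length \<open>2 * \<bar>sin (pi * (\<rho> - k))\<bar>\<close>. The bound
  says that the divisor of the Poisson summation vanishes no faster than the distance of
  \<open>\<alpha> * (norm x)\<^sup>2\<close> to the nearest integer.\<close>

lemma norm_cis_minus_1_ge:
  fixes k :: int and \<rho> :: real
  assumes "\<bar>\<rho> - k\<bar> \<le> 1 / 2"
  shows "\<bar>\<rho> - k\<bar> \<le> norm (cis (2 * pi * \<rho>) - 1)"
proof -
  define y where "y = pi * \<bar>\<rho> - k\<bar>"
  have y: "0 \<le> y" "y \<le> pi / 2" unfolding y_def using assms by auto
  have "cis (2 * pi * \<rho>) = cis (2 * pi * (\<rho> - k))"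
    using cis_divide[of "2 * pi * \<rho>" "2 * pi * of_int k"] cis_multiple_2pi[of k] by (simp add: algebra_simps)
  moreover have "norm (cis \<theta> - 1) = 2 * \<bar>sin (\<theta> / 2)\<bar>" for \<theta>
  proof -
    have "(norm (cis \<theta> - 1))\<^sup>2 = (cos \<theta> - 1)\<^sup>2 + (sin \<theta>)\<^sup>2" by (simp add: cmod_power2)
    also have "\<dots> = 2 - 2 * cos \<theta>" using sin_cos_squared_add[of \<theta>] by (simp add: power2_diff)
    also have "cos \<theta> = 1 - 2 * (sin (\<theta> / 2))\<^sup>2" using cos_double_sin[of "\<theta> / 2"] by simp
    finally have "(norm (cis \<theta> - 1))\<^sup>2 = (2 * \<bar>sin (\<theta> / 2)\<bar>)\<^sup>2" by (simp add: power_mult_distrib)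
    then show ?thesis by (rule power2_eq_imp_eq) auto
  qed
  ultimately have "norm (cis (2 * pi * \<rho>) - 1) = 2 * \<bar>sin (pi * (\<rho> - k))\<bar>" by simp
  also have "\<bar>sin (pi * (\<rho> - k))\<bar> = \<bar>sin y\<bar>" unfolding y_def by (cases "\<rho> \<ge> k") (auto simp: algebra_simps abs_if sin_diff)
  finally have "norm (cis (2 * pi * \<rho>) - 1) \<ge> y" using sin_ge_half[OF y] by linarith
  moreover have "y \<ge> \<bar>\<rho> - k\<bar>" unfolding y_def using pi_gt3 mult_right_mono[of 1 pi "\<bar>\<rho> - k\<bar>"] by simp
  ultimately show ?thesis by linarith
qed

text \<open>Trigonometric polynomials with arbitrary real frequencies. Induction reduces statements
  that are additive in the test function to one exponential, for which the integral against
  \<open>u\<close> is a value of \<open>gaussian_transform\<close>.\<close>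

inductive trig :: "(real \<Rightarrow> complex) \<Rightarrow> bool" where
  trig_cis: "trig (\<lambda>s. c * cis (pi * \<tau> * s))"
| trig_add: "trig \<psi> \<Longrightarrow> trig \<phi> \<Longrightarrow> trig (\<lambda>s. \<psi> s + \<phi> s)"

lemma trig_mult: "trig \<psi> \<Longrightarrow> trig (\<lambda>s. c * \<psi> s)"
proof (induction rule: trig.induct)
  case (trig_cis d \<tau>)
  show ?case using trig.trig_cis[of "c * d" \<tau>] by (simp add: mult.assoc)
next
  case (trig_add \<psi> \<phi>)
  then show ?case using trig.trig_add by (simp add: distrib_left)
qed

lemma trig_sum:
  assumes "\<And>i. i \<in> I \<Longrightarrow> trig (\<psi> i)"
  shows "trig (\<lambda>s. \<Sum>i\<in>I. \<psi> i s)"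
proof (cases "finite I")
  case True
  then show ?thesis using assms
  proof induction
    case empty
    show ?case using trig_cis[of 0] by simp
  qed (auto intro: trig_add)
next
  case False
  then show ?thesis using trig_cis[of 0] by simp
qed

lemma trig_poly: "trig (\<lambda>s. poly p (cis (pi * \<tau> * s)))"
proof -
  have "(\<lambda>s. poly p (cis (pi * \<tau> * s))) = (\<lambda>s. \<Sum>i\<le>degree p. coeff p i * cis (pi * (real i * \<tau>) * s))"
  proof -
    have "cis (pi * \<tau> * s) ^ i = cis (pi * (real i * \<tau>) * s)" for s i
      by (simp only: Complex.DeMoivre) (simp only: mult_ac)
    then show ?thesis unfolding poly_altdef by simp
  qed
  then show ?thesis by (simp only:) (intro trig_sum trig_cis)
qed

lemma trig_bounded_lipschitz:
  assumes "trig \<psi>"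
  obtains B L where "\<And>s. norm (\<psi> s) \<le> B" "\<And>s t. norm (\<psi> s - \<psi> t) \<le> L * \<bar>s - t\<bar>"
proof -
  from assms have "\<exists>B L. \<forall>s t. norm (\<psi> s) \<le> B \<and> norm (\<psi> s - \<psi> t) \<le> L * \<bar>s - t\<bar>"
  proof induction
    case (trig_cis c \<tau>)
    have "norm (c * cis (pi * \<tau> * s) - c * cis (pi * \<tau> * t)) \<le> (norm c * (pi * \<bar>\<tau>\<bar>)) * \<bar>s - t\<bar>" for s t
    proof -
      have "norm (c * cis (pi * \<tau> * s) - c * cis (pi * \<tau> * t)) = norm c * norm (cis (pi * \<tau> * s) - cis (pi * \<tau> * t))"
        by (simp add: norm_mult flip: right_diff_distrib)
      also have "\<dots> \<le> norm c * \<bar>pi * \<tau> * s - pi * \<tau> * t\<bar>" by (intro mult_left_mono norm_cis_diff_le) auto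
      also have "\<bar>pi * \<tau> * s - pi * \<tau> * t\<bar> = pi * \<bar>\<tau>\<bar> * \<bar>s - t\<bar>" by (simp add: abs_mult flip: right_diff_distrib)
      finally show ?thesis by simp
    qed
    then show ?case by (intro exI[of _ "norm c"] exI[of _ "norm c * (pi * \<bar>\<tau>\<bar>)"]) (auto simp: norm_mult)
  next
    case (trig_add \<psi> \<phi>)
    then obtain B L B' L' where *: "\<And>s t. norm (\<psi> s) \<le> B \<and> norm (\<psi> s - \<psi> t) \<le> L * \<bar>s - t\<bar>"
      "\<And>s t. norm (\<phi> s) \<le> B' \<and> norm (\<phi> s - \<phi> t) \<le> L' * \<bar>s - t\<bar>" by metis
    have "norm (\<psi> s + \<phi> s) \<le> B + B'" for s
      using norm_triangle_ineq[of "\<psi> s" "\<phi> s"] *(1)[of s] *(2)[of s] by fastforce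
    moreover have "norm (\<psi> s + \<phi> s - (\<psi> t + \<phi> t)) \<le> (L + L') * \<bar>s - t\<bar>" for s t
      using norm_triangle_ineq[of "\<psi> s - \<psi> t" "\<phi> s - \<phi> t"] *(1)[of s t] *(2)[of s t]
      by (simp add: algebra_simps)
    ultimately show ?case by blast
  qed
  then show thesis using that by blast
qed

lemma trig_continuous: "trig \<psi> \<Longrightarrow> continuous_on UNIV \<psi>"
  by (induction rule: trig.induct) (auto intro!: continuous_intros simp: cis_conv_exp)

text \<open>A limit known to exist is identified through its averages, in which oscillations cancel.
  The mean is split at an index beyond which the terms are within \<open>e / 2\<close> of the limit;
  the fixed initial block is outweighed by \<open>n\<close>.\<close>

lemma cesaro_unique:
  fixes X :: "nat \<Rightarrow> 'a::real_normed_vector"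
  assumes X: "X \<longlonglongrightarrow> l" and m: "(\<lambda>n. (\<Sum>j<n. X j) /\<^sub>R real n) \<longlonglongrightarrow> 0"
  shows "l = 0"
proof -
  have "(\<lambda>n. (\<Sum>j<n. X j - l) /\<^sub>R real n) \<longlonglongrightarrow> 0"
  proof (rule LIMSEQ_I)
    fix e :: real assume e: "e > 0"
    have "Bseq (\<lambda>n. X n - l)" using X by (intro convergent_imp_Bseq convergentI) (auto intro: tendsto_intros)
    then obtain B where B: "B > 0" "\<And>n. norm (X n - l) \<le> B" by (auto elim: BseqE)
    from LIMSEQ_D[OF X, of "e / 2"] e obtain K where K: "\<And>n. n \<ge> K \<Longrightarrow> norm (X n - l) < e / 2" by auto
    obtain n0 where n0: "real n0 > 2 * (real K * B) / e" using reals_Archimedean2 by blast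
    show "\<exists>no. \<forall>n\<ge>no. norm ((\<Sum>j<n. X j - l) /\<^sub>R real n - 0) < e"
    proof (intro exI allI impI)
      fix n assume n: "n \<ge> max (Suc n0) K"
      then have np: "real n > 0" "real n > 2 * (real K * B) / e" using n0 by auto
      have "norm (\<Sum>j<n. X j - l) \<le> (\<Sum>j<n. norm (X j - l))" by (rule norm_sum)
      also have "\<dots> = (\<Sum>j<K. norm (X j - l)) + (\<Sum>j=K..<n. norm (X j - l))"
        using n by (subst sum.atLeastLessThan_concat[of 0 K n, symmetric, simplified lessThan_atLeast0[symmetric]]) auto
      also have "\<dots> \<le> (\<Sum>j<K. B) + (\<Sum>j=K..<n. e / 2)"
        using B K by (intro add_mono sum_mono) (auto intro: less_imp_le)
      also have "\<dots> \<le> real K * B + real n * (e / 2)" using e by (simp add: mult_right_mono)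
      also have "\<dots> < real n * e"
      proof -
        have "2 * (real K * B) < real n * e" using np e by (simp add: pos_divide_less_eq)
        then show ?thesis by simp
      qed
      finally show "norm ((\<Sum>j<n. X j - l) /\<^sub>R real n - 0) < e"
        using np by (simp add: divide_simps mult.commute)
    qed
  qed
  from tendsto_diff[OF m this] have "(\<lambda>n. (\<Sum>j<n. X j) /\<^sub>R real n - (\<Sum>j<n. X j - l) /\<^sub>R real n) \<longlonglongrightarrow> 0" by simp
  moreover have "\<forall>\<^sub>F n in sequentially. (\<Sum>j<n. X j) /\<^sub>R real n - (\<Sum>j<n. X j - l) /\<^sub>R real n = l"
    unfolding eventually_sequentially
    by (intro exI[of _ 1]) (simp add: sum_subtractf scaleR_diff_right sum_constant_scaleR)
  ultimately have "(\<lambda>n::nat. l) \<longlonglongrightarrow> 0" by (rule Lim_transform_eventually)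
  then show ?thesis using LIMSEQ_unique tendsto_const by blast
qed

text \<open>Lagrange interpolation, meant for the finitely many spheres of index below
  \<open>n0\<close> on which \<open>u\<close> need not vanish.\<close>

lemma lagrange_poly:
  fixes \<zeta> :: "nat \<Rightarrow> 'a::field"
  assumes "finite I" "inj_on \<zeta> I" "n \<in> I"
  obtains p where "\<And>m. m \<in> I \<Longrightarrow> poly p (\<zeta> m) = (if m = n then 1 else 0)"
proof
  fix m assume m: "m \<in> I"
  let ?q = "\<Prod>k\<in>I - {n}. [:- \<zeta> k, 1:]"
  have "poly ?q (\<zeta> n) \<noteq> 0" using assms by (auto simp: poly_prod inj_on_def)
  moreover have "m \<noteq> n \<Longrightarrow> poly ?q (\<zeta> m) = 0" using assms m by (auto simp: poly_prod)
  ultimately show "poly (smult (inverse (poly ?q (\<zeta> n))) ?q) (\<zeta> m) = (if m = n then 1 else 0)" by auto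
qed

lemma measurable_cis_norm [measurable]: "(\<lambda>x::'a::euclidean_space. cis (r * (norm x)\<^sup>2)) \<in> borel_measurable borel"
  by (intro borel_measurable_continuous_onI) (auto intro!: continuous_intros simp: cis_conv_exp)

lemma measurable_trig_norm: "trig \<psi> \<Longrightarrow> (\<lambda>x::'a::euclidean_space. \<psi> ((norm x)\<^sup>2)) \<in> borel_measurable borel"
  by (intro borel_measurable_continuous_onI continuous_on_compose2[OF trig_continuous] continuous_intros) auto

section \<open>Poisson sums as functionals of trigonometric polynomials\<close>

context
  fixes u :: "'a::euclidean_space \<Rightarrow> complex" and \<alpha> :: real and n0 :: nat
  assumes u: "rapid u" and \<alpha>: "\<alpha> > 0"
begin

text \<open>The term of the Poisson sum for the translate by \<open>2 * \<alpha> * j\<close>. The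
  index is real so that both signs and the shift by one are covered by the same formula.\<close>

definition coefficient :: "(real \<Rightarrow> complex) \<Rightarrow> real \<Rightarrow> complex" where
  "coefficient \<psi> j = (LINT x|lborel. u x * (\<psi> ((norm x)\<^sup>2) * cis (2 * pi * \<alpha> * j * (norm x)\<^sup>2)))"

lemma coefficient_cis:
  "coefficient (\<lambda>s. c * cis (pi * \<tau> * s)) j = c * gaussian_transform u (of_real (\<tau> + 2 * \<alpha> * j))"
proof -
  have "u x * (c * cis (pi * \<tau> * (norm x)\<^sup>2) * cis (2 * pi * \<alpha> * j * (norm x)\<^sup>2))
      = c * (u x * cis (pi * (\<tau> + 2 * \<alpha> * j) * (norm x)\<^sup>2))" for x
    by (simp add: cis_mult algebra_simps)
  then show ?thesis unfolding coefficient_def gaussian_transform_real by (simp only: integral_mult_right_zero)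
qed

lemma coefficient_integrable:
  assumes "trig \<psi>"
  shows "integrable lborel (\<lambda>x. u x * (\<psi> ((norm x)\<^sup>2) * cis (2 * pi * \<alpha> * j * (norm x)\<^sup>2)))"
proof -
  obtain B where B: "\<And>s. norm (\<psi> s) \<le> B" using trig_bounded_lipschitz[OF assms] by metis
  show ?thesis
    by (rule rapid_integrable_mult[OF u, of _ B])
      (use B measurable_trig_norm[OF assms, measurable] in \<open>auto simp: norm_mult\<close>)
qed

lemma coefficient_add:
  assumes "trig \<psi>" "trig \<phi>"
  shows "coefficient (\<lambda>s. \<psi> s + \<phi> s) j = coefficient \<psi> j + coefficient \<phi> j"
  unfolding coefficient_def
  using Bochner_Integration.integral_add[OF coefficient_integrable[OF assms(1), of j] coefficient_integrable[OF assms(2), of j]]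
  by (simp add: algebra_simps)

lemma coefficient_mult: "coefficient (\<lambda>s. c * \<psi> s) j = c * coefficient \<psi> j"
  unfolding coefficient_def by (simp add: mult.left_commute[of _ c] mult.assoc)

context
  assumes decay: "\<exists>C. \<forall>s. s \<noteq> 0 \<longrightarrow> norm (gaussian_transform u (of_real s)) \<le> C / s\<^sup>2"
begin

lemma coefficient_summable:
  assumes "trig \<psi>"
  shows "summable (\<lambda>n. coefficient \<psi> (real (Suc n)) + coefficient \<psi> (- real (Suc n)))"
  using assms
proof induction
  case (trig_cis c \<tau>)
  obtain C where C: "\<And>s. s \<noteq> 0 \<Longrightarrow> norm (gaussian_transform u (of_real s)) \<le> C / s\<^sup>2" using decay by blast
  have s: "summable (\<lambda>n. norm c * (2 * (\<bar>C\<bar> / \<alpha>\<^sup>2 * inverse (real (Suc n) ^ 2))))"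
    using inverse_power_summable[of 2, where 'a=real] by (intro summable_mult) (simp only: summable_Suc_iff[of "\<lambda>n. inverse (real n ^ 2)"] order_refl)
  show ?case unfolding coefficient_cis
  proof (rule summable_comparison_test_ev[OF _ s])
    \<comment> \<open>From \<open>n1\<close> on, the frequency \<open>\<tau>\<close> is smaller than
      \<open>\<alpha> * real (Suc n)\<close>, so \<open>\<tau> + 2 * \<alpha> * j\<close> keeps at
      least that modulus.\<close>
    obtain n1 where n1: "real n1 > \<bar>\<tau>\<bar> / \<alpha>" using reals_Archimedean2 by blast
    have *: "norm (gaussian_transform u (of_real (\<tau> + 2 * \<alpha> * j))) \<le> \<bar>C\<bar> / \<alpha>\<^sup>2 * inverse (real (Suc n) ^ 2)"
      if "n \<ge> n1" "\<bar>j\<bar> = real (Suc n)" for n j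
    proof -
      have "real (Suc n) > \<bar>\<tau>\<bar> / \<alpha>" using that n1 by linarith
      then have t: "\<bar>\<tau>\<bar> < \<alpha> * real (Suc n)" using \<alpha> by (simp only: pos_divide_less_eq mult.commute)
      have "\<bar>2 * \<alpha> * j\<bar> = 2 * (\<alpha> * real (Suc n))" using that \<alpha> by (simp add: abs_mult)
      then have ge: "\<alpha> * real (Suc n) \<le> \<bar>\<tau> + 2 * \<alpha> * j\<bar>" using t by linarith
      have pos: "\<alpha> * real (Suc n) > 0" using \<alpha> by simp
      then have ne: "\<tau> + 2 * \<alpha> * j \<noteq> 0" using ge by auto
      have "(\<alpha> * real (Suc n))\<^sup>2 \<le> (\<tau> + 2 * \<alpha> * j)\<^sup>2" using ge pos by (metis abs_le_square_iff abs_of_pos)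
      then have "\<bar>C\<bar> / (\<tau> + 2 * \<alpha> * j)\<^sup>2 \<le> \<bar>C\<bar> / (\<alpha> * real (Suc n))\<^sup>2"
        using pos ne by (intro divide_left_mono mult_pos_pos) auto
      moreover have "C / (\<tau> + 2 * \<alpha> * j)\<^sup>2 \<le> \<bar>C\<bar> / (\<tau> + 2 * \<alpha> * j)\<^sup>2" by (intro divide_right_mono) auto
      ultimately have "norm (gaussian_transform u (of_real (\<tau> + 2 * \<alpha> * j))) \<le> \<bar>C\<bar> / (\<alpha> * real (Suc n))\<^sup>2"
        using C[OF ne] by linarith
      then show ?thesis by (simp only: power_mult_distrib) (simp add: divide_inverse del: of_nat_Suc)
    qed
    show "\<forall>\<^sub>F n in sequentially. norm (c * gaussian_transform u (of_real (\<tau> + 2 * \<alpha> * real (Suc n)))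
        + c * gaussian_transform u (of_real (\<tau> + 2 * \<alpha> * - real (Suc n))))
        \<le> norm c * (2 * (\<bar>C\<bar> / \<alpha>\<^sup>2 * inverse (real (Suc n) ^ 2)))"
      unfolding eventually_sequentially
    proof (intro exI[of _ n1] allI impI)
      fix n assume n: "n \<ge> n1"
      let ?a = "gaussian_transform u (of_real (\<tau> + 2 * \<alpha> * real (Suc n)))"
      let ?b = "gaussian_transform u (of_real (\<tau> + 2 * \<alpha> * - real (Suc n)))"
      have "norm (c * ?a + c * ?b) = norm c * norm (?a + ?b)"
        by (simp only: distrib_left[symmetric] norm_mult)
      also have "\<dots> \<le> norm c * (\<bar>C\<bar> / \<alpha>\<^sup>2 * inverse (real (Suc n) ^ 2) + \<bar>C\<bar> / \<alpha>\<^sup>2 * inverse (real (Suc n) ^ 2))"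
        by (intro mult_left_mono order_trans[OF norm_triangle_ineq] add_mono *[OF n]) simp_all
      finally show "norm (c * ?a + c * ?b) \<le> norm c * (2 * (\<bar>C\<bar> / \<alpha>\<^sup>2 * inverse (real (Suc n) ^ 2)))"
        by (simp only: mult_2)
    qed
  qed
next
  case (trig_add \<psi> \<phi>)
  from summable_add[OF trig_add.IH] show ?case
    unfolding coefficient_add[OF trig_add.hyps] by (simp only: add_ac)
qed

text \<open>A linear functional of \<open>\<psi>\<close>. If \<open>u\<close> vanishes on the
  spheres of index at least \<open>n0\<close>, it can depend only on the values of
  \<open>\<psi>\<close> at \<open>n / \<alpha>\<close> with \<open>1 \<le> n < n0\<close>, which is
  the content of \<open>total_eq_0\<close>.\<close>

definition total :: "(real \<Rightarrow> complex) \<Rightarrow> complex" where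
  "total \<psi> = coefficient \<psi> 0 + (\<Sum>n. coefficient \<psi> (real (Suc n)) + coefficient \<psi> (- real (Suc n)))"

lemma total_add:
  assumes "trig \<psi>" "trig \<phi>"
  shows "total (\<lambda>s. \<psi> s + \<phi> s) = total \<psi> + total \<phi>"
  unfolding total_def coefficient_add[OF assms]
  using suminf_add[OF coefficient_summable[OF assms(1)] coefficient_summable[OF assms(2)]]
  by (simp add: algebra_simps)

lemma total_mult: "trig \<psi> \<Longrightarrow> total (\<lambda>s. c * \<psi> s) = c * total \<psi>"
  unfolding total_def coefficient_mult
  using suminf_mult[OF coefficient_summable] by (simp add: distrib_left)

lemma total_sum:
  assumes "finite I" "\<And>i. i \<in> I \<Longrightarrow> trig (\<psi> i)"
  shows "total (\<lambda>s. \<Sum>i\<in>I. \<psi> i s) = (\<Sum>i\<in>I. total (\<psi> i))"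
  using assms
proof induction
  case empty
  show ?case using total_mult[OF trig_cis[of 0 0], of 0] by simp
next
  case (insert i I)
  then show ?case by (simp add: total_add trig_sum)
qed

end

context
  assumes lip: "rapid_lipschitz u" and dim: "DIM('a) \<ge> 3" and n0: "n0 \<ge> 1"
    and vanish: "\<And>x n. n \<ge> n0 \<Longrightarrow> (norm x)\<^sup>2 = real n / \<alpha> \<Longrightarrow> u x = 0"
begin

text \<open>The divisor has simple zeros across the spheres of index \<open>n \<ge> 1\<close>. They
  are compensated by \<open>u\<close> if \<open>n \<ge> n0\<close> and by \<open>\<psi>\<close>
  otherwise, each being Lipschitz. At the origin neither need vanish, and the quotient is of order
  \<open>1 / (norm x)\<^sup>2\<close>, integrable since the dimension is at least 3.\<close>

lemma quotient_integrable:
  assumes \<psi>: "trig \<psi>" "\<And>n. 1 \<le> n \<Longrightarrow> n < n0 \<Longrightarrow> \<psi> (real n / \<alpha>) = 0"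
  shows "integrable lborel (\<lambda>x. u x * \<psi> ((norm x)\<^sup>2) / (cis (2 * pi * \<alpha> * (norm x)\<^sup>2) - 1))"
proof -
  obtain B L where B: "\<And>s. norm (\<psi> s) \<le> B" and L: "\<And>s t. norm (\<psi> s - \<psi> t) \<le> L * \<bar>s - t\<bar>"
    using trig_bounded_lipschitz[OF \<psi>(1)] by metis
  have B0: "B \<ge> 0" using B[of 0] norm_ge_zero order_trans by blast
  have L0: "L \<ge> 0" using order_trans[OF norm_ge_zero L[of 0 1]] by simp
  define W where "W = (\<lambda>x::'a. (1 + norm x) ^ (2 * DIM('a)))"
  have W: "W x > 0" for x unfolding W_def by (intro zero_less_power) (simp add: add_pos_nonneg)
  obtain C where C: "C > 0" "\<And>x. norm (u x) * W x \<le> C" using rapidE[OF u, of "2 * DIM('a)"] unfolding W_def by metis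
  obtain D where D: "\<And>x y. norm (y - x) \<le> 1 \<Longrightarrow> norm (u y - u x) * W x \<le> D * norm (y - x)"
    using lip unfolding rapid_lipschitz_def W_def by metis
  \<comment> \<open>The summand with \<open>L\<close> is for spheres where \<open>\<psi>\<close>
    vanishes, the one with \<open>D\<close> for those where \<open>u\<close> does. \<open>K1\<close>
    adds what is needed inside the innermost sphere but away from the origin.\<close>
  define K where "K = C * L / \<alpha> + B * (\<bar>D\<bar> + C) / sqrt \<alpha>"
  have K0: "K \<ge> 0" unfolding K_def using C(1) L0 B0 \<alpha> by simp
  define K1 where "K1 = K + C * B / \<alpha>"
  have K1: "K1 \<ge> 0" "K \<le> K1" "C * B / \<alpha> \<le> K1" unfolding K1_def using K0 C(1) B0 \<alpha> by auto
  define num where "num = (\<lambda>x. norm (u x * \<psi> ((norm x)\<^sup>2)))"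
  define den where "den = (\<lambda>x::'a. norm (cis (2 * pi * (\<alpha> * (norm x)\<^sup>2)) - 1))"
  have num: "num x * W x \<le> C * B" for x
  proof -
    have "num x * W x = (norm (u x) * W x) * norm (\<psi> ((norm x)\<^sup>2))" unfolding num_def by (simp add: norm_mult)
    also have "\<dots> \<le> C * B" using C B W[of x] by (intro mult_mono) auto
    finally show ?thesis .
  qed
  have main: "num x / den x \<le> K1 / W x + (C * B / \<alpha>) * (indicator (ball 0 1) x * (1 / (norm x)\<^sup>2))" for x
  proof -
    define \<rho> where "\<rho> = \<alpha> * (norm x)\<^sup>2"
    define k where "k = round \<rho>"
    define \<delta> where "\<delta> = \<bar>\<rho> - of_int k\<bar>"
    have d12: "\<delta> \<le> 1 / 2" unfolding \<delta>_def k_def using of_int_round_abs_le[of \<rho>] by (simp add: abs_minus_commute)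
    have den: "den x \<ge> \<delta>" unfolding den_def \<delta>_def \<rho>_def[symmetric]
      using norm_cis_minus_1_ge[of \<rho> k] d12 \<delta>_def by simp
    have rho0: "\<rho> \<ge> 0" unfolding \<rho>_def using \<alpha> by simp
    have k0: "k \<ge> 0" unfolding k_def using round_mono[OF rho0] by simp
    have ind: "(C * B / \<alpha>) * (indicator (ball 0 1) x * (1 / (norm x)\<^sup>2)) \<ge> 0" using C(1) B0 \<alpha> by simp
    have fromK: ?thesis if le: "num x * W x \<le> K1 * \<delta>"
    \<comment> \<open>On a zero of the divisor the quotient is 0 by convention; elsewhere
      \<open>den x \<ge> \<delta>\<close> turns the bound by \<open>\<delta>\<close> into one by the
      divisor.\<close>
    proof (cases "den x = 0")
      case True
      then show ?thesis using ind K1(1) W[of x] by simp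
    next
      case False
      then have dp: "den x > 0" unfolding den_def by simp
      have "num x * W x \<le> K1 * den x" using le mult_left_mono[OF den K1(1)] by linarith
      then have "num x / den x \<le> K1 / W x" using dp W[of x] by (simp add: divide_simps mult.commute)
      then show ?thesis using ind by linarith
    qed
    consider "k = 0" | "k \<ge> 1" using k0 by linarith
    then show ?thesis
    proof cases
      case 1
      then have dr: "\<delta> = \<alpha> * (norm x)\<^sup>2" using rho0 unfolding \<delta>_def \<rho>_def by simp
      show ?thesis
      proof (cases "norm x < 1")
        case True
        show ?thesis
        proof (cases "x = 0")
          case True
          then show ?thesis using K1(1) W[of x] unfolding den_def by simp
        next
          case False
          have "1 \<le> W x" unfolding W_def by (intro one_le_power) simp
          then have nb: "num x \<le> C * B" using num[of x] mult_left_mono[of 1 "W x" "num x"] unfolding num_def by simp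
          have p: "\<alpha> * (norm x)\<^sup>2 > 0" using False \<alpha> by simp
          have "num x / den x \<le> (C * B) / (\<alpha> * (norm x)\<^sup>2)"
            using nb den p dr C(1) B0 by (intro frac_le) (auto simp: num_def)
          also have "\<dots> = (C * B / \<alpha>) * (indicator (ball 0 1) x * (1 / (norm x)\<^sup>2))" using True by simp
          finally show ?thesis using K1(1) W[of x] by (smt (verit) divide_nonneg_pos)
        qed
      next
        case False
        then have "1 \<le> (norm x)\<^sup>2" by simp
        then have "\<alpha> \<le> \<delta>" unfolding dr using \<alpha> by simp
        then have "C * B / \<alpha> * \<alpha> \<le> K1 * \<delta>" using K1 C(1) B0 \<alpha> by (intro mult_mono) auto
        then have "num x * W x \<le> K1 * \<delta>" using num[of x] \<alpha> by simp
        then show ?thesis by (rule fromK)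
      qed
    next
      case 2
      define n where "n = nat k"
      have n: "real n = of_int k" "n \<ge> 1" unfolding n_def using 2 by auto
      have dn: "\<bar>(norm x)\<^sup>2 - real n / \<alpha>\<bar> = \<delta> / \<alpha>"
        unfolding \<delta>_def \<rho>_def n(1) using \<alpha> by (simp add: field_simps abs_if)
      show ?thesis
      proof (cases "n < n0")
        case True
        then have "norm (\<psi> ((norm x)\<^sup>2)) \<le> L * (\<delta> / \<alpha>)" using L[of "(norm x)\<^sup>2" "real n / \<alpha>"] \<psi>(2)[OF n(2)] dn by simp
        then have "(norm (u x) * W x) * norm (\<psi> ((norm x)\<^sup>2)) \<le> C * (L * (\<delta> / \<alpha>))"
          using C W[of x] by (intro mult_mono) auto
        then have "num x * W x \<le> (C * L / \<alpha>) * \<delta>" unfolding num_def by (simp add: norm_mult mult_ac)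
        also have "\<dots> \<le> K1 * \<delta>"
          using K1(2) B0 C(1) \<alpha> unfolding K_def \<delta>_def by (intro mult_right_mono) (auto intro: order_trans[rotated])
        finally show ?thesis by (rule fromK)
      next
        case False
        define r where "r = sqrt (real n / \<alpha>)"
        have r2: "r\<^sup>2 = real n / \<alpha>" unfolding r_def using \<alpha> by simp
        have rge: "r \<ge> 1 / sqrt \<alpha>" unfolding r_def real_sqrt_divide using n(2) \<alpha> by (simp add: divide_right_mono)
        have sa: "sqrt \<alpha> > 0" using \<alpha> by simp
        then have rp: "r > 0" using rge by (meson divide_pos_pos less_le_trans zero_less_one)
        have "\<rho> > 0" using d12 2 unfolding \<delta>_def by linarith
        then have x0: "norm x > 0" unfolding \<rho>_def by (auto simp: zero_less_mult_iff)
        \<comment> \<open>The radial projection of \<open>x\<close> onto the nearest sphere of the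
          family, where \<open>u\<close> vanishes.\<close>
        define y where "y = (r / norm x) *\<^sub>R x"
        have ny: "norm y = r" unfolding y_def using x0 rp by simp
        have "y - x = (r / norm x - 1) *\<^sub>R x" unfolding y_def by (simp add: algebra_simps)
        then have "norm (y - x) = \<bar>r / norm x - 1\<bar> * norm x" by simp
        also have "\<dots> = \<bar>(r / norm x - 1) * norm x\<bar>" by (simp add: abs_mult)
        also have "(r / norm x - 1) * norm x = r - norm x" using x0 by (simp add: left_diff_distrib)
        finally have yx: "norm (y - x) = \<bar>r - norm x\<bar>" .
        have "\<bar>r - norm x\<bar> * (1 / sqrt \<alpha>) \<le> \<bar>r - norm x\<bar> * (r + norm x)"
          using rge x0 by (intro mult_left_mono) linarith+
        also have "\<dots> = \<bar>r\<^sup>2 - (norm x)\<^sup>2\<bar>"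
          using rp x0 by (simp add: power2_eq_square square_diff_square_factored abs_mult mult.commute)
        also have "\<dots> = \<delta> / \<alpha>" using dn unfolding r2 by (simp add: abs_minus_commute)
        finally have "\<bar>r - norm x\<bar> \<le> \<delta> / \<alpha> * sqrt \<alpha>" using sa by (simp add: pos_divide_le_eq)
        also have "\<dots> = \<delta> / sqrt \<alpha>" using \<alpha> sa by (simp add: divide_simps)
        finally have yxd: "norm (y - x) \<le> \<delta> / sqrt \<alpha>" unfolding yx .
        have uy: "u y = 0" using vanish[of n y] False ny r2 by simp
        have "norm (u x) * W x \<le> (\<bar>D\<bar> + C) * (\<delta> / sqrt \<alpha>)"
        \<comment> \<open>The Lipschitz bound is available only within distance 1. If the projection
          may be farther away, \<open>\<delta>\<close> is bounded below and the decay bound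
          \<open>C\<close> suffices.\<close>
        proof (cases "\<delta> / sqrt \<alpha> \<le> 1")
          case True
          have "norm (u x) * W x \<le> D * norm (y - x)" using D[of y x] yxd True uy by simp
          also have "\<dots> \<le> (\<bar>D\<bar> + C) * (\<delta> / sqrt \<alpha>)" using yxd C(1) by (intro mult_mono) auto
          finally show ?thesis .
        next
          case False
          then have "C * 1 \<le> (\<bar>D\<bar> + C) * (\<delta> / sqrt \<alpha>)" using C(1) by (intro mult_mono) auto
          then show ?thesis using C(2)[of x] by simp
        qed
        then have "(norm (u x) * W x) * norm (\<psi> ((norm x)\<^sup>2)) \<le> ((\<bar>D\<bar> + C) * (\<delta> / sqrt \<alpha>)) * B"
          by (rule mult_mono[OF _ B]) (use C(1) sa in \<open>simp_all add: \<delta>_def\<close>)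
        then have "num x * W x \<le> (B * (\<bar>D\<bar> + C) / sqrt \<alpha>) * \<delta>" unfolding num_def by (simp add: norm_mult mult_ac)
        also have "\<dots> \<le> K1 * \<delta>"
          using K1(2) L0 C(1) \<alpha> unfolding K_def \<delta>_def by (intro mult_right_mono) (auto intro: order_trans[rotated])
        finally show ?thesis by (rule fromK)
      qed
    qed
  qed
  show ?thesis
  proof (rule Bochner_Integration.integrable_bound)
    show "integrable lborel (\<lambda>x::'a. K1 * (1 / W x) + (C * B / \<alpha>) * (indicator (ball 0 1) x * (1 / (norm x)\<^sup>2)))"
      unfolding W_def
      by (intro Bochner_Integration.integrable_add integrable_mult_right integrable_decay integrable_inverse_square_near_0 dim)
    show "(\<lambda>x. u x * \<psi> ((norm x)\<^sup>2) / (cis (2 * pi * \<alpha> * (norm x)\<^sup>2) - 1)) \<in> borel_measurable lborel"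
      using rapid_measurable[OF u, measurable] measurable_trig_norm[OF \<psi>(1), measurable] by simp
    have e: "norm (u x * \<psi> ((norm x)\<^sup>2) / (cis (2 * pi * \<alpha> * (norm x)\<^sup>2) - 1)) = num x / den x" for x
      unfolding num_def den_def norm_divide by (simp only: mult.assoc)
    show "AE x in lborel. norm (u x * \<psi> ((norm x)\<^sup>2) / (cis (2 * pi * \<alpha> * (norm x)\<^sup>2) - 1))
        \<le> norm (K1 * (1 / W x) + (C * B / \<alpha>) * (indicator (ball 0 1) x * (1 / (norm x)\<^sup>2)))"
      unfolding e using main abs_ge_self order_trans by (intro AE_I2) fastforce
  qed
qed

lemma norm_geometric_sum_le:
  fixes z :: complex
  assumes "norm z = 1" "z \<noteq> 1"
  shows "norm (\<Sum>j<n. z ^ j) \<le> 2 / norm (z - 1)"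
proof -
  have "norm (z ^ n - 1) \<le> 2"
    using norm_triangle_ineq4[of "z ^ n" 1] assms by (simp add: norm_power)
  then show ?thesis unfolding geometric_sum[OF assms(2)] norm_divide
    by (intro divide_right_mono) auto
qed

text \<open>
  Dividing by \<open>cis (2 * pi * \<alpha> * |x|\<^sup>2) - 1\<close> writes the coefficients as differences \<open>B (j + 1) - B j\<close>.
  The partial sums therefore telescope, and Cesaro means of \<open>B\<close> at either end tend to zero by dominated
  convergence. At the zeros of the divisor, division by zero makes the quotient vanish, which is harmless.
\<close>

lemma total_eq_0:
  assumes decay: "\<exists>C. \<forall>s. s \<noteq> 0 \<longrightarrow> norm (gaussian_transform u (of_real s)) \<le> C / s\<^sup>2"
    and \<psi>: "trig \<psi>" "\<And>n. 1 \<le> n \<Longrightarrow> n < n0 \<Longrightarrow> \<psi> (real n / \<alpha>) = 0"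
  shows "total \<psi> = 0"
proof -
  define w where "w = (\<lambda>x::'a. cis (2 * pi * \<alpha> * (norm x)\<^sup>2))"
  define v where "v = (\<lambda>x. u x * \<psi> ((norm x)\<^sup>2) / (w x - 1))"
  have v: "integrable lborel v" unfolding v_def w_def by (rule quotient_integrable[OF \<psi>])
  have iv: "integrable lborel (\<lambda>x. v x * cis (r * (norm x)\<^sup>2))" for r
    by (rule Bochner_Integration.integrable_bound[OF v])
      (use borel_measurable_integrable[OF v] in \<open>auto simp: norm_mult\<close>)
  define B where "B = (\<lambda>j. LINT x|lborel. v x * cis (2 * pi * \<alpha> * j * (norm x)\<^sup>2))"
  have step: "coefficient \<psi> j = B (j + 1) - B j" for j
  proof -
    have "B (j + 1) - B j = (LINT x|lborel. v x * cis (2 * pi * \<alpha> * (j + 1) * (norm x)\<^sup>2) - v x * cis (2 * pi * \<alpha> * j * (norm x)\<^sup>2))"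
      unfolding B_def by (rule Bochner_Integration.integral_diff[symmetric, OF iv iv])
    also have "\<dots> = coefficient \<psi> j"
      unfolding coefficient_def
    proof (rule integral_cong_AE)
      have "AE x in (lborel :: 'a measure). x \<noteq> 0" by (rule AE_lborel_singleton)
      then show "AE x in lborel. v x * cis (2 * pi * \<alpha> * (j + 1) * (norm x)\<^sup>2) - v x * cis (2 * pi * \<alpha> * j * (norm x)\<^sup>2)
          = u x * (\<psi> ((norm x)\<^sup>2) * cis (2 * pi * \<alpha> * j * (norm x)\<^sup>2))"
      proof eventually_elim
        fix x :: 'a assume x: "x \<noteq> 0"
        have "cis (2 * pi * \<alpha> * (j + 1) * (norm x)\<^sup>2) = w x * cis (2 * pi * \<alpha> * j * (norm x)\<^sup>2)"
          unfolding w_def cis_mult by (simp add: algebra_simps)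
        then have "v x * cis (2 * pi * \<alpha> * (j + 1) * (norm x)\<^sup>2) - v x * cis (2 * pi * \<alpha> * j * (norm x)\<^sup>2)
            = v x * (w x - 1) * cis (2 * pi * \<alpha> * j * (norm x)\<^sup>2)" by (simp add: algebra_simps)
        also have "v x * (w x - 1) = u x * \<psi> ((norm x)\<^sup>2)"
        \<comment> \<open>A zero of the divisor other than the origin lies on a sphere of index
          \<open>n \<ge> 1\<close>, where \<open>u\<close> or \<open>\<psi>\<close> vanishes; so
          both sides are 0. The origin is a null set.\<close>
        proof (cases "w x = 1")
          case True
          define \<rho> where "\<rho> = \<alpha> * (norm x)\<^sup>2"
          have "\<bar>\<rho> - round \<rho>\<bar> \<le> norm (cis (2 * pi * \<rho>) - 1)"
            using of_int_round_abs_le[of \<rho>] by (intro norm_cis_minus_1_ge) (simp add: abs_minus_commute)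
          also have "cis (2 * pi * \<rho>) = 1" using True unfolding w_def \<rho>_def by (simp only: mult.assoc)
          finally have r: "\<rho> = of_int (round \<rho>)" by simp
          have "\<rho> > 0" unfolding \<rho>_def using x \<alpha> by simp
          then have "round \<rho> \<ge> 1" using r by linarith
          then obtain n where n: "round \<rho> = int n" "n \<ge> 1"
            using that[of "nat (round \<rho>)"] by simp
          then have x2: "(norm x)\<^sup>2 = real n / \<alpha>" using r \<alpha> unfolding \<rho>_def by (simp add: field_simps)
          have "u x * \<psi> ((norm x)\<^sup>2) = 0"
            using vanish[OF _ x2] \<psi>(2)[OF n(2)] unfolding x2 by (cases "n < n0") auto
          then show ?thesis using True by simp
        qed (simp add: v_def)
        finally show "v x * cis (2 * pi * \<alpha> * (j + 1) * (norm x)\<^sup>2) - v x * cis (2 * pi * \<alpha> * j * (norm x)\<^sup>2)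
          = u x * (\<psi> ((norm x)\<^sup>2) * cis (2 * pi * \<alpha> * j * (norm x)\<^sup>2))" by (simp only: mult.assoc)
      qed
    qed (use borel_measurable_integrable[OF Bochner_Integration.integrable_diff[OF iv iv]]
           borel_measurable_integrable[OF coefficient_integrable[OF \<psi>(1)]] in auto)
    finally show ?thesis by simp
  qed
  \<comment> \<open>What remains of the sum over \<open>\<bar>j\<bar> \<le> N\<close> after
    telescoping.\<close>
  define X where "X = (\<lambda>N::nat. B (real N + 1) - B (- real N))"
  have partial: "coefficient \<psi> 0 + (\<Sum>n<N. coefficient \<psi> (real (Suc n)) + coefficient \<psi> (- real (Suc n))) = X N" for N
  proof (induction N)
    case 0
    show ?case unfolding X_def step by simp
  next
    case (Suc N)
    define F where "F = (\<lambda>n. coefficient \<psi> (real (Suc n)) + coefficient \<psi> (- real (Suc n)))"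
    have "- real (Suc N) + 1 = - real N" "real (Suc N) = real N + 1" by simp_all
    then have F: "F N = X (Suc N) - X N" unfolding F_def step X_def by (simp only: algebra_simps)
    have "coefficient \<psi> 0 + (\<Sum>n<Suc N. F n) = (coefficient \<psi> 0 + (\<Sum>n<N. F n)) + F N"
      by (simp only: sum.lessThan_Suc add.assoc)
    also have "\<dots> = X N + F N" using Suc unfolding F_def by (simp only:)
    finally show ?case unfolding F by (simp add: F_def del: of_nat_Suc sum.lessThan_Suc)
  qed
  have "X \<longlonglongrightarrow> total \<psi>"
    unfolding total_def[OF decay] partial[symmetric]
    using summable_LIMSEQ[OF coefficient_summable[OF decay \<psi>(1)]] by (intro tendsto_intros) auto
  moreover have "(\<lambda>n. (\<Sum>j<n. X j) /\<^sub>R real n) \<longlonglongrightarrow> 0"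
  proof -
    define g where "g = (\<lambda>n x. v x * ((\<Sum>j<n. w x * w x ^ j - cnj (w x) ^ j) /\<^sub>R real n))"
    have wj: "cis (2 * pi * \<alpha> * (real j + 1) * (norm x)\<^sup>2) = w x * w x ^ j"
        "cis (2 * pi * \<alpha> * (- real j) * (norm x)\<^sup>2) = cnj (w x) ^ j" for j x
      unfolding w_def cis_cnj Complex.DeMoivre cis_mult by (simp_all add: algebra_simps)
    have nw: "norm (w x) = 1" for x unfolding w_def by simp
    have "(\<Sum>j<n. X j) /\<^sub>R real n = (LINT x|lborel. g n x)" for n
    proof -
      have "(\<Sum>j<n. X j) = (\<Sum>j<n. LINT x|lborel. v x * cis (2 * pi * \<alpha> * (real j + 1) * (norm x)\<^sup>2) - v x * cis (2 * pi * \<alpha> * (- real j) * (norm x)\<^sup>2))"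
        unfolding X_def B_def by (intro sum.cong refl Bochner_Integration.integral_diff[symmetric] iv)
      also have "\<dots> = (LINT x|lborel. (\<Sum>j<n. v x * cis (2 * pi * \<alpha> * (real j + 1) * (norm x)\<^sup>2) - v x * cis (2 * pi * \<alpha> * (- real j) * (norm x)\<^sup>2)))"
        by (intro Bochner_Integration.integral_sum[symmetric] Bochner_Integration.integrable_diff iv)
      finally have "(\<Sum>j<n. X j) /\<^sub>R real n = (LINT x|lborel. (\<Sum>j<n. v x * cis (2 * pi * \<alpha> * (real j + 1) * (norm x)\<^sup>2) - v x * cis (2 * pi * \<alpha> * (- real j) * (norm x)\<^sup>2)) /\<^sub>R real n)"
        by (simp only: integral_scaleR_right)
      then show ?thesis unfolding g_def wj
        by (simp only: right_diff_distrib[symmetric] sum_distrib_left[symmetric] mult_scaleR_right)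
    qed
    moreover have "(\<lambda>n. LINT x|lborel. g n x) \<longlonglongrightarrow> (LINT x|(lborel::'a measure). 0)"
    proof (rule integral_dominated_convergence[where w="\<lambda>x. 2 * norm (v x)"])
      show "g n \<in> borel_measurable lborel" for n
      proof -
        have [measurable]: "v \<in> borel_measurable borel" using borel_measurable_integrable[OF v] by simp
        have [measurable]: "w \<in> borel_measurable borel" unfolding w_def by measurable
        have "(\<lambda>x. cnj (w x)) = (\<lambda>x. cis (- (2 * pi * \<alpha>) * (norm x)\<^sup>2))"
          unfolding w_def cis_cnj by (simp only: mult_minus_left)
        then have [measurable]: "(\<lambda>x. cnj (w x)) \<in> borel_measurable borel" by (simp only: measurable_cis_norm)
        show ?thesis unfolding g_def by measurable
      qed
      show "integrable lborel (\<lambda>x. 2 * norm (v x))" by (intro integrable_mult_right integrable_norm v)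
      show "AE x in lborel. norm (g n x) \<le> 2 * norm (v x)" for n
      proof (rule AE_I2)
        fix x
        have "norm (\<Sum>j<n. w x * w x ^ j - cnj (w x) ^ j) \<le> (\<Sum>j<n. 2)"
          by (intro sum_norm_le order_trans[OF norm_triangle_ineq4]) (simp add: norm_mult norm_power nw)
        then have "norm (\<Sum>j<n. w x * w x ^ j - cnj (w x) ^ j) * inverse (real n) \<le> (\<Sum>j<n. 2) * inverse (real n)"
          by (intro mult_right_mono) auto
        also have "\<dots> \<le> 2" by (cases "n = 0") simp_all
        finally have "norm (v x) * (norm (\<Sum>j<n. w x * w x ^ j - cnj (w x) ^ j) * inverse (real n)) \<le> norm (v x) * 2"
          by (intro mult_left_mono) auto
        moreover have "norm (g n x) = norm (v x) * (norm (\<Sum>j<n. w x * w x ^ j - cnj (w x) ^ j) * inverse (real n))"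
          unfolding g_def norm_mult norm_scaleR by (simp add: mult.commute)
        ultimately show "norm (g n x) \<le> 2 * norm (v x)" by (simp only: mult.commute)
      qed
      show "AE x in lborel. (\<lambda>n. g n x) \<longlonglongrightarrow> 0"
      proof (rule AE_I2)
        fix x
        show "(\<lambda>n. g n x) \<longlonglongrightarrow> 0"
        proof (cases "w x = 1")
          case True
          then show ?thesis unfolding g_def v_def by simp
        next
          case False
          \<comment> \<open>Two geometric sums, each bounded by \<open>2 / norm (w x - 1)\<close>
            independently of \<open>n\<close>; averaging then leaves a factor
            \<open>inverse (real n)\<close>.\<close>
          define K where "K = 4 * norm (v x) / norm (w x - 1)"
          have wc: "cnj (w x) \<noteq> 1" "norm (cnj (w x) - 1) = norm (w x - 1)"
            using False complex_cnj_cancel_iff[of "w x" 1] complex_mod_cnj[of "w x - 1"] by simp_all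
          have bd: "norm (g n x) \<le> K * inverse (real n)" for n
          proof -
            have "norm (\<Sum>j<n. w x * w x ^ j - cnj (w x) ^ j) \<le> norm (\<Sum>j<n. w x ^ j) + norm (\<Sum>j<n. cnj (w x) ^ j)"
              unfolding sum_subtractf sum_distrib_left[symmetric]
              by (rule order_trans[OF norm_triangle_ineq4]) (simp add: norm_mult nw)
            also have "\<dots> \<le> 2 / norm (w x - 1) + 2 / norm (w x - 1)"
              using norm_geometric_sum_le[of "w x" n] norm_geometric_sum_le[of "cnj (w x)" n] wc False nw
              by (intro add_mono) auto
            finally have "norm (\<Sum>j<n. w x * w x ^ j - cnj (w x) ^ j) \<le> 4 / norm (w x - 1)" by simp
            then have "norm (v x) * (norm (\<Sum>j<n. w x * w x ^ j - cnj (w x) ^ j) * inverse (real n))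
                \<le> norm (v x) * (4 / norm (w x - 1) * inverse (real n))"
              by (intro mult_left_mono mult_right_mono) auto
            moreover have "norm (g n x) = norm (v x) * (norm (\<Sum>j<n. w x * w x ^ j - cnj (w x) ^ j) * inverse (real n))"
              unfolding g_def norm_mult norm_scaleR by (simp add: mult.commute)
            moreover have "norm (v x) * (4 / norm (w x - 1) * inverse (real n)) = K * inverse (real n)"
              unfolding K_def by simp
            ultimately show ?thesis by (simp only:)
          qed
          have "(\<lambda>n. K * inverse (real n)) \<longlonglongrightarrow> 0"
            using tendsto_mult[OF tendsto_const lim_inverse_n, of K] by simp
          with bd show ?thesis by (rule Lim_null_comparison[OF always_eventually[OF allI]])
        qed
      qed
    qed simp
    ultimately show ?thesis by simp
  qed
  ultimately show ?thesis by (rule cesaro_unique)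
qed

text \<open>Subtracting from the exponential of frequency \<open>t\<close> its interpolation at the
  points \<open>n / \<alpha>\<close> with \<open>1 \<le> n < n0\<close> gives a test function killed
  by \<open>total\<close>. Hence \<open>total\<close> of the exponential is a combination of its
  values at these points, with coefficients independent of \<open>t\<close>; for
  \<open>n0 = 1\<close> the combination is empty.\<close>

theorem poisson_sum_squared_radius:
  assumes decay: "\<exists>C. \<forall>s. s \<noteq> 0 \<longrightarrow> norm (gaussian_transform u (of_real s)) \<le> C / s\<^sup>2"
  obtains c where "\<And>t. (\<lambda>n. gaussian_transform u (of_real (t + 2 * \<alpha> * real (Suc n)))
      + gaussian_transform u (of_real (t - 2 * \<alpha> * real (Suc n))))
    sums ((\<Sum>n\<in>{1..<n0}. c n * cis (pi * t * (real n / \<alpha>))) - gaussian_transform u (of_real t))"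
proof -
  let ?I = "{1..<n0}"
  \<comment> \<open>The frequency \<open>\<alpha> / n0\<close> places the nodes at the angles
    \<open>pi * n / n0\<close>, inside the open upper half circle. They are therefore distinct, as
    their cosines show.\<close>
  define \<zeta> where "\<zeta> = (\<lambda>n::nat. cis (pi * (\<alpha> / real n0) * (real n / \<alpha>)))"
  have "inj_on \<zeta> ?I"
  proof (rule inj_onI)
    fix m n assume mn: "m \<in> ?I" "n \<in> ?I" "\<zeta> m = \<zeta> n"
    have r: "pi * (\<alpha> / real n0) * (real k / \<alpha>) = pi * (real k / real n0)" for k using \<alpha> by simp
    have c: "cos (pi * (real m / real n0)) = cos (pi * (real n / real n0))"
      using arg_cong[OF mn(3), of Re] unfolding \<zeta>_def r by simp
    have b: "0 \<le> pi * (real k / real n0) \<and> pi * (real k / real n0) \<le> pi" if "k \<in> ?I" for k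
    proof -
      have "real k / real n0 \<le> 1" using that by (intro divide_le_eq_1[THEN iffD2]) auto
      then have "pi * (real k / real n0) \<le> pi * 1" by (intro mult_left_mono pi_ge_zero)
      then show ?thesis by simp
    qed
    have "pi * (real m / real n0) = pi * (real n / real n0)"
      by (rule cos_inj_pi[OF _ _ _ _ c]) (use b[OF mn(1)] b[OF mn(2)] in simp_all)
    then have "real m / real n0 = real n / real n0" by (simp only: mult_cancel_left pi_neq_zero simp_thms)
    then show "m = n" using n0 by (simp add: divide_eq_eq)
  qed
  then have "\<exists>p. \<forall>m\<in>?I. poly p (\<zeta> m) = (if m = n then 1 else 0)" if "n \<in> ?I" for n
    using lagrange_poly[OF finite_atLeastLessThan _ that, of \<zeta>] by metis
  then obtain p where p: "\<And>n m. n \<in> ?I \<Longrightarrow> m \<in> ?I \<Longrightarrow> poly (p n) (\<zeta> m) = (if m = n then 1 else 0)" by metis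
  define \<phi> where "\<phi> = (\<lambda>n s. poly (p n) (cis (pi * (\<alpha> / real n0) * s)))"
  have \<phi>: "trig (\<phi> n)" for n unfolding \<phi>_def by (rule trig_poly)
  show thesis
  proof (rule that[of "\<lambda>n. total (\<phi> n)"])
    fix t :: real
    let ?e = "\<lambda>s. 1 * cis (pi * t * s)"
    let ?r = "\<lambda>s. \<Sum>n\<in>?I. - cis (pi * t * (real n / \<alpha>)) * \<phi> n s"
    have tr: "trig ?e" "trig ?r" by (intro trig_cis trig_sum trig_mult \<phi>)+
    have "?e (real m / \<alpha>) + ?r (real m / \<alpha>) = 0" if "1 \<le> m" "m < n0" for m
    proof -
      have m: "m \<in> ?I" using that by simp
      have "?r (real m / \<alpha>) = (\<Sum>n\<in>?I. if m = n then - cis (pi * t * (real n / \<alpha>)) else 0)"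
      proof (intro sum.cong refl)
        fix n assume "n \<in> ?I"
        from p[OF this m] show "- cis (pi * t * (real n / \<alpha>)) * \<phi> n (real m / \<alpha>)
            = (if m = n then - cis (pi * t * (real n / \<alpha>)) else 0)"
          unfolding \<phi>_def \<zeta>_def by (cases "m = n") (simp_all only: simp_thms if_True if_False mult_1_right mult_zero_right)
      qed
      also have "\<dots> = - cis (pi * t * (real m / \<alpha>))"
        unfolding sum.delta'[OF finite_atLeastLessThan] using m by (simp only: if_True)
      finally show ?thesis by (simp only: mult_1 right_minus)
    qed
    then have T0: "total (\<lambda>s. ?e s + ?r s) = 0"
      by (rule total_eq_0[OF decay trig_add[OF tr]])
    have "total ?r = (\<Sum>n\<in>?I. total (\<lambda>s. - cis (pi * t * (real n / \<alpha>)) * \<phi> n s))"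
      by (intro total_sum[OF decay] trig_mult \<phi> finite_atLeastLessThan)
    also have "\<dots> = (\<Sum>n\<in>?I. - (total (\<phi> n) * cis (pi * t * (real n / \<alpha>))))"
      unfolding total_mult[OF decay \<phi>] by (intro sum.cong refl) (simp only: mult_minus_left mult.commute[of "total _"])
    also have "\<dots> = - (\<Sum>n\<in>?I. total (\<phi> n) * cis (pi * t * (real n / \<alpha>)))" by (rule sum_negf)
    finally have T: "total ?e = (\<Sum>n\<in>?I. total (\<phi> n) * cis (pi * t * (real n / \<alpha>)))"
      using T0 unfolding total_add[OF decay tr] by (simp only: add_eq_0_iff2 minus_minus)
    have "(\<lambda>n. coefficient ?e (real (Suc n)) + coefficient ?e (- real (Suc n))) sums (total ?e - coefficient ?e 0)"
      using summable_sums[OF coefficient_summable[OF decay tr(1)]]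
      unfolding total_def[OF decay] by (simp only: add_diff_cancel_left')
    then show "(\<lambda>n. gaussian_transform u (of_real (t + 2 * \<alpha> * real (Suc n)))
      + gaussian_transform u (of_real (t - 2 * \<alpha> * real (Suc n))))
      sums ((\<Sum>n\<in>?I. total (\<phi> n) * cis (pi * t * (real n / \<alpha>))) - gaussian_transform u (of_real t))"
      unfolding T coefficient_cis by (simp only: mult_1 mult_zero_right add_0_right mult_minus_right add_uminus_conv_diff)
  qed
qed

end

end

section \<open>Complex Gaussians\<close>

text \<open>Differentiation under the integral sign. Cauchy's inequality turns the local majorant of
  the integrand into one of its derivative, hence of the difference quotients, and dominated
  convergence applies.\<close>

lemma holomorphic_integral:
  fixes \<phi> :: "complex \<Rightarrow> 'b \<Rightarrow> complex"
  assumes S: "open S"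
    and hol: "\<And>x. (\<lambda>z. \<phi> z x) holomorphic_on S"
    and meas: "\<And>z. z \<in> S \<Longrightarrow> \<phi> z \<in> borel_measurable M"
    and dom: "\<And>z. z \<in> S \<Longrightarrow> \<exists>r>0. ball z r \<subseteq> S \<and> (\<exists>g. integrable M g \<and> (\<forall>w\<in>ball z r. \<forall>x. norm (\<phi> w x) \<le> g x))"
  shows "(\<lambda>z. LINT x|M. \<phi> z x) holomorphic_on S"
  unfolding holomorphic_on_open[OF S]
proof (intro ballI)
  fix z assume z: "z \<in> S"
  from dom[OF z] obtain r g where r: "r > 0" "ball z r \<subseteq> S" and g: "integrable M g"
    and g': "\<forall>w\<in>ball z r. \<forall>x. norm (\<phi> w x) \<le> g x" by (elim exE conjE)
  note g = g g'[rule_format]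
  have int: "integrable M (\<phi> w)" if "w \<in> ball z r" for w
  proof (rule Bochner_Integration.integrable_bound[OF g(1)])
    show "\<phi> w \<in> borel_measurable M" by (rule meas[OF subsetD[OF r(2) that]])
    show "AE x in M. norm (\<phi> w x) \<le> norm (g x)"
      by (intro AE_I2 order_trans[OF g(2)[OF that]]) simp
  qed
  \<comment> \<open>Circles of radius \<open>r / 3\<close> around points of the ball of radius
    \<open>r / 2\<close> stay in the ball of radius \<open>r\<close>.\<close>
  define \<delta> where "\<delta> = r / 2"
  have \<delta>: "\<delta> > 0" "\<delta> < r" using r(1) by (auto simp: \<delta>_def)
  have d1: "(deriv ^^ 1) f = deriv f" for f :: "complex \<Rightarrow> complex" by simp
  have lip: "norm (\<phi> w x - \<phi> z x) \<le> (g x / (r / 3)) * norm (w - z)" if w0: "w \<in> ball z \<delta>" for w x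
  proof (rule field_differentiable_bound[of "ball z \<delta>" "\<lambda>w. \<phi> w x" "\<lambda>w. deriv (\<lambda>w. \<phi> w x) w"])
    show "convex (ball z \<delta>)" by simp
    fix w' assume hw: "w' \<in> ball z \<delta>"
    have sub: "cball w' (r / 3) \<subseteq> ball z r"
    proof
      fix v assume "v \<in> cball w' (r / 3)"
      then have "dist w' v \<le> r / 3" "dist z w' < r / 2" using hw unfolding \<delta>_def by simp_all
      then have "dist z v < r" using dist_triangle[of z v w'] r(1) by linarith
      then show "v \<in> ball z r" by simp
    qed
    have "w' \<in> ball z r" using hw \<delta>(2) unfolding mem_ball by linarith
    then have "w' \<in> S" by (rule subsetD[OF r(2)])
    then show "((\<lambda>w. \<phi> w x) has_field_derivative deriv (\<lambda>w. \<phi> w x) w') (at w' within ball z \<delta>)"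
      by (rule holomorphic_derivI[OF hol S])
    have h: "(\<lambda>w. \<phi> w x) holomorphic_on cball w' (r / 3)"
      by (rule holomorphic_on_subset[OF hol subset_trans[OF sub r(2)]])
    have "norm ((deriv ^^ 1) (\<lambda>w. \<phi> w x) w') \<le> fact 1 * g x / (r / 3) ^ 1"
    proof (rule Cauchy_inequality)
      show "(\<lambda>w. \<phi> w x) holomorphic_on ball w' (r / 3)"
        by (rule holomorphic_on_subset[OF h ball_subset_cball])
      show "continuous_on (cball w' (r / 3)) (\<lambda>w. \<phi> w x)" by (rule holomorphic_on_imp_continuous_on[OF h])
      show "0 < r / 3" using r(1) by simp
      fix v assume "norm (w' - v) = r / 3"
      then have "v \<in> cball w' (r / 3)" by (simp add: dist_norm)
      then show "norm (\<phi> v x) \<le> g x" by (rule g(2)[OF subsetD[OF sub]])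
    qed
    then show "norm (deriv (\<lambda>w. \<phi> w x) w') \<le> g x / (r / 3)"
      by (simp only: d1 fact_1 mult_1 power_one_right)
  next
    show "w \<in> ball z \<delta>" "z \<in> ball z \<delta>" using w0 \<delta> by simp_all
  qed
  define D where "D = (\<lambda>x. deriv (\<lambda>w. \<phi> w x) z)"
  have "((\<lambda>w. ((LINT x|M. \<phi> w x) - (LINT x|M. \<phi> z x)) / (w - z)) \<longlongrightarrow> (LINT x|M. D x)) (at z within ball z \<delta>)"
    unfolding tendsto_at_iff_sequentially o_def
  proof (intro allI impI)
    fix X assume X: "\<forall>i. X i \<in> ball z \<delta> - {z}" "X \<longlonglongrightarrow> z"
    define q where "q = (\<lambda>i x. (\<phi> (X i) x - \<phi> z x) / (X i - z))"
    have Xr: "X i \<in> ball z r" "X i \<noteq> z" for i using X(1)[rule_format, of i] \<delta> by simp_all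
    have zr: "z \<in> ball z r" using r(1) by simp
    have qm: "q i \<in> borel_measurable M" for i
      unfolding q_def using borel_measurable_integrable[OF int[OF Xr(1)]] borel_measurable_integrable[OF int[OF zr]]
      by (intro borel_measurable_divide borel_measurable_diff) auto
    have lim: "(\<lambda>i. q i x) \<longlonglongrightarrow> D x" for x
    proof -
      have "((\<lambda>w. \<phi> w x) has_field_derivative D x) (at z)"
        unfolding D_def by (rule holomorphic_derivI[OF hol S z])
      then have "((\<lambda>w. (\<phi> w x - \<phi> z x) / (w - z)) \<longlongrightarrow> D x) (at z)"
        by (simp add: has_field_derivative_iff)
      from this[unfolded tendsto_at_iff_sequentially o_def, rule_format, of X] show ?thesis
        unfolding q_def using Xr(2) X(2) by simp
    qed
    have "(\<lambda>i. LINT x|M. q i x) \<longlonglongrightarrow> (LINT x|M. D x)"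
    proof (rule integral_dominated_convergence[where w="\<lambda>x. g x / (r / 3)"])
      show "D \<in> borel_measurable M" by (rule borel_measurable_LIMSEQ_metric[OF qm lim])
      show "integrable M (\<lambda>x. g x / (r / 3))" using g(1) by simp
      show "AE x in M. norm (q i x) \<le> g x / (r / 3)" for i
      proof (rule AE_I2)
        fix x
        have "norm (\<phi> (X i) x - \<phi> z x) \<le> (g x / (r / 3)) * norm (X i - z)" using X(1) by (intro lip) simp
        then show "norm (q i x) \<le> g x / (r / 3)"
          unfolding q_def norm_divide using Xr(2)[of i] by (subst pos_divide_le_eq) auto
      qed
    qed (use qm in simp, use lim in simp)
    moreover have "(LINT x|M. q i x) = ((LINT x|M. \<phi> (X i) x) - (LINT x|M. \<phi> z x)) / (X i - z)" for i
      unfolding q_def using Bochner_Integration.integral_diff[OF int[OF Xr(1)] int[OF zr], of i] by simp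
    ultimately show "(\<lambda>i. ((LINT x|M. \<phi> (X i) x) - (LINT x|M. \<phi> z x)) / (X i - z)) \<longlonglongrightarrow> (LINT x|M. D x)" by simp
  qed
  moreover have "at z within ball z \<delta> = at z" using \<delta> by (intro at_within_open) auto
  ultimately have "((\<lambda>z. LINT x|M. \<phi> z x) has_field_derivative (LINT x|M. D x)) (at z)"
    unfolding has_field_derivative_iff by (simp only:)
  then show "\<exists>f'. ((\<lambda>z. LINT x|M. \<phi> z x) has_field_derivative f') (at z)" by blast
qed

section \<open>Fourier transforms of Gaussians\<close>

lemma integrable_gaussian: "c > 0 \<Longrightarrow> integrable lborel (\<lambda>y::real. exp (- (c * y\<^sup>2)))"
proof -
  assume c: "c > 0"
  define \<sigma> where "\<sigma> = 1 / sqrt (2 * c)"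
  have sp: "\<sigma> > 0" unfolding \<sigma>_def using c by simp
  have s: "\<sigma>\<^sup>2 = 1 / (2 * c)" unfolding \<sigma>_def using c by (simp add: power_divide)
  have "integrable lborel (\<lambda>y. sqrt (2 * pi * \<sigma>\<^sup>2) * normal_density 0 \<sigma> y)"
    using sp by (intro integrable_mult_right integrable_normal_density)
  moreover have "sqrt (2 * pi * \<sigma>\<^sup>2) * normal_density 0 \<sigma> y = exp (- (c * y\<^sup>2))" for y
  proof -
    have "sqrt (2 * pi * \<sigma>\<^sup>2) * normal_density 0 \<sigma> y = exp (- (y - 0)\<^sup>2 / (2 * \<sigma>\<^sup>2))"
      unfolding normal_density_def using sp by simp
    then show ?thesis unfolding s using c by simp
  qed
  ultimately show ?thesis by simp
qed

definition gauss_kernel :: "complex \<Rightarrow> real \<Rightarrow> real \<Rightarrow> complex" where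
  "gauss_kernel \<tau> b y = exp (- (of_real pi * \<tau> * of_real (y\<^sup>2))) * cis (- 2 * pi * b * y)"

lemma norm_gauss_kernel: "norm (gauss_kernel \<tau> b y) = exp (- (pi * Re \<tau> * y\<^sup>2))"
  unfolding gauss_kernel_def by (simp add: norm_mult)

lemma gauss_kernel_measurable [measurable]: "gauss_kernel \<tau> b \<in> borel_measurable borel"
  unfolding gauss_kernel_def
  by (intro borel_measurable_continuous_onI) (auto intro!: continuous_intros simp: cis_conv_exp)

lemma gauss_kernel_integrable: "Re \<tau> > 0 \<Longrightarrow> integrable lborel (gauss_kernel \<tau> b)"
  by (rule Bochner_Integration.integrable_bound[OF integrable_gaussian[of "pi * Re \<tau>"]])
    (auto simp: norm_gauss_kernel)

text \<open>The characteristic function of the standard normal distribution after the substitution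
  \<open>x = c * y\<close>, with \<open>c\<^sup>2 = 2 * pi * r\<close> chosen so that
  \<open>x\<^sup>2 / 2\<close> becomes \<open>pi * r * y\<^sup>2\<close>.\<close>

lemma gauss_fourier_real:
  assumes r: "r > 0"
  shows "(LINT y|lborel. gauss_kernel (of_real r) b y) = of_real (sqrt (1 / r) * exp (- pi * b\<^sup>2 / r))"
proof -
  define c where "c = sqrt (2 * pi * r)"
  have c: "c > 0" "c\<^sup>2 = 2 * pi * r" unfolding c_def using r by auto
  define t where "t = - 2 * pi * b / c"
  have "of_real (exp (- (t\<^sup>2) / 2)) = char std_normal_distribution t"
    unfolding char_std_normal_distribution by simp
  also have "\<dots> = (LINT x|lborel. std_normal_density x *\<^sub>R iexp (t * x))"
    unfolding char_def by (subst integral_density) auto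
  also have "\<dots> = \<bar>c\<bar> *\<^sub>R (LINT y|lborel. std_normal_density (0 + c * y) *\<^sub>R iexp (t * (0 + c * y)))"
    using c by (intro lborel_integral_real_affine) auto
  also have "(\<lambda>y. std_normal_density (0 + c * y) *\<^sub>R iexp (t * (0 + c * y)))
      = (\<lambda>y. (1 / sqrt (2 * pi)) *\<^sub>R gauss_kernel (of_real r) b y)"
  proof
    fix y
    have "(c * y)\<^sup>2 / 2 = pi * r * y\<^sup>2" using c by (simp add: power_mult_distrib)
    then have 1: "std_normal_density (0 + c * y) = (1 / sqrt (2 * pi)) * exp (- (pi * r * y\<^sup>2))"
      unfolding std_normal_density_def by simp
    have "t * (0 + c * y) = - 2 * pi * b * y" unfolding t_def using c by simp
    then have 2: "iexp (t * (0 + c * y)) = cis (- 2 * pi * b * y)" by (simp only: cis_conv_exp)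
    have 3: "exp (- (of_real pi * of_real r * of_real (y\<^sup>2))) = (of_real (exp (- (pi * r * y\<^sup>2))) :: complex)"
      by (simp add: exp_of_real[symmetric])
    show "std_normal_density (0 + c * y) *\<^sub>R iexp (t * (0 + c * y)) = (1 / sqrt (2 * pi)) *\<^sub>R gauss_kernel (of_real r) b y"
      unfolding 1 2 gauss_kernel_def 3 scaleR_conv_of_real by (simp only: of_real_mult mult.assoc)
  qed
  finally have "of_real (exp (- (t\<^sup>2) / 2)) = (c / sqrt (2 * pi)) *\<^sub>R (LINT y|lborel. gauss_kernel (of_real r) b y)"
    using c(1) by simp
  also have "c / sqrt (2 * pi) = sqrt r" unfolding c_def using r by (simp add: real_sqrt_mult)
  finally have e: "of_real (exp (- (t\<^sup>2) / 2)) = of_real (sqrt r) * (LINT y|lborel. gauss_kernel (of_real r) b y)"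
    by (simp only: scaleR_conv_of_real)
  have "t\<^sup>2 = (2 * pi) * (2 * pi * b\<^sup>2) / c\<^sup>2" unfolding t_def by (simp add: power2_eq_square)
  then have "- (t\<^sup>2) / 2 = - pi * b\<^sup>2 / r" unfolding c(2) by simp
  then have "of_real (sqrt r) * (LINT y|lborel. gauss_kernel (of_real r) b y) = of_real (exp (- pi * b\<^sup>2 / r))"
    using e by (simp only:)
  then have "(LINT y|lborel. gauss_kernel (of_real r) b y) = of_real (exp (- pi * b\<^sup>2 / r)) / of_real (sqrt r)"
    using r by (simp add: nonzero_eq_divide_eq mult.commute)
  then show ?thesis using r by (simp add: real_sqrt_divide)
qed

text \<open>Both sides are holomorphic in the right half-plane and agree on the positive reals. The
  principal root is the right branch because \<open>1 / \<tau>\<close> never leaves that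
  half-plane.\<close>

lemma gauss_fourier_complex:
  assumes \<tau>: "Re \<tau> > 0"
  shows "(LINT y|lborel. gauss_kernel \<tau> b y) = csqrt (1 / \<tau>) * exp (- (of_real pi * of_real (b\<^sup>2) / \<tau>))"
proof -
  define S where "S = {z::complex. Re z > 0}"
  define F where "F = (\<lambda>\<tau>. LINT y|lborel. gauss_kernel \<tau> b y)"
  define R where "R = (\<lambda>\<tau>. csqrt (1 / \<tau>) * exp (- (of_real pi * of_real (b\<^sup>2) / \<tau>)))"
  have S: "open S" "connected S" "convex S"
    unfolding S_def by (auto simp: open_halfspace_Re_gt convex_halfspace_Re_gt convex_connected)
  have hF: "F holomorphic_on S" unfolding F_def
  proof (rule holomorphic_integral[OF S(1)])
    show "(\<lambda>z. gauss_kernel z b y) holomorphic_on S" for y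
      unfolding gauss_kernel_def by (intro holomorphic_intros)
    show "gauss_kernel z b \<in> borel_measurable lborel" for z by simp
    fix z assume z: "z \<in> S"
    \<comment> \<open>On the ball of radius \<open>Re z / 2\<close> real parts stay at least
      \<open>\<delta>\<close>, so one Gaussian dominates all the kernels.\<close>
    define \<delta> where "\<delta> = Re z / 2"
    have \<delta>: "\<delta> > 0" using z unfolding \<delta>_def S_def by simp
    have ge: "Re w \<ge> \<delta>" if "w \<in> ball z \<delta>" for w
    proof -
      have "\<bar>Re (z - w)\<bar> \<le> norm (z - w)" by (rule abs_Re_le_cmod)
      then show ?thesis using that unfolding \<delta>_def by (simp add: dist_norm)
    qed
    show "\<exists>r>0. ball z r \<subseteq> S \<and> (\<exists>g. integrable lborel g \<and> (\<forall>w\<in>ball z r. \<forall>x. norm (gauss_kernel w b x) \<le> g x))"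
    proof (intro exI conjI ballI allI)
      show "\<delta> > 0" by (rule \<delta>)
      show "ball z \<delta> \<subseteq> S" using ge \<delta> unfolding S_def by fastforce
      show "integrable lborel (\<lambda>y. exp (- (pi * \<delta> * y\<^sup>2)))" using \<delta> by (intro integrable_gaussian) auto
      show "norm (gauss_kernel w b y) \<le> exp (- (pi * \<delta> * y\<^sup>2))" if "w \<in> ball z \<delta>" for w y
        unfolding norm_gauss_kernel using ge[OF that] by (simp add: mult_left_mono mult_right_mono)
    qed
  qed
  have ne: "z \<noteq> 0" "1 / z \<notin> \<real>\<^sub>\<le>\<^sub>0" if "z \<in> S" for z
  proof -
    show "z \<noteq> 0" using that unfolding S_def by auto
    have "Re (1 / z) > 0" using that unfolding S_def by (auto simp: Re_divide intro!: divide_pos_pos sum_power2_gt_zero_iff[THEN iffD2])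
    then show "1 / z \<notin> \<real>\<^sub>\<le>\<^sub>0" by (auto simp: complex_nonpos_Reals_iff)
  qed
  have hR: "R holomorphic_on S" unfolding R_def using ne by (intro holomorphic_intros) auto
  have "F \<tau> - R \<tau> = 0"
  proof (rule analytic_continuation[where S=S and U="of_real ` {0<..}" and \<xi>=1 and f="\<lambda>z. F z - R z"])
    show "(\<lambda>z. F z - R z) holomorphic_on S" by (intro holomorphic_intros hF hR)
    show "of_real ` {0<..} \<subseteq> S" unfolding S_def by auto
    show "1 \<in> S" "\<tau> \<in> S" unfolding S_def using \<tau> by auto
    show "(1::complex) islimpt of_real ` {0<..}"
      unfolding islimpt_approachable
    proof (intro allI impI)
      fix e :: real assume e: "e > 0"
      then have "of_real (1 + e / 2) \<noteq> (1::complex)" by (simp only: of_real_eq_1_iff)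
      moreover have "dist (of_real (1 + e / 2)) (1::complex) < e"
        using e dist_of_real[of "1 + e / 2" 1, where 'a=complex] by (simp add: dist_real_def)
      moreover have "of_real (1 + e / 2) \<in> (of_real ` {0<..} :: complex set)" using e by (intro imageI) simp
      ultimately show "\<exists>x'\<in>of_real ` {0<..}. x' \<noteq> (1::complex) \<and> dist x' 1 < e" by blast
    qed
    fix z :: complex assume "z \<in> of_real ` {0<..}"
    then obtain r where r: "z = of_real r" "r > 0" by auto
    have "csqrt (1 / of_real r) = of_real (sqrt (1 / r))"
      using csqrt_of_real_nonneg[of "of_real (1 / r)"] r by simp
    moreover have "exp (- (of_real pi * of_real (b\<^sup>2) / of_real r)) = (of_real (exp (- pi * b\<^sup>2 / r)) :: complex)"
      by (simp add: exp_of_real[symmetric])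
    ultimately show "F z - R z = 0"
      unfolding F_def R_def r(1) gauss_fourier_real[OF r(2)] by simp
  qed (use S in auto)
  then show ?thesis unfolding F_def R_def by simp
qed

lemma cis_sum: "finite I \<Longrightarrow> cis (\<Sum>i\<in>I. f i) = (\<Prod>i\<in>I. cis (f i))"
  by (induction rule: finite_induct) (simp_all flip: cis_mult)

abbreviation gauss :: "complex \<Rightarrow> 'a::euclidean_space \<Rightarrow> complex" where
  "gauss \<tau> x \<equiv> exp (- (of_real pi * \<tau> * of_real ((norm x)\<^sup>2)))"

abbreviation character :: "'a::euclidean_space \<Rightarrow> 'a \<Rightarrow> complex" where
  "character x \<xi> \<equiv> cis (- 2 * pi * (x \<bullet> \<xi>))"

lemma gauss_fourier:
  fixes a :: "'a::euclidean_space"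
  assumes \<tau>: "Re \<tau> > 0"
  shows "integrable lborel (\<lambda>y::'a. gauss \<tau> y * character y a)"
    and "(LINT y|lborel. gauss \<tau> y * character y a)
      = csqrt (1 / \<tau>) ^ DIM('a) * exp (- (of_real pi * of_real ((norm a)\<^sup>2) / \<tau>))"
proof -
  have nrm: "(norm y)\<^sup>2 = (\<Sum>b\<in>Basis. (y \<bullet> b)\<^sup>2)" for y :: 'a
    unfolding power2_norm_eq_inner by (subst euclidean_inner) (simp add: power2_eq_square)
  have e: "gauss \<tau> y * character y a
      = (\<Prod>b\<in>Basis. gauss_kernel \<tau> (a \<bullet> b) (y \<bullet> b))" for y :: 'a
  proof -
    have "character y a = (\<Prod>b\<in>Basis. cis (- 2 * pi * (a \<bullet> b) * (y \<bullet> b)))"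
    proof -
      have "- 2 * pi * (y \<bullet> a) = (\<Sum>b\<in>Basis. - 2 * pi * (a \<bullet> b) * (y \<bullet> b))"
        unfolding euclidean_inner[of y a] sum_distrib_left by (intro sum.cong refl) simp
      then show ?thesis by (simp only: cis_sum finite_Basis)
    qed
    moreover have "gauss \<tau> y = (\<Prod>b\<in>Basis. exp (- (of_real pi * \<tau> * of_real ((y \<bullet> b)\<^sup>2))))"
      unfolding nrm of_real_sum sum_distrib_left sum_negf[symmetric] by (rule exp_sum) simp
    ultimately show ?thesis unfolding gauss_kernel_def prod.distrib by simp
  qed
  show "integrable lborel (\<lambda>y::'a. gauss \<tau> y * character y a)"
    unfolding e by (intro integrable_lborel_prod gauss_kernel_integrable \<tau>)
  have "(LINT y|lborel. (\<Prod>b\<in>Basis. gauss_kernel \<tau> (a \<bullet> b) ((y::'a) \<bullet> b)))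
      = (\<Prod>b\<in>Basis. csqrt (1 / \<tau>) * exp (- (of_real pi * of_real ((a \<bullet> b)\<^sup>2) / \<tau>)))"
    by (subst integral_lborel_prod) (simp_all only: gauss_kernel_integrable[OF \<tau>] gauss_fourier_complex[OF \<tau>])
  also have "\<dots> = csqrt (1 / \<tau>) ^ DIM('a) * (\<Prod>b\<in>Basis. exp (- (of_real pi * of_real ((a \<bullet> b)\<^sup>2) / \<tau>)))"
    by (simp add: prod.distrib)
  also have "(\<Prod>b\<in>Basis. exp (- (of_real pi * of_real ((a \<bullet> b)\<^sup>2) / \<tau>))) = exp (- (of_real pi * of_real ((norm a)\<^sup>2) / \<tau>))"
    unfolding nrm of_real_sum sum_distrib_left sum_divide_distrib sum_negf[symmetric] by (rule exp_sum[symmetric]) simp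
  finally show "(LINT y|lborel. gauss \<tau> y * character y a)
      = csqrt (1 / \<tau>) ^ DIM('a) * exp (- (of_real pi * of_real ((norm a)\<^sup>2) / \<tau>))"
    unfolding e .
qed

lemma cis_measurable [measurable]: "cis \<in> borel_measurable borel"
  by (intro borel_measurable_continuous_onI) (auto intro!: continuous_intros simp: cis_conv_exp)

lemma complex_exp_measurable [measurable]: "(exp :: complex \<Rightarrow> complex) \<in> borel_measurable borel"
  by (intro borel_measurable_continuous_onI continuous_intros)

section \<open>The functional equation\<close>

definition fourier :: "('a::euclidean_space \<Rightarrow> complex) \<Rightarrow> 'a \<Rightarrow> complex" where
  "fourier f \<xi> = (LINT x|lborel. f x * character x \<xi>)"

text \<open>Fubini moves the Fourier transform from \<open>f\<close> to the Gaussian. The character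
  by \<open>a\<close> on one side becomes a translation on the other; this \<open>a\<close> is the
  parameter expanded later.\<close>

lemma gaussian_multiplication_formula:
  fixes f g :: "'a::euclidean_space \<Rightarrow> complex" and a :: 'a
  assumes f: "rapid f" and g: "g = fourier f" and \<tau>: "Re \<tau> > 0"
  shows "(LINT y|lborel. g y * (gauss \<tau> y * character y a))
    = csqrt (1 / \<tau>) ^ DIM('a) * (LINT x|lborel. f x * exp (- (of_real pi * of_real ((norm (x + a))\<^sup>2) / \<tau>)))"
proof -
  note fm [measurable] = rapid_measurable[OF f]
  define K where "K = (\<lambda>y::'a. gauss \<tau> y)"
  define \<Phi> where "\<Phi> = (\<lambda>x y. f x * (K y * character y (x + a)))"
  have K [measurable]: "K \<in> borel_measurable borel" unfolding K_def by measurable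
  have Ki: "integrable lborel (\<lambda>y. K y * character y b)" for b
    unfolding K_def by (rule gauss_fourier(1)[OF \<tau>])
  have nPhi: "norm (\<Phi> x y) = norm (f x) * norm (K y)" for x y unfolding \<Phi>_def by (simp add: norm_mult)
  have int: "integrable (lborel \<Otimes>\<^sub>M lborel) (case_prod \<Phi>)"
  proof (rule lborel_pair.Fubini_integrable)
    show "case_prod \<Phi> \<in> borel_measurable (lborel \<Otimes>\<^sub>M lborel)"
      unfolding \<Phi>_def by measurable
    have "(\<lambda>x. LINT y|lborel. norm (\<Phi> x y)) = (\<lambda>x. norm (f x) * (LINT y|lborel. norm (K y)))"
      unfolding nPhi by simp
    then show "integrable lborel (\<lambda>x. LINT y|lborel. norm (case (x, y) of (x, y) \<Rightarrow> \<Phi> x y))"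
      using integrable_mult_left[OF integrable_norm[OF rapid_integrable[OF f]]] by simp
    have "integrable lborel (\<Phi> x)" for x unfolding \<Phi>_def by (intro integrable_mult_right Ki)
    then show "AE x in lborel. integrable lborel (\<lambda>y. case (x, y) of (x, y) \<Rightarrow> \<Phi> x y)"
      by (intro AE_I2) simp
  qed
  have "g y * (K y * character y a) = (LINT x|lborel. \<Phi> x y)" for y
  proof -
    have "(LINT x|lborel. \<Phi> x y) = (LINT x|lborel. f x * character x y * (K y * character y a))"
    proof (intro Bochner_Integration.integral_cong refl)
      fix x
      have "character y (x + a) = character x y * character y a"
        unfolding cis_mult by (simp add: inner_add_right inner_commute algebra_simps)
      then show "\<Phi> x y = f x * character x y * (K y * character y a)"
        unfolding \<Phi>_def by (simp only: mult_ac)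
    qed
    also have "\<dots> = (LINT x|lborel. f x * character x y) * (K y * character y a)"
      by (rule integral_mult_left_zero)
    finally show ?thesis unfolding g fourier_def by (simp only:)
  qed
  then have "(LINT y|lborel. g y * (K y * character y a)) = (LINT y|lborel. LINT x|lborel. \<Phi> x y)"
    by (simp only:)
  also have "\<dots> = (LINT x|lborel. LINT y|lborel. \<Phi> x y)"
    by (rule lborel_pair.Fubini_integral[OF int])
  also have "(\<lambda>x. LINT y|lborel. \<Phi> x y)
      = (\<lambda>x. csqrt (1 / \<tau>) ^ DIM('a) * (f x * exp (- (of_real pi * of_real ((norm (x + a))\<^sup>2) / \<tau>))))"
  proof
    fix x
    have "(LINT y|lborel. \<Phi> x y) = f x * (LINT y|lborel. K y * character y (x + a))"
      unfolding \<Phi>_def by (rule integral_mult_right_zero)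
    then show "(LINT y|lborel. \<Phi> x y) = csqrt (1 / \<tau>) ^ DIM('a) * (f x * exp (- (of_real pi * of_real ((norm (x + a))\<^sup>2) / \<tau>)))"
      unfolding K_def gauss_fourier(2)[OF \<tau>] by (simp only: mult_ac)
  qed
  finally show ?thesis unfolding K_def by (simp only: integral_mult_right_zero)
qed

text \<open>The limit \<open>\<tau> \<longlonglongrightarrow> - \<i> * s\<close> from the right
  half-plane. As \<open>\<i> / s\<close> is not on the cut of \<open>csqrt\<close>, the branch is
  continuous there; on both sides the integrands are dominated by the modulus of \<open>g\<close> or
  of \<open>f\<close>.\<close>

lemma oscillatory_multiplication_formula:
  fixes f g :: "'a::euclidean_space \<Rightarrow> complex" and a :: 'a
  assumes f: "rapid f" and g: "rapid g" "g = fourier f" and s: "s \<noteq> 0"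
  shows "(LINT y|lborel. g y * (cis (pi * s * (norm y)\<^sup>2) * character y a))
    = csqrt (\<i> / of_real s) ^ DIM('a) * (LINT x|lborel. f x * cis (- (pi * (norm (x + a))\<^sup>2 / s)))"
proof -
  note fm [measurable] = rapid_measurable[OF f] rapid_measurable[OF g(1)]
  define \<tau> where "\<tau> = (\<lambda>n. of_real (inverse (real (Suc n))) - \<i> * of_real s)"
  have Re: "Re (\<tau> n) = inverse (real (Suc n))" for n unfolding \<tau>_def by (simp del: of_nat_Suc of_real_inverse)
  have Re0: "Re (\<tau> n) > 0" for n unfolding Re by simp
  have lim0: "(\<lambda>n. of_real (inverse (real (Suc n))) :: complex) \<longlonglongrightarrow> of_real 0"
    by (intro tendsto_of_real LIMSEQ_inverse_real_of_nat)
  have lim: "\<tau> \<longlonglongrightarrow> - (\<i> * of_real s)"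
    unfolding \<tau>_def using tendsto_diff[OF lim0 tendsto_const[of "\<i> * of_real s"]] by simp
  have ne: "- (\<i> * of_real s) \<noteq> 0" using s by simp
  have e: "1 / (- (\<i> * of_real s)) = \<i> / of_real s"
    using s by (simp add: field_simps)
  have lim_inv: "(\<lambda>n. 1 / \<tau> n) \<longlonglongrightarrow> \<i> / of_real s"
    unfolding e[symmetric] by (rule tendsto_divide[OF tendsto_const lim ne])
  have "\<i> / of_real s \<notin> \<real>\<^sub>\<le>\<^sub>0" using s by (simp add: complex_nonpos_Reals_iff Im_divide_of_real)
  then have "isCont csqrt (\<i> / of_real s)" by (rule continuous_at_csqrt)
  from isCont_tendsto_compose[OF this lim_inv]
  have c: "(\<lambda>n. csqrt (1 / \<tau> n) ^ DIM('a)) \<longlonglongrightarrow> csqrt (\<i> / of_real s) ^ DIM('a)" by (rule tendsto_power)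
  have ReInv: "Re (1 / \<tau> n) > 0" for n
    using Re0[of n] by (simp add: Re_divide sum_power2_gt_zero_iff)
  have L: "(\<lambda>n. LINT y|lborel. g y * (gauss (\<tau> n) y * character y a))
      \<longlonglongrightarrow> (LINT y|lborel. g y * (cis (pi * s * (norm y)\<^sup>2) * character y a))"
  proof (rule integral_dominated_convergence[where w="\<lambda>y. norm (g y)"])
    show "integrable lborel (\<lambda>y. norm (g y))" by (intro integrable_norm rapid_integrable g)
    show "AE y in lborel. norm (g y * (gauss (\<tau> n) y * character y a)) \<le> norm (g y)" for n
    proof (rule AE_I2)
      fix y :: 'a
      have "norm (gauss (\<tau> n) y :: complex) \<le> 1"
        using Re0[of n] by simp
      then have "norm (g y) * norm (gauss (\<tau> n) y :: complex) \<le> norm (g y) * 1"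
        by (intro mult_left_mono) auto
      then show "norm (g y * (gauss (\<tau> n) y * character y a)) \<le> norm (g y)"
        unfolding norm_mult norm_cis by (simp only: mult_1_right)
    qed
    show "AE y in lborel. (\<lambda>n. g y * (gauss (\<tau> n) y * character y a))
       \<longlonglongrightarrow> g y * (cis (pi * s * (norm y)\<^sup>2) * character y a)"
    proof (rule AE_I2)
      fix y :: 'a
      have "exp (- (of_real pi * (- (\<i> * of_real s)) * of_real ((norm y)\<^sup>2))) = cis (pi * s * (norm y)\<^sup>2)"
        unfolding cis_conv_exp by (simp add: mult_ac)
      moreover have "(\<lambda>n. g y * (gauss (\<tau> n) y * character y a))
         \<longlonglongrightarrow> g y * (exp (- (of_real pi * (- (\<i> * of_real s)) * of_real ((norm y)\<^sup>2))) * character y a)"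
        by (intro tendsto_mult tendsto_exp tendsto_minus tendsto_const lim)
      ultimately show "(\<lambda>n. g y * (gauss (\<tau> n) y * character y a))
       \<longlonglongrightarrow> g y * (cis (pi * s * (norm y)\<^sup>2) * character y a)" by (simp only:)
    qed
  qed measurable
  have R: "(\<lambda>n. LINT x|lborel. f x * exp (- (of_real pi * of_real ((norm (x + a))\<^sup>2) / \<tau> n)))
      \<longlonglongrightarrow> (LINT x|lborel. f x * cis (- (pi * (norm (x + a))\<^sup>2 / s)))"
  proof (rule integral_dominated_convergence[where w="\<lambda>y. norm (f y)"])
    show "integrable lborel (\<lambda>y. norm (f y))" by (intro integrable_norm rapid_integrable f)
    have ex: "exp (- (of_real pi * of_real ((norm (x + a))\<^sup>2) / \<tau> n)) = exp (- (of_real (pi * (norm (x + a))\<^sup>2) * (1 / \<tau> n)))" for x n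
      by simp
    show "AE x in lborel. norm (f x * exp (- (of_real pi * of_real ((norm (x + a))\<^sup>2) / \<tau> n))) \<le> norm (f x)" for n
    proof (rule AE_I2)
      fix x :: 'a
      have "Re (- (of_real (pi * (norm (x + a))\<^sup>2) * (1 / \<tau> n))) = - (pi * (norm (x + a))\<^sup>2 * Re (1 / \<tau> n))"
        by (simp only: uminus_complex.sel times_complex.sel Re_complex_of_real Im_complex_of_real)
      also have "\<dots> \<le> 0" using ReInv[of n] by simp
      finally have "norm (exp (- (of_real (pi * (norm (x + a))\<^sup>2) * (1 / \<tau> n))) :: complex) \<le> 1"
        unfolding norm_exp_eq_Re by simp
      then have "norm (f x) * norm (exp (- (of_real (pi * (norm (x + a))\<^sup>2) * (1 / \<tau> n))) :: complex) \<le> norm (f x) * 1"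
        by (intro mult_left_mono) auto
      then show "norm (f x * exp (- (of_real pi * of_real ((norm (x + a))\<^sup>2) / \<tau> n))) \<le> norm (f x)"
        unfolding ex norm_mult by (simp only: mult_1_right)
    qed
    show "AE x in lborel. (\<lambda>n. f x * exp (- (of_real pi * of_real ((norm (x + a))\<^sup>2) / \<tau> n)))
       \<longlonglongrightarrow> f x * cis (- (pi * (norm (x + a))\<^sup>2 / s))"
    proof (rule AE_I2)
      fix x :: 'a
      have "exp (- (of_real (pi * (norm (x + a))\<^sup>2) * (\<i> / of_real s))) = cis (- (pi * (norm (x + a))\<^sup>2 / s))"
        unfolding cis_conv_exp by (simp add: mult_ac)
      moreover have "(\<lambda>n. f x * exp (- (of_real (pi * (norm (x + a))\<^sup>2) * (1 / \<tau> n))))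
          \<longlonglongrightarrow> f x * exp (- (of_real (pi * (norm (x + a))\<^sup>2) * (\<i> / of_real s)))"
        by (intro tendsto_mult tendsto_exp tendsto_minus tendsto_const lim_inv)
      ultimately show "(\<lambda>n. f x * exp (- (of_real pi * of_real ((norm (x + a))\<^sup>2) / \<tau> n)))
       \<longlonglongrightarrow> f x * cis (- (pi * (norm (x + a))\<^sup>2 / s))" unfolding ex by (simp only:)
    qed
  qed measurable
  show ?thesis
    by (rule LIMSEQ_unique[OF L]) (unfold gaussian_multiplication_formula[OF f g(2) Re0], rule tendsto_mult[OF c R])
qed

lemma rapid_mult_cis:
  assumes "rapid u" "continuous_on UNIV h"
  shows "rapid (\<lambda>x. u x * cis (h x))"
proof -
  have "continuous_on UNIV (\<lambda>x. cis (h x))"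
    unfolding cis_conv_exp using assms(2) by (intro continuous_intros)
  then have "continuous_on UNIV (\<lambda>x. u x * cis (h x))"
    using rapid_continuous[OF assms(1)] by (intro continuous_on_mult)
  then show ?thesis using assms(1) unfolding rapid_def by (simp add: norm_mult)
qed

text \<open>Taylor expansion of the exponential: the terms below order \<open>m\<close> integrate to
  0, and the remainder contributes at most \<open>D * \<epsilon>\<close> after division by
  \<open>\<epsilon> ^ m\<close>.\<close>

lemma leading_moment:
  fixes u :: "'a::euclidean_space \<Rightarrow> complex"
  assumes u: "rapid u" and van: "\<And>j. j < m \<Longrightarrow> (LINT x|lborel. u x * of_real (x \<bullet> w) ^ j) = 0"
  shows "(\<lambda>n. (LINT x|lborel. u x * cis (inverse (real (Suc n)) * (c * (x \<bullet> w)))) / of_real (inverse (real (Suc n))) ^ m)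
    \<longlonglongrightarrow> (\<i> * of_real c) ^ m / fact m * (LINT x|lborel. u x * of_real (x \<bullet> w) ^ m)"
proof -
  define I where "I = (\<lambda>j. LINT x|lborel. u x * of_real (x \<bullet> w) ^ j)"
  have um: "rapid (\<lambda>x. u x * of_real (x \<bullet> w) ^ j)" for j by (rule rapid_mult_inner_power[OF u])
  define D where "D = (LINT x|lborel. norm (u x * of_real (x \<bullet> w) ^ Suc m)) * \<bar>c\<bar> ^ Suc m"
  have main: "norm ((LINT x|lborel. u x * cis (\<epsilon> * (c * (x \<bullet> w)))) / of_real \<epsilon> ^ m - (\<i> * of_real c) ^ m / fact m * I m) \<le> D * \<epsilon>"
    if \<epsilon>: "\<epsilon> > 0" for \<epsilon>
  proof -
    define T where "T = (\<lambda>x. \<Sum>k\<le>m. ((\<i> * of_real (\<epsilon> * c)) ^ k / fact k) * (u x * of_real (x \<bullet> w) ^ k))"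
    have "(LINT x|lborel. T x) = (\<Sum>k\<le>m. (LINT x|lborel. ((\<i> * of_real (\<epsilon> * c)) ^ k / fact k) * (u x * of_real (x \<bullet> w) ^ k)))"
      unfolding T_def by (intro Bochner_Integration.integral_sum integrable_mult_right rapid_integrable um)
    also have "\<dots> = (\<Sum>k\<le>m. ((\<i> * of_real (\<epsilon> * c)) ^ k / fact k) * I k)"
      unfolding I_def by (intro sum.cong refl integral_mult_right_zero)
    also have "\<dots> = (\<Sum>k\<in>{m}. ((\<i> * of_real (\<epsilon> * c)) ^ k / fact k) * I k)"
      using van unfolding I_def by (intro sum.mono_neutral_right) auto
    finally have T: "(LINT x|lborel. T x) = (\<i> * of_real (\<epsilon> * c)) ^ m / fact m * I m" by simp
    have Ti: "integrable lborel T"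
      unfolding T_def by (intro Bochner_Integration.integrable_sum integrable_mult_right rapid_integrable um)
    have ui: "integrable lborel (\<lambda>x. u x * cis (\<epsilon> * (c * (x \<bullet> w))))"
      by (intro rapid_integrable rapid_mult_cis u continuous_intros)
    have bound: "norm (u x * cis (\<epsilon> * (c * (x \<bullet> w))) - T x) \<le> \<epsilon> ^ Suc m * (norm (u x * of_real (x \<bullet> w) ^ Suc m) * \<bar>c\<bar> ^ Suc m)" for x
    proof -
      define y where "y = \<epsilon> * (c * (x \<bullet> w))"
      have "T x = u x * (\<Sum>k\<le>m. (\<i> * of_real y) ^ k / fact k)"
        unfolding T_def sum_distrib_left y_def
        by (intro sum.cong refl) (simp add: power_mult_distrib)
      then have "u x * cis y - T x = u x * (iexp y - (\<Sum>k\<le>m. (\<i> * of_real y) ^ k / fact k))"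
        by (simp only: right_diff_distrib cis_conv_exp)
      then have "norm (u x * cis y - T x) = norm (u x) * norm (iexp y - (\<Sum>k\<le>m. (\<i> * of_real y) ^ k / fact k))"
        by (simp only: norm_mult)
      also have "\<dots> \<le> norm (u x) * (\<bar>y\<bar> ^ Suc m / fact (Suc m))" by (intro mult_left_mono iexp_approx1) auto
      also have "\<dots> \<le> norm (u x) * (\<bar>y\<bar> ^ Suc m / 1)"
        by (intro mult_left_mono divide_left_mono fact_ge_1) auto
      also have "\<dots> = \<epsilon> ^ Suc m * (norm (u x * of_real (x \<bullet> w) ^ Suc m) * \<bar>c\<bar> ^ Suc m)"
        unfolding y_def using \<epsilon> by (simp only: abs_mult power_mult_distrib norm_mult norm_power norm_of_real abs_of_pos) simp
      finally show ?thesis unfolding y_def .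
    qed
    have "(LINT x|lborel. u x * cis (\<epsilon> * (c * (x \<bullet> w)))) - (\<i> * of_real (\<epsilon> * c)) ^ m / fact m * I m
        = (LINT x|lborel. u x * cis (\<epsilon> * (c * (x \<bullet> w))) - T x)"
      unfolding T[symmetric] by (rule Bochner_Integration.integral_diff[symmetric, OF ui Ti])
    then have "norm ((LINT x|lborel. u x * cis (\<epsilon> * (c * (x \<bullet> w)))) - (\<i> * of_real (\<epsilon> * c)) ^ m / fact m * I m)
        \<le> (LINT x|lborel. norm (u x * cis (\<epsilon> * (c * (x \<bullet> w))) - T x))" by (simp only: integral_norm_bound)
    also have "\<dots> \<le> (LINT x|lborel. \<epsilon> ^ Suc m * (norm (u x * of_real (x \<bullet> w) ^ Suc m) * \<bar>c\<bar> ^ Suc m))"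
      by (intro integral_mono integrable_norm Bochner_Integration.integrable_diff ui Ti integrable_mult_right
          integrable_mult_left rapid_integrable um bound)
    also have "\<dots> = \<epsilon> ^ Suc m * D" unfolding D_def by (simp only: integral_mult_right_zero integral_mult_left_zero)
    finally have le: "norm ((LINT x|lborel. u x * cis (\<epsilon> * (c * (x \<bullet> w)))) - (\<i> * of_real (\<epsilon> * c)) ^ m / fact m * I m) \<le> \<epsilon> ^ Suc m * D" .
    have "(LINT x|lborel. u x * cis (\<epsilon> * (c * (x \<bullet> w)))) / of_real \<epsilon> ^ m - (\<i> * of_real c) ^ m / fact m * I m
      = ((LINT x|lborel. u x * cis (\<epsilon> * (c * (x \<bullet> w)))) - (\<i> * of_real (\<epsilon> * c)) ^ m / fact m * I m) / of_real \<epsilon> ^ m"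
      using \<epsilon> by (simp add: diff_divide_distrib power_mult_distrib)
    moreover have "norm (z / of_real \<epsilon> ^ m) = norm z / \<epsilon> ^ m" for z :: complex
      using \<epsilon> by (simp add: norm_divide norm_power)
    ultimately have "norm ((LINT x|lborel. u x * cis (\<epsilon> * (c * (x \<bullet> w)))) / of_real \<epsilon> ^ m - (\<i> * of_real c) ^ m / fact m * I m)
      \<le> (\<epsilon> ^ Suc m * D) / \<epsilon> ^ m"
      using divide_right_mono[OF le, of "\<epsilon> ^ m"] \<epsilon> by (simp only: zero_le_power less_imp_le)
    then show ?thesis using \<epsilon> by (simp add: mult.commute)
  qed
  have "(\<lambda>n. D * inverse (real (Suc n))) \<longlonglongrightarrow> D * 0"
    by (rule tendsto_mult[OF tendsto_const LIMSEQ_inverse_real_of_nat])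
  then have z: "(\<lambda>n. D * inverse (real (Suc n))) \<longlonglongrightarrow> 0" by (simp only: mult_zero_right)
  have "(\<lambda>n. (LINT x|lborel. u x * cis (inverse (real (Suc n)) * (c * (x \<bullet> w)))) / of_real (inverse (real (Suc n))) ^ m - (\<i> * of_real c) ^ m / fact m * I m) \<longlonglongrightarrow> 0"
    by (rule Lim_null_comparison[OF always_eventually[OF allI[OF main]] z]) simp
  then show ?thesis unfolding I_def by (rule LIM_zero_cancel)
qed

text \<open>A branch of \<open>(\<i> / z)\<close> to the power \<open>d / 2\<close>, divided by
  \<open>z ^ m\<close>. Its modulus is that of the multiplier for dimension
  \<open>d + 2 * m\<close>, so a factor of degree \<open>m\<close> acts like \<open>2 * m\<close>
  further dimensions.\<close>

definition weight :: "nat \<Rightarrow> nat \<Rightarrow> complex \<Rightarrow> complex" where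
  "weight d m z = csqrt (\<i> / z) ^ d / z ^ m"

text \<open>
  Both sides of the multiplication formula with \<open>a = \<epsilon> w\<close> have order \<open>m\<close> as \<open>\<epsilon>\<close> tends to \<open>0\<close>;
  the functional equation compares their leading coefficients.
\<close>

theorem gaussian_functional_equation:
  fixes f g :: "'a::euclidean_space \<Rightarrow> complex" and w :: 'a
  assumes f: "rapid f" and g: "rapid g" "g = fourier f" and s: "s \<noteq> 0"
    and vf: "\<And>j t. j < m \<Longrightarrow> gaussian_transform (\<lambda>x. f x * of_real (x \<bullet> w) ^ j) (of_real t) = 0"
    and vg: "\<And>j t. j < m \<Longrightarrow> gaussian_transform (\<lambda>x. g x * of_real (x \<bullet> w) ^ j) (of_real t) = 0"
  shows "gaussian_transform (\<lambda>x. g x * of_real (x \<bullet> w) ^ m) (of_real s)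
    = weight DIM('a) m (of_real s) * gaussian_transform (\<lambda>x. f x * of_real (x \<bullet> w) ^ m) (of_real (- 1 / s))"
proof -
  define ug where "ug = (\<lambda>y. g y * cis (pi * s * (norm y)\<^sup>2))"
  define uf where "uf = (\<lambda>x. f x * cis (pi * (- 1 / s) * (norm x)\<^sup>2))"
  have r: "rapid ug" "rapid uf" unfolding ug_def uf_def by (intro rapid_mult_cis f g continuous_intros)+
  have mg: "(LINT x|lborel. ug x * of_real (x \<bullet> w) ^ j) = gaussian_transform (\<lambda>x. g x * of_real (x \<bullet> w) ^ j) (of_real s)" for j
    unfolding ug_def gaussian_transform_real by (simp only: mult_ac)
  have mf: "(LINT x|lborel. uf x * of_real (x \<bullet> w) ^ j) = gaussian_transform (\<lambda>x. f x * of_real (x \<bullet> w) ^ j) (of_real (- 1 / s))" for j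
    unfolding uf_def gaussian_transform_real by (simp only: mult_ac)
  define \<epsilon> where "\<epsilon> = (\<lambda>n. inverse (real (Suc n)))"
  define Lg where "Lg = (\<lambda>n. (LINT x|lborel. ug x * cis (\<epsilon> n * ((- 2 * pi) * (x \<bullet> w)))) / of_real (\<epsilon> n) ^ m)"
  define Lf where "Lf = (\<lambda>n. (LINT x|lborel. uf x * cis (\<epsilon> n * ((- 2 * pi / s) * (x \<bullet> w)))) / of_real (\<epsilon> n) ^ m)"
  define k where "k = csqrt (\<i> / of_real s) ^ DIM('a)"
  have limg: "Lg \<longlonglongrightarrow> (\<i> * of_real (- 2 * pi)) ^ m / fact m * (LINT x|lborel. ug x * of_real (x \<bullet> w) ^ m)"
    unfolding Lg_def \<epsilon>_def by (rule leading_moment[OF r(1)]) (simp only: mg vg)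
  have limf: "Lf \<longlonglongrightarrow> (\<i> * of_real (- 2 * pi / s)) ^ m / fact m * (LINT x|lborel. uf x * of_real (x \<bullet> w) ^ m)"
    unfolding Lf_def \<epsilon>_def by (rule leading_moment[OF r(2)]) (simp only: mf vf)
  have eq: "Lg n = k * cis (- (pi * (norm w)\<^sup>2 / s) * (\<epsilon> n)\<^sup>2) * Lf n" for n
  proof -
    define e where "e = \<epsilon> n"
    have "(LINT y|lborel. ug y * cis (e * ((- 2 * pi) * (y \<bullet> w)))) = (LINT y|lborel. g y * (cis (pi * s * (norm y)\<^sup>2) * character y (e *\<^sub>R w)))"
      unfolding ug_def inner_scaleR_right by (simp only: mult_ac)
    also have "\<dots> = k * (LINT x|lborel. f x * cis (- (pi * (norm (x + e *\<^sub>R w))\<^sup>2 / s)))"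
      unfolding k_def by (rule oscillatory_multiplication_formula[OF f g s])
    also have "(\<lambda>x. f x * cis (- (pi * (norm (x + e *\<^sub>R w))\<^sup>2 / s)))
        = (\<lambda>x. cis (- (pi * (norm w)\<^sup>2 / s) * e\<^sup>2) * (uf x * cis (e * ((- 2 * pi / s) * (x \<bullet> w)))))"
    proof
      \<comment> \<open>Of the expanded square of \<open>norm (x + e *\<^sub>R w)\<close>, the cross
        term provides the character whose moments are compared; the term of order
        \<open>e\<^sup>2\<close> is a unimodular constant tending to 1.\<close>
      fix x
      have "(norm (x + e *\<^sub>R w))\<^sup>2 = (norm x)\<^sup>2 + 2 * e * (x \<bullet> w) + e\<^sup>2 * (norm w)\<^sup>2"
        unfolding power2_norm_eq_inner
        by (simp add: inner_add_left inner_add_right inner_commute power2_eq_square algebra_simps)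
      then have "- (pi * (norm (x + e *\<^sub>R w))\<^sup>2 / s)
        = - (pi * (norm w)\<^sup>2 / s) * e\<^sup>2 + (pi * (- 1 / s) * (norm x)\<^sup>2 + e * ((- 2 * pi / s) * (x \<bullet> w)))"
        using s by (simp add: field_simps)
      then have "cis (- (pi * (norm (x + e *\<^sub>R w))\<^sup>2 / s))
        = cis (- (pi * (norm w)\<^sup>2 / s) * e\<^sup>2) * (cis (pi * (- 1 / s) * (norm x)\<^sup>2) * cis (e * ((- 2 * pi / s) * (x \<bullet> w))))"
        by (simp only: cis_mult)
      then show "f x * cis (- (pi * (norm (x + e *\<^sub>R w))\<^sup>2 / s))
        = cis (- (pi * (norm w)\<^sup>2 / s) * e\<^sup>2) * (uf x * cis (e * ((- 2 * pi / s) * (x \<bullet> w))))"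
        unfolding uf_def by (simp only: mult_ac)
    qed
    finally have "(LINT y|lborel. ug y * cis (e * ((- 2 * pi) * (y \<bullet> w))))
      = k * (cis (- (pi * (norm w)\<^sup>2 / s) * e\<^sup>2) * (LINT x|lborel. uf x * cis (e * ((- 2 * pi / s) * (x \<bullet> w)))))"
      by (simp only: integral_mult_right_zero)
    then show ?thesis unfolding Lg_def Lf_def e_def by (simp only: times_divide_eq_right mult.assoc)
  qed
  have "(\<lambda>n. cis (- (pi * (norm w)\<^sup>2 / s) * (\<epsilon> n)\<^sup>2)) \<longlonglongrightarrow> 1"
  proof -
    have "(\<lambda>n. \<epsilon> n) \<longlonglongrightarrow> 0" unfolding \<epsilon>_def by (rule LIMSEQ_inverse_real_of_nat)
    then have "(\<lambda>n. - (pi * (norm w)\<^sup>2 / s) * (\<epsilon> n)\<^sup>2) \<longlonglongrightarrow> - (pi * (norm w)\<^sup>2 / s) * 0\<^sup>2"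
      by (intro tendsto_mult tendsto_power tendsto_const)
    then have l: "(\<lambda>n. - (pi * (norm w)\<^sup>2 / s) * (\<epsilon> n)\<^sup>2) \<longlonglongrightarrow> 0" by simp
    have "isCont cis 0" unfolding cis_conv_exp by (intro continuous_intros)
    from isCont_tendsto_compose[OF this l] show ?thesis by simp
  qed
  then have "(\<lambda>n. k * cis (- (pi * (norm w)\<^sup>2 / s) * (\<epsilon> n)\<^sup>2) * Lf n)
     \<longlonglongrightarrow> k * 1 * ((\<i> * of_real (- 2 * pi / s)) ^ m / fact m * (LINT x|lborel. uf x * of_real (x \<bullet> w) ^ m))"
    by (intro tendsto_mult tendsto_const limf)
  then have "Lg \<longlonglongrightarrow> k * 1 * ((\<i> * of_real (- 2 * pi / s)) ^ m / fact m * (LINT x|lborel. uf x * of_real (x \<bullet> w) ^ m))"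
    unfolding eq[symmetric] .
  from LIMSEQ_unique[OF limg this]
  have e1: "(\<i> * of_real (- 2 * pi)) ^ m / fact m * (LINT x|lborel. ug x * of_real (x \<bullet> w) ^ m)
    = k * 1 * ((\<i> * of_real (- 2 * pi / s)) ^ m / fact m * (LINT x|lborel. uf x * of_real (x \<bullet> w) ^ m))" .
  \<comment> \<open>The two frequencies differ by the factor \<open>s\<close>, the origin of
    \<open>z ^ m\<close> in \<open>weight\<close>.\<close>
  have e2: "(\<i> * of_real (- 2 * pi / s)) ^ m = (\<i> * of_real (- 2 * pi)) ^ m / of_real s ^ m"
    by (simp add: power_divide[symmetric])
  have cancel: "X = k / S * Y" if "A / F * X = k * 1 * (A / S / F * Y)" "A / F \<noteq> 0" for X Y A F S :: complex
  proof -
    have "A / F * X = A / F * (k / S * Y)" using that(1) by (simp add: mult_ac)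
    then show ?thesis using that(2) by (simp only: mult_cancel_left) simp
  qed
  have "(LINT x|lborel. ug x * of_real (x \<bullet> w) ^ m) = k / of_real s ^ m * (LINT x|lborel. uf x * of_real (x \<bullet> w) ^ m)"
    by (rule cancel[OF e1[unfolded e2]]) simp
  then show ?thesis unfolding mg mf weight_def k_def .
qed

section \<open>Recovering a function from its Gaussian transforms\<close>

lemma norm_gaussian_exp_le:
  "Im z \<ge> 0 \<Longrightarrow> norm (chirp z x :: complex) \<le> 1"
  for x :: "'a::euclidean_space"
proof -
  assume z: "Im z \<ge> 0"
  have "\<i> * of_real pi * z * of_real ((norm x)\<^sup>2) = of_real (pi * (norm x)\<^sup>2) * (\<i> * z)"
    by (simp add: mult_ac)
  then have "Re (\<i> * of_real pi * z * of_real ((norm x)\<^sup>2)) = pi * (norm x)\<^sup>2 * Re (\<i> * z)"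
    by (simp only: times_complex.sel Re_complex_of_real Im_complex_of_real)
  also have "\<dots> = - (pi * (norm x)\<^sup>2 * Im z)" by simp
  also have "\<dots> \<le> 0" using z by simp
  finally show ?thesis unfolding norm_exp_eq_Re by simp
qed

lemma norm_gaussian_integrand_le:
  fixes x :: "'a::euclidean_space" and c :: complex
  assumes "Im z \<ge> 0"
  shows "norm (c * chirp z x) \<le> norm c"
  using mult_left_mono[OF norm_gaussian_exp_le[OF assms, of x] norm_ge_zero[of c]]
  by (simp only: norm_mult mult_1_right)

lemma gaussian_integrand_measurable:
  assumes "rapid u"
  shows "(\<lambda>x. u x * chirp z x) \<in> borel_measurable borel"
proof -
  note [measurable] = rapid_measurable[OF assms]
  show ?thesis by measurable
qed

lemma norm_gaussian_transform_le:
  assumes "rapid u" "Im z \<ge> 0"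
  shows "norm (gaussian_transform u z) \<le> (LINT x|lborel. norm (u x))"
proof -
  have "norm (gaussian_transform u z) \<le> (LINT x|lborel. norm (u x * chirp z x))"
    unfolding gaussian_transform_def by (rule integral_norm_bound)
  also have "\<dots> \<le> (LINT x|lborel. norm (u x))"
  proof (rule integral_mono')
    show "integrable lborel (\<lambda>x. norm (u x))" by (intro integrable_norm rapid_integrable assms)
  qed (use norm_gaussian_integrand_le[OF assms(2)] in auto)
  finally show ?thesis .
qed

lemma gaussian_transform_continuous:
  assumes u: "rapid u"
  shows "continuous_on {z. 0 \<le> Im z} (gaussian_transform u)"
proof (rule continuous_on_sequentiallyI)
  fix Z a assume Z: "\<forall>n. Z n \<in> {z. 0 \<le> Im z}" "a \<in> {z. 0 \<le> Im z}" "Z \<longlonglongrightarrow> a"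
  show "(\<lambda>n. gaussian_transform u (Z n)) \<longlonglongrightarrow> gaussian_transform u a"
    unfolding gaussian_transform_def
  proof (rule integral_dominated_convergence[where w="\<lambda>x. norm (u x)"])
    show "integrable lborel (\<lambda>x. norm (u x))" by (intro integrable_norm rapid_integrable u)
    show "AE x in lborel. (\<lambda>n. u x * chirp (Z n) x)
        \<longlonglongrightarrow> u x * chirp a x"
      by (intro AE_I2 tendsto_mult tendsto_exp tendsto_const Z(3))
    show "AE x in lborel. norm (u x * chirp (Z n) x) \<le> norm (u x)" for n
      using Z(1) by (intro AE_I2 norm_gaussian_integrand_le) simp
  qed (use gaussian_integrand_measurable[OF u] in simp_all)
qed

lemma gaussian_transform_holomorphic:
  assumes u: "rapid u"
  shows "gaussian_transform u holomorphic_on {z. 0 < Im z}"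
  unfolding gaussian_transform_def
proof (rule holomorphic_integral)
  show "open {z. 0 < Im z}" by (rule open_halfspace_Im_gt)
  show "(\<lambda>z. u x * chirp z x) holomorphic_on {z. 0 < Im z}" for x
    by (intro holomorphic_intros)
  show "(\<lambda>x. u x * chirp z x) \<in> borel_measurable lborel" for z
    using gaussian_integrand_measurable[OF u] by simp
  fix z :: complex assume z: "z \<in> {z. 0 < Im z}"
  obtain r where r: "r > 0" "ball z r \<subseteq> {z. 0 < Im z}"
    using open_contains_ball_eq[OF open_halfspace_Im_gt] z by metis
  have "norm (u x * chirp w x) \<le> norm (u x)" if "w \<in> ball z r" for w x
    using subsetD[OF r(2) that] by (intro norm_gaussian_integrand_le) simp
  then show "\<exists>r>0. ball z r \<subseteq> {z. 0 < Im z} \<and> (\<exists>g. integrable lborel g \<and>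
      (\<forall>w\<in>ball z r. \<forall>x. norm (u x * chirp w x) \<le> g x))"
    by (intro exI[of _ r] conjI r exI[of _ "\<lambda>x. norm (u x)"] integrable_norm rapid_integrable u ballI allI)
qed

text \<open>Zero boundary values are in particular real, so Schwarz reflection produces an entire
  function, which vanishes on the real line.\<close>

lemma gaussian_transform_zero_extends:
  assumes u: "rapid u" and zero: "\<And>t. gaussian_transform u (of_real t) = 0" and z: "Im z \<ge> 0"
  shows "gaussian_transform u z = 0"
proof -
  define F where "F = gaussian_transform u"
  define G where "G = (\<lambda>z. if 0 \<le> Im z then F z else cnj (F (cnj z)))"
  have F0: "F z = 0" if "z \<in> \<real>" for z using that zero unfolding F_def by (auto elim: Reals_cases)
  have hG: "G holomorphic_on UNIV"
    unfolding G_def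
  proof (rule Schwarz_reflection)
    show "F holomorphic_on UNIV \<inter> {z. 0 < Im z}"
      using gaussian_transform_holomorphic[OF u] unfolding F_def by simp
    show "continuous_on (UNIV \<inter> {z. 0 \<le> Im z}) F"
      using gaussian_transform_continuous[OF u] unfolding F_def by simp
    show "F z \<in> \<real>" if "z \<in> \<real>" for z using F0[OF that] by simp
  qed simp_all
  have "G z = 0"
  proof (rule analytic_continuation[OF hG, of \<real> 0])
    show "(0::complex) islimpt \<real>"
      unfolding islimpt_approachable
    proof (intro allI impI)
      fix e :: real assume "e > 0"
      then show "\<exists>x'\<in>\<real>. x' \<noteq> 0 \<and> dist x' (0::complex) < e"
        by (intro bexI[of _ "of_real (e / 2)"]) auto
    qed
    fix z :: complex assume "z \<in> \<real>"
    then show "G z = 0" using F0 unfolding G_def by (auto simp: complex_is_Real_iff)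
  qed auto
  then show ?thesis using z unfolding G_def F_def by simp
qed

text \<open>Up to a constant factor, \<open>exp (c * (x \<bullet> w))\<close> turns the Gaussian
  centred at 0 into the one centred at \<open>w\<close>, and its power series brings in the moments.
  The partial sums are dominated because \<open>c * norm x * norm w\<close> exceeds
  \<open>pi * N * (norm x)\<^sup>2\<close> by at most
  \<open>pi * N * (norm w)\<^sup>2\<close>.\<close>

lemma gaussian_moments_zero:
  fixes f :: "'a::euclidean_space \<Rightarrow> complex"
  assumes f: "rapid f" and zero: "\<And>m. gaussian_transform (\<lambda>x. f x * of_real (x \<bullet> w) ^ m) (\<i> * of_real N) = 0"
    and N: "N > 0"
  shows "(LINT x|lborel. f x * of_real (exp (- (pi * N * (norm (x - w))\<^sup>2)))) = 0"
proof -
  note [measurable] = rapid_measurable[OF f]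
  define E where "E = (\<lambda>x::'a. exp (- (pi * N * (norm x)\<^sup>2)))"
  define c where "c = 2 * pi * N"
  have gE: "chirp (\<i> * of_real N) x = (of_real (E x) :: complex)" for x :: 'a
  proof -
    have "\<i> * of_real pi * (\<i> * of_real N) * of_real r = (of_real (- (pi * N * r)) :: complex)" for r
      by (simp add: complex_eq_iff)
    then show ?thesis unfolding E_def by (simp only: exp_of_real)
  qed
  define F where "F = (\<lambda>m x. of_real ((c * (x \<bullet> w)) ^ m / fact m) * (f x * of_real (E x)))"
  have Fi: "integrable lborel (F m) \<and> (LINT x|lborel. F m x) = 0" for m
  proof -
    have e: "F m x = of_real (c ^ m / fact m) * ((f x * of_real (x \<bullet> w) ^ m) * chirp (\<i> * of_real N) x)" for x
      unfolding F_def gE by (simp add: power_mult_distrib)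
    have "integrable lborel (\<lambda>x. (f x * of_real (x \<bullet> w) ^ m) * chirp (\<i> * of_real N) x)"
      using rapid_mult_inner_power[OF f] N
      by (intro rapid_integrable_mult[of _ _ 1] norm_gaussian_exp_le) auto
    then show ?thesis
      unfolding e using zero[of m] unfolding gaussian_transform_def
      by (simp only: integral_mult_right_zero mult_zero_right) simp
  qed
  have part: "norm (\<Sum>m<n. F m x) \<le> exp (pi * N * (norm w)\<^sup>2) * norm (f x)" for n x
  proof -
    have "norm (\<Sum>m<n. F m x) = norm (\<Sum>m<n. of_real ((c * (x \<bullet> w)) ^ m / fact m) :: complex) * (norm (f x) * E x)"
      unfolding F_def sum_distrib_right[symmetric] norm_mult by (simp add: E_def)
    also have "norm (\<Sum>m<n. of_real ((c * (x \<bullet> w)) ^ m / fact m) :: complex) \<le> (\<Sum>m<n. \<bar>c * (x \<bullet> w)\<bar> ^ m / fact m)"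
      by (intro sum_norm_le, simp only: norm_of_real) (simp add: power_abs)
    also have "\<dots> \<le> exp \<bar>c * (x \<bullet> w)\<bar>"
    proof -
      have "(\<Sum>m<n. \<bar>c * (x \<bullet> w)\<bar> ^ m / fact m) = (\<Sum>m<n. \<bar>c * (x \<bullet> w)\<bar> ^ m /\<^sub>R fact m)"
        by (simp add: divide_inverse mult.commute)
      also have "\<dots> \<le> exp \<bar>c * (x \<bullet> w)\<bar>"
        unfolding exp_def by (intro sum_le_suminf summable_exp_generic) auto
      finally show ?thesis .
    qed
    finally have "norm (\<Sum>m<n. F m x) \<le> (exp \<bar>c * (x \<bullet> w)\<bar> * E x) * norm (f x)"
      by (simp add: mult_right_mono E_def mult_ac)
    also have "exp \<bar>c * (x \<bullet> w)\<bar> * E x \<le> exp (pi * N * (norm w)\<^sup>2)"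
    proof -
      have "\<bar>c * (x \<bullet> w)\<bar> \<le> c * (norm x * norm w)"
        unfolding c_def abs_mult using N Cauchy_Schwarz_ineq2[of x w] by (simp add: mult_left_mono)
      also have "\<dots> - pi * N * (norm x)\<^sup>2 \<le> pi * N * (norm w)\<^sup>2"
      proof -
        have "0 \<le> pi * N * (norm x - norm w)\<^sup>2" using N by simp
        then show ?thesis unfolding c_def power2_diff by (simp add: algebra_simps)
      qed
      ultimately have "\<bar>c * (x \<bullet> w)\<bar> + - (pi * N * (norm x)\<^sup>2) \<le> pi * N * (norm w)\<^sup>2" by linarith
      then show ?thesis unfolding E_def exp_add[symmetric] by (simp only: exp_le_cancel_iff)
    qed
    finally show ?thesis by (simp add: mult_right_mono)
  qed
  have lim: "(\<lambda>n. \<Sum>m<n. F m x) \<longlonglongrightarrow> of_real (exp (c * (x \<bullet> w))) * (f x * of_real (E x))" for x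
  proof -
    have "(\<lambda>m. (c * (x \<bullet> w)) ^ m /\<^sub>R fact m) sums exp (c * (x \<bullet> w))" by (rule exp_converges)
    then have "(\<lambda>m. of_real ((c * (x \<bullet> w)) ^ m /\<^sub>R fact m) :: complex) sums of_real (exp (c * (x \<bullet> w)))" by (rule sums_of_real)
    from sums_mult2[OF this, of "f x * of_real (E x)"] show ?thesis
      unfolding sums_def F_def by (simp add: divide_inverse mult.commute)
  qed
  have "(\<lambda>n. LINT x|lborel. (\<Sum>m<n. F m x)) \<longlonglongrightarrow> (LINT x|lborel. of_real (exp (c * (x \<bullet> w))) * (f x * of_real (E x)))"
  proof (rule integral_dominated_convergence[where w="\<lambda>x. exp (pi * N * (norm w)\<^sup>2) * norm (f x)"])
    show "integrable lborel (\<lambda>x. exp (pi * N * (norm w)\<^sup>2) * norm (f x))"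
      by (intro integrable_mult_right integrable_norm rapid_integrable f)
    show "(\<lambda>x. of_real (exp (c * (x \<bullet> w))) * (f x * of_real (E x))) \<in> borel_measurable lborel"
      unfolding E_def by measurable
    show "(\<lambda>x. \<Sum>m<n. F m x) \<in> borel_measurable lborel" for n
      unfolding F_def E_def by measurable
  qed (intro AE_I2 lim part)+
  moreover have "(LINT x|lborel. (\<Sum>m<n. F m x)) = 0" for n
    using Fi by (subst Bochner_Integration.integral_sum) auto
  ultimately have z: "(LINT x|lborel. of_real (exp (c * (x \<bullet> w))) * (f x * of_real (E x))) = 0"
    by (simp only: LIMSEQ_const_iff)
  have "f x * of_real (exp (- (pi * N * (norm (x - w))\<^sup>2)))
      = of_real (exp (- (pi * N * (norm w)\<^sup>2))) * (of_real (exp (c * (x \<bullet> w))) * (f x * of_real (E x)))" for x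
  proof -
    have "- (pi * N * (norm (x - w))\<^sup>2) = - (pi * N * (norm w)\<^sup>2) + (c * (x \<bullet> w) + - (pi * N * (norm x)\<^sup>2))"
      unfolding c_def power2_norm_eq_inner by (simp add: inner_diff_left inner_diff_right inner_commute algebra_simps)
    then show ?thesis unfolding E_def by (simp only: exp_add of_real_mult mult_ac)
  qed
  then show ?thesis using z by (simp only: integral_mult_right_zero mult_zero_right)
qed

lemma integral_affine:
  fixes h :: "'a::euclidean_space \<Rightarrow> complex"
  assumes "h \<in> borel_measurable borel" "c \<noteq> 0"
  shows "(LINT x|lborel. h x) = \<bar>c\<bar> ^ DIM('a) *\<^sub>R (LINT x|lborel. h (t + c *\<^sub>R x))"
proof -
  have [measurable]: "h \<in> borel_measurable borel" by fact
  have "(LINT x|lborel. h x) = (LINT x|density (distr lborel borel (\<lambda>x. t + c *\<^sub>R x)) (\<lambda>_. ennreal (\<bar>c\<bar> ^ DIM('a))). h x)"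
    using lborel_affine[OF assms(2), of t] by (simp add: ennreal_power)
  also have "\<dots> = (LINT x|distr lborel borel (\<lambda>x. t + c *\<^sub>R x). \<bar>c\<bar> ^ DIM('a) *\<^sub>R h x)"
    by (rule integral_density) auto
  also have "\<dots> = (LINT x|lborel. \<bar>c\<bar> ^ DIM('a) *\<^sub>R h (t + c *\<^sub>R x))"
    by (rule integral_distr) measurable
  finally show ?thesis by simp
qed

text \<open>An approximate identity: for \<open>N = 1 / \<epsilon>\<^sup>2\<close> the substitution
  \<open>w + \<epsilon> *\<^sub>R x\<close> turns the Gaussian into a fixed one of mass 1, and the
  values of \<open>f\<close> tend to \<open>f w\<close>.\<close>

lemma rapid_zero_from_gaussians:
  fixes f :: "'a::euclidean_space \<Rightarrow> complex"
  assumes f: "rapid f" and zero: "\<And>N. N > 0 \<Longrightarrow> (LINT x|lborel. f x * of_real (exp (- (pi * N * (norm (x - w))\<^sup>2)))) = 0"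
  shows "f w = 0"
proof -
  note [measurable] = rapid_measurable[OF f]
  define \<epsilon> where "\<epsilon> = (\<lambda>n. inverse (real (Suc n)))"
  have \<epsilon>: "\<epsilon> n > 0" for n unfolding \<epsilon>_def by simp
  define E where "E = (\<lambda>x::'a. exp (- (pi * (norm x)\<^sup>2)))"
  have Ei: "integrable lborel E" and E1: "(LINT x|lborel. of_real (E x)) = (1::complex)"
  proof -
    have e: "exp (- (of_real pi * 1 * of_real ((norm y)\<^sup>2))) * cis (- 2 * pi * (y \<bullet> 0)) = (of_real (E y) :: complex)" for y :: 'a
      unfolding E_def by (simp add: exp_of_real[symmetric])
    have i: "integrable lborel (\<lambda>y::'a. of_real (E y) :: complex)"
      using gauss_fourier(1)[of 1 "0::'a"] unfolding e by simp
    show "integrable lborel E" using integrable_Re[OF i] by simp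
    show "(LINT x|lborel. of_real (E x)) = (1::complex)"
      using gauss_fourier(2)[of 1 "0::'a"] unfolding e by simp
  qed
  have z: "(LINT x|lborel. f (w + \<epsilon> n *\<^sub>R x) * of_real (E x)) = 0" for n
  proof -
    define h where "h = (\<lambda>x. f x * of_real (exp (- (pi * (1 / (\<epsilon> n)\<^sup>2) * (norm (x - w))\<^sup>2))) :: complex)"
    have "(LINT x|lborel. h x) = 0" unfolding h_def using \<epsilon>[of n] by (intro zero) simp
    moreover have "h \<in> borel_measurable borel" unfolding h_def by measurable
    ultimately have "\<bar>\<epsilon> n\<bar> ^ DIM('a) *\<^sub>R (LINT x|lborel. h (w + \<epsilon> n *\<^sub>R x)) = 0"
      using integral_affine[of h "\<epsilon> n" w] less_imp_neq[OF \<epsilon>[of n]] by (simp only: not_False_eq_True)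
    then have "(LINT x|lborel. h (w + \<epsilon> n *\<^sub>R x)) = 0" using \<epsilon>[of n] by simp
    moreover have "h (w + \<epsilon> n *\<^sub>R x) = f (w + \<epsilon> n *\<^sub>R x) * of_real (E x)" for x
      unfolding h_def E_def using \<epsilon>[of n] by (simp add: power_mult_distrib)
    ultimately show ?thesis by simp
  qed
  obtain C where C: "\<And>x. norm (f x) \<le> C" using rapidE[OF f, of 0] by auto
  have "(\<lambda>n. LINT x|lborel. f (w + \<epsilon> n *\<^sub>R x) * of_real (E x)) \<longlonglongrightarrow> (LINT x|lborel. f w * of_real (E x))"
  proof (rule integral_dominated_convergence[where w="\<lambda>x. C * E x"])
    show "integrable lborel (\<lambda>x. C * E x)" by (intro integrable_mult_right Ei)
    show "AE x in lborel. (\<lambda>n. f (w + \<epsilon> n *\<^sub>R x) * of_real (E x)) \<longlonglongrightarrow> f w * of_real (E x)"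
    proof (rule AE_I2)
      fix x :: 'a
      have "(\<lambda>n. w + \<epsilon> n *\<^sub>R x) \<longlonglongrightarrow> w + 0 *\<^sub>R x"
        unfolding \<epsilon>_def by (intro tendsto_add tendsto_scaleR tendsto_const LIMSEQ_inverse_real_of_nat)
      then have l: "(\<lambda>n. w + \<epsilon> n *\<^sub>R x) \<longlonglongrightarrow> w" by simp
      have "isCont f w" using rapid_continuous[OF f, of UNIV] by (simp add: continuous_on_eq_continuous_at)
      from tendsto_mult[OF isCont_tendsto_compose[OF this l] tendsto_const]
      show "(\<lambda>n. f (w + \<epsilon> n *\<^sub>R x) * of_real (E x)) \<longlonglongrightarrow> f w * of_real (E x)" .
    qed
    show "AE x in lborel. norm (f (w + \<epsilon> n *\<^sub>R x) * of_real (E x)) \<le> C * E x" for n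
      using C by (intro AE_I2) (simp add: norm_mult E_def mult_right_mono)
    show "(\<lambda>x. f w * of_real (E x)) \<in> borel_measurable lborel" unfolding E_def by measurable
    show "(\<lambda>x. f (w + \<epsilon> n *\<^sub>R x) * of_real (E x)) \<in> borel_measurable lborel" for n unfolding E_def by measurable
  qed
  then have "(LINT x|lborel. f w * of_real (E x)) = 0" unfolding z by (simp only: LIMSEQ_const_iff)
  then show ?thesis using E1 by (simp only: integral_mult_right_zero mult_1_right)
qed

theorem rapid_zero_if_transforms_zero:
  assumes f: "rapid f" and zero: "\<And>w m t. gaussian_transform (\<lambda>x. f x * of_real (x \<bullet> w) ^ m) (of_real t) = 0"
  shows "f w = 0"
proof (rule rapid_zero_from_gaussians[OF f])
  fix N :: real assume N: "N > 0"
  then have "Im (\<i> * of_real N) \<ge> 0" by simp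
  from gaussian_moments_zero[OF f gaussian_transform_zero_extends[OF rapid_mult_inner_power[OF f] zero this] N]
  show "(LINT x|lborel. f x * of_real (exp (- (pi * N * (norm (x - w))\<^sup>2)))) = 0" .
qed

section \<open>Schwartz functions\<close>

lemma one_plus_le_double: "p \<le> 1 + q \<Longrightarrow> 0 \<le> q \<Longrightarrow> 1 + p \<le> 2 * (1 + q)" for p q :: real
  by simp

text \<open>
  Landau's inequality: a rapidly decaying function with a uniform quadratic Taylor bound has a rapidly
  decaying derivative, as one sees by taking a step of length \<open>(1 + norm x)\<^sup>-\<^sup>N\<close>.
\<close>

lemma rapid_lipschitz_from_taylor:
  fixes g :: "'a::euclidean_space \<Rightarrow> complex" and L :: "'a \<Rightarrow> 'a \<Rightarrow> complex"
  assumes g: "rapid g" and L: "\<And>x \<delta> t. L x (t *\<^sub>R \<delta>) = of_real t * L x \<delta>"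
    and taylor: "\<And>x \<delta>. norm (g (x + \<delta>) - g x - L x \<delta>) \<le> A * (norm \<delta>)\<^sup>2"
  shows "rapid_lipschitz g"
  unfolding rapid_lipschitz_def
proof (intro allI)
  fix N :: nat
  \<comment> \<open>The exponent is doubled because increments of \<open>g\<close> must be of order
    \<open>\<eta>\<^sup>2\<close> for the step length \<open>\<eta> = 1 / W\<close>.\<close>
  obtain C where C: "C > 0" "\<And>x. norm (g x) * (1 + norm x) ^ (2 * N) \<le> C" using rapidE[OF g] by metis
  define B where "B = (4 ^ N + 1) * C"
  have Bp: "B \<ge> 0" unfolding B_def using C(1) by simp
  have "norm (g y - g x) * (1 + norm x) ^ N \<le> (B + 2 * \<bar>A\<bar>) * norm (y - x)" if xy: "norm (y - x) \<le> 1" for x y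
  proof -
    define W where "W = (1 + norm x) ^ N"
    have W: "W \<ge> 1" unfolding W_def by (intro one_le_power) simp
    have W2: "W\<^sup>2 = (1 + norm x) ^ (2 * N)" unfolding W_def by (simp add: power_mult power_power_commute[of _ N 2])
    define \<eta> where "\<eta> = 1 / W"
    have \<eta>: "0 < \<eta>" "\<eta> \<le> 1" "\<eta> * W = 1" unfolding \<eta>_def using W by auto
    have far: "norm (g z - g x) \<le> B * \<eta>\<^sup>2" if z: "norm (z - x) \<le> 1" for z
    proof -
      have "norm x \<le> 1 + norm z" using norm_triangle_ineq2[of x z] z by (simp add: norm_minus_commute)
      then have "1 + norm x \<le> 2 * (1 + norm z)" by (rule one_plus_le_double[OF _ norm_ge_zero])
      then have "(1 + norm x) ^ (2 * N) \<le> (2 * (1 + norm z)) ^ (2 * N)" by (intro power_mono) auto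
      moreover have "(2 * t) ^ (2 * N) = 4 ^ N * t ^ (2 * N)" for t :: real
        by (simp add: power_mult_distrib power_mult)
      ultimately have "W\<^sup>2 \<le> 4 ^ N * (1 + norm z) ^ (2 * N)" unfolding W2 by (simp only:)
      then have "norm (g z) * W\<^sup>2 \<le> norm (g z) * (4 ^ N * (1 + norm z) ^ (2 * N))" by (intro mult_left_mono) auto
      also have "\<dots> = 4 ^ N * (norm (g z) * (1 + norm z) ^ (2 * N))" by simp
      also have "\<dots> \<le> 4 ^ N * C" by (intro mult_left_mono C) auto
      finally have 1: "norm (g z) * W\<^sup>2 \<le> 4 ^ N * C" .
      have 2: "norm (g x) * W\<^sup>2 \<le> C" using C(2)[of x] unfolding W2 .
      have "norm (g z - g x) * W\<^sup>2 \<le> (norm (g z) + norm (g x)) * W\<^sup>2"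
        by (intro mult_right_mono norm_triangle_ineq4) auto
      also have "\<dots> \<le> B" using 1 2 unfolding B_def by (simp add: distrib_right)
      finally have "norm (g z - g x) \<le> B / W\<^sup>2" using W by (subst pos_le_divide_eq) auto
      then show ?thesis unfolding \<eta>_def by (simp add: power_divide)
    qed
    define d where "d = norm (y - x)"
    have "norm (g y - g x) \<le> (B + 2 * \<bar>A\<bar>) * (d * \<eta>)"
    \<comment> \<open>Increments of length at least \<open>\<eta>\<close> are controlled by the
      decay of \<open>g\<close> alone. For shorter ones the linear part is first estimated on a step
      of length exactly \<open>\<eta>\<close> in the same direction.\<close>
    proof (cases "d \<ge> \<eta>")
      case True
      have "norm (g y - g x) \<le> B * \<eta>\<^sup>2" by (rule far[OF xy])
      also have "\<dots> \<le> B * (d * \<eta>)" unfolding power2_eq_square using True \<eta> Bp by (intro mult_left_mono mult_right_mono) auto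
      also have "\<dots> \<le> (B + 2 * \<bar>A\<bar>) * (d * \<eta>)" using \<eta> unfolding d_def by (intro mult_right_mono) auto
      finally show ?thesis .
    next
      case False
      show ?thesis
      proof (cases "d = 0")
        case True
        then show ?thesis unfolding d_def by simp
      next
        case dne: False
        then have dp: "d > 0" unfolding d_def by simp
        define v where "v = (\<eta> / d) *\<^sub>R (y - x)"
        have nv: "norm v = \<eta>" unfolding v_def using dp \<eta> by (simp add: d_def[symmetric])
        have yx: "y - x = (d / \<eta>) *\<^sub>R v" unfolding v_def using dp \<eta> by simp
        have "norm (L x v) \<le> norm (g (x + v) - g x) + norm (g (x + v) - g x - L x v)"
          using norm_triangle_ineq4[of "g (x + v) - g x" "g (x + v) - g x - L x v"] by simp
        also have "\<dots> \<le> B * \<eta>\<^sup>2 + \<bar>A\<bar> * \<eta>\<^sup>2"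
        proof (rule add_mono)
          show "norm (g (x + v) - g x) \<le> B * \<eta>\<^sup>2" using nv \<eta> by (intro far) simp
          have "norm (g (x + v) - g x - L x v) \<le> A * \<eta>\<^sup>2" using taylor[of x v] nv by simp
          also have "\<dots> \<le> \<bar>A\<bar> * \<eta>\<^sup>2" by (intro mult_right_mono) auto
          finally show "norm (g (x + v) - g x - L x v) \<le> \<bar>A\<bar> * \<eta>\<^sup>2" .
        qed
        finally have Lv: "norm (L x v) \<le> (B + \<bar>A\<bar>) * \<eta>\<^sup>2" by (simp add: distrib_right)
        have "norm (L x (y - x)) = d / \<eta> * norm (L x v)"
          unfolding yx L norm_mult using dp \<eta> by (simp add: norm_divide)
        also have "\<dots> \<le> d / \<eta> * ((B + \<bar>A\<bar>) * \<eta>\<^sup>2)" using dp \<eta> by (intro mult_left_mono Lv) auto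
        also have "\<dots> = (B + \<bar>A\<bar>) * (d * \<eta>)" using \<eta> by (simp add: power2_eq_square)
        finally have 1: "norm (L x (y - x)) \<le> (B + \<bar>A\<bar>) * (d * \<eta>)" .
        have "norm (g y - g x - L x (y - x)) \<le> A * d\<^sup>2" using taylor[of x "y - x"] unfolding d_def by simp
        also have "\<dots> \<le> \<bar>A\<bar> * d\<^sup>2" by (intro mult_right_mono) auto
        also have "\<dots> \<le> \<bar>A\<bar> * (d * \<eta>)" unfolding power2_eq_square using False dp by (intro mult_left_mono) auto
        finally have 2: "norm (g y - g x - L x (y - x)) \<le> \<bar>A\<bar> * (d * \<eta>)" .
        have "norm (g y - g x) \<le> norm (g y - g x - L x (y - x)) + norm (L x (y - x))"
          using norm_triangle_ineq[of "g y - g x - L x (y - x)" "L x (y - x)"] by simp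
        also have "\<dots> \<le> \<bar>A\<bar> * (d * \<eta>) + (B + \<bar>A\<bar>) * (d * \<eta>)" by (rule add_mono[OF 2 1])
        also have "\<dots> = (B + 2 * \<bar>A\<bar>) * (d * \<eta>)" by (simp add: algebra_simps)
        finally show ?thesis .
      qed
    qed
    then have "norm (g y - g x) * W \<le> (B + 2 * \<bar>A\<bar>) * (d * \<eta>) * W" using W by (intro mult_right_mono) auto
    also have "\<dots> = (B + 2 * \<bar>A\<bar>) * d * (\<eta> * W)" by (simp only: mult.assoc)
    finally show ?thesis using \<eta>(3) unfolding W_def[symmetric] d_def[symmetric] by simp
  qed
  then show "\<exists>C. \<forall>x y. norm (y - x) \<le> 1 \<longrightarrow> norm (g y - g x) * (1 + norm x) ^ N \<le> C * norm (y - x)" by blast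
qed

text \<open>\<open>L\<close> is the formal derivative under the integral sign, and \<open>A\<close>
  comes from the second moment of \<open>norm (f x)\<close> through
  \<open>norm (iexp y - 1 - \<i> * y) \<le> y\<^sup>2\<close>. The decay of the increments is then
  inherited from that of the transform itself.\<close>

lemma rapid_lipschitz_fourier:
  fixes f :: "'a::euclidean_space \<Rightarrow> complex"
  assumes f: "rapid f" and g: "rapid (fourier f)"
  shows "rapid_lipschitz (fourier f)"
proof (rule rapid_lipschitz_from_taylor[OF g])
  note fm [measurable] = rapid_measurable[OF f]
  define L where "L = (\<lambda>\<xi> \<delta>. LINT x|lborel. (f x * of_real (x \<bullet> \<delta>)) * (of_real (- 2 * pi) * \<i> * character x \<xi>))"
  define A where "A = (LINT x|lborel. norm (f x) * (2 * pi * norm x)\<^sup>2)"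
  let ?T = "\<lambda>\<xi> \<delta> x. f x * character x (\<xi> + \<delta>) - f x * character x \<xi>
     - (f x * of_real (x \<bullet> \<delta>)) * (of_real (- 2 * pi) * \<i> * character x \<xi>)"
  have Li: "integrable lborel (\<lambda>x. (f x * of_real (x \<bullet> \<delta>)) * (of_real (- 2 * pi) * \<i> * character x \<xi>))" for \<xi> \<delta>
    by (intro rapid_integrable_mult[of _ _ "2 * pi"] rapid_mult_inner f) (simp_all add: norm_mult)
  have Fi: "integrable lborel (\<lambda>x. f x * character x \<xi>)" for \<xi>
    by (intro rapid_integrable_mult[of _ _ 1] f) simp_all
  show "L x (t *\<^sub>R \<delta>) = of_real t * L x \<delta>" for x \<delta> t
    unfolding L_def integral_mult_right_zero[symmetric] by (intro Bochner_Integration.integral_cong) simp_all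
  have Ai: "integrable lborel (\<lambda>x. norm (f x) * (2 * pi * norm x)\<^sup>2)"
  proof -
    obtain C where C: "\<And>x. norm (f x) * (1 + norm x) ^ (2 + 2 * DIM('a)) \<le> C" using rapidE[OF f] by metis
    show ?thesis
    proof (rule integrable_decay_bound[where C="(2 * pi)\<^sup>2 * C"])
      fix x :: 'a
      have "norm (f x) * (2 * pi * norm x)\<^sup>2 * (1 + norm x) ^ (2 * DIM('a))
          = (2 * pi)\<^sup>2 * (norm (f x) * ((norm x)\<^sup>2 * (1 + norm x) ^ (2 * DIM('a))))"
        by (simp only: power_mult_distrib mult_ac)
      also have "\<dots> \<le> (2 * pi)\<^sup>2 * (norm (f x) * ((1 + norm x)\<^sup>2 * (1 + norm x) ^ (2 * DIM('a))))"
        by (intro mult_left_mono mult_right_mono power_mono) auto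
      also have "\<dots> \<le> (2 * pi)\<^sup>2 * C" using C[of x] unfolding power_add by (intro mult_left_mono) auto
      finally show "norm (norm (f x) * (2 * pi * norm x)\<^sup>2) * (1 + norm x) ^ (2 * DIM('a)) \<le> (2 * pi)\<^sup>2 * C" by simp
    qed measurable
  qed
  show "norm (fourier f (\<xi> + \<delta>) - fourier f \<xi> - L \<xi> \<delta>) \<le> A * (norm \<delta>)\<^sup>2" for \<xi> \<delta>
  proof -
    have pt: "norm (?T \<xi> \<delta> x) \<le> norm (f x) * (2 * pi * norm x)\<^sup>2 * (norm \<delta>)\<^sup>2" for x
    proof -
      define y where "y = - 2 * pi * (x \<bullet> \<delta>)"
      have "character x (\<xi> + \<delta>) = character x \<xi> * iexp y"
        unfolding y_def cis_conv_exp[symmetric] cis_mult by (simp add: inner_add_right algebra_simps)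
      moreover have y: "\<i> * of_real y = of_real (x \<bullet> \<delta>) * (of_real (- 2 * pi) * \<i>)"
        unfolding y_def by simp
      moreover have "F * (c * E) - F * c - (F * r) * (p * \<i> * c) = F * c * (E - (1 + r * (p * \<i>)))" for F c E r p :: complex
        by (simp add: algebra_simps)
      ultimately have "?T \<xi> \<delta> x
        = f x * character x \<xi> * (iexp y - (1 + \<i> * of_real y))"
        by (simp only:)
      then have "norm (?T \<xi> \<delta> x) = norm (f x) * norm (iexp y - (1 + \<i> * of_real y))"
        by (simp only: norm_mult norm_cis mult_1_right)
      also have "\<dots> \<le> norm (f x) * y\<^sup>2"
      proof (rule mult_left_mono)
        have "norm (iexp y - (\<Sum>k\<le>1. (\<i> * of_real y) ^ k / fact k)) \<le> \<bar>y\<bar> ^ Suc 1 / fact (Suc 1)" by (rule iexp_approx1)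
        also have "(\<Sum>k\<le>1. (\<i> * of_real y) ^ k / fact k) = 1 + \<i> * of_real y" by simp
        also have "\<bar>y\<bar> ^ Suc 1 / fact (Suc 1) \<le> y\<^sup>2" by (simp add: power2_eq_square)
        finally show "norm (iexp y - (1 + \<i> * of_real y)) \<le> y\<^sup>2" .
      qed simp
      also have "y\<^sup>2 \<le> (2 * pi * norm x)\<^sup>2 * (norm \<delta>)\<^sup>2"
      proof -
        have "\<bar>x \<bullet> \<delta>\<bar> \<le> norm x * norm \<delta>" by (rule Cauchy_Schwarz_ineq2)
        then have "\<bar>y\<bar> \<le> \<bar>2 * pi * norm x * norm \<delta>\<bar>" unfolding y_def by (simp add: abs_mult)
        then show ?thesis unfolding power_mult_distrib[symmetric] abs_le_square_iff .
      qed
      finally show ?thesis by (simp add: mult_left_mono mult.assoc)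
    qed
    have "fourier f (\<xi> + \<delta>) - fourier f \<xi> - L \<xi> \<delta> = (LINT x|lborel. ?T \<xi> \<delta> x)"
      unfolding fourier_def L_def
      by (subst Bochner_Integration.integral_diff[OF Bochner_Integration.integrable_diff[OF Fi Fi] Li],
          subst Bochner_Integration.integral_diff[OF Fi Fi]) (rule refl)
    then have "norm (fourier f (\<xi> + \<delta>) - fourier f \<xi> - L \<xi> \<delta>) \<le> (LINT x|lborel. norm (?T \<xi> \<delta> x))"
      by (simp only: integral_norm_bound)
    also have "\<dots> \<le> (LINT x|lborel. norm (f x) * (2 * pi * norm x)\<^sup>2 * (norm \<delta>)\<^sup>2)"
      by (intro integral_mono integrable_norm Bochner_Integration.integrable_diff Fi Li integrable_mult_left Ai pt)
    also have "\<dots> = A * (norm \<delta>)\<^sup>2" unfolding A_def by (rule integral_mult_left_zero)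
    finally show ?thesis .
  qed
qed

section \<open>Decay of Fourier transforms\<close>

lemma fourier_continuous:
  fixes f :: "'a::euclidean_space \<Rightarrow> complex"
  assumes f: "rapid f"
  shows "continuous_on UNIV (fourier f)"
proof (rule continuous_on_sequentiallyI)
  note [measurable] = rapid_measurable[OF f]
  fix Z and a :: 'a assume Z: "Z \<longlonglongrightarrow> a"
  show "(\<lambda>n. fourier f (Z n)) \<longlonglongrightarrow> fourier f a"
    unfolding fourier_def
  proof (rule integral_dominated_convergence[where w="\<lambda>x. norm (f x)"])
    show "integrable lborel (\<lambda>x. norm (f x))" by (intro integrable_norm rapid_integrable f)
    show "AE x in lborel. (\<lambda>n. f x * character x (Z n)) \<longlonglongrightarrow> f x * character x a"
      unfolding cis_conv_exp
      by (intro AE_I2 tendsto_mult tendsto_exp tendsto_const tendsto_of_real tendsto_inner Z)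
  qed (simp_all add: norm_mult)
qed

lemma norm_fourier_le: "norm (fourier f \<xi>) \<le> (LINT x|lborel. norm (f x))"
  unfolding fourier_def
  using integral_norm_bound[of lborel "\<lambda>x. f x * character x \<xi>"] by (simp add: norm_mult)

text \<open>
  Translation invariance of Lebesgue measure, applied to difference quotients, replaces integration by parts.
\<close>

lemma fourier_derivative:
  fixes u :: "'a::euclidean_space \<Rightarrow> complex" and e :: 'a
  assumes u: "rapid u" "rapid_lipschitz u" and e: "norm e = 1"
    and D: "\<And>x. ((\<lambda>t. u (x + t *\<^sub>R e)) has_vector_derivative D x) (at 0)" and Dm: "D \<in> borel_measurable borel"
  shows "fourier D \<xi> = 2 * of_real pi * \<i> * of_real (e \<bullet> \<xi>) * fourier u \<xi>"
proof -
  note [measurable] = rapid_measurable[OF u(1)] Dm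
  define \<epsilon> where "\<epsilon> = (\<lambda>n. inverse (real (Suc n)))"
  have \<epsilon>: "\<epsilon> n > 0" "\<epsilon> n \<le> 1" for n unfolding \<epsilon>_def by (auto simp: inverse_le_1_iff)
  have \<epsilon>0: "\<epsilon> \<longlonglongrightarrow> 0" unfolding \<epsilon>_def by (rule LIMSEQ_inverse_real_of_nat)
  obtain C where C: "\<And>x y. norm (y - x) \<le> 1 \<Longrightarrow> norm (u y - u x) * (1 + norm x) ^ (2 * DIM('a)) \<le> C * norm (y - x)"
    using u(2) unfolding rapid_lipschitz_def by metis
  define q where "q = (\<lambda>n x. (u (x + \<epsilon> n *\<^sub>R e) - u x) /\<^sub>R \<epsilon> n * character x \<xi>)"
  have Fi: "integrable lborel (\<lambda>x. u x * character x \<xi>)"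
    by (intro rapid_integrable_mult[of _ _ 1] u) simp_all
  have quot: "(\<lambda>n. (h (\<epsilon> n) - h 0) /\<^sub>R \<epsilon> n) \<longlonglongrightarrow> d" if "(h has_vector_derivative d) (at 0)" for h :: "real \<Rightarrow> complex" and d
  proof -
    have "((\<lambda>t. (h t - h 0 - (t - 0) *\<^sub>R d) /\<^sub>R norm (t - 0)) \<longlongrightarrow> 0) (at 0)"
      using that unfolding has_vector_derivative_def has_derivative_at_within by simp
    moreover have "filterlim \<epsilon> (at 0) sequentially" using \<epsilon>0 \<epsilon>(1) by (intro filterlim_atI) (auto intro!: always_eventually simp: less_imp_neq[symmetric])
    ultimately have "((\<lambda>n. (h (\<epsilon> n) - h 0 - (\<epsilon> n - 0) *\<^sub>R d) /\<^sub>R norm (\<epsilon> n - 0)) \<longlongrightarrow> 0) sequentially"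
      by (rule filterlim_compose)
    moreover have "(h (\<epsilon> n) - h 0 - (\<epsilon> n - 0) *\<^sub>R d) /\<^sub>R norm (\<epsilon> n - 0) = (h (\<epsilon> n) - h 0) /\<^sub>R \<epsilon> n - d" for n
      using \<epsilon>(1)[of n] by (simp add: scaleR_diff_right)
    ultimately show ?thesis by (simp add: LIM_zero_iff)
  qed
  have L: "(\<lambda>n. LINT x|lborel. q n x) \<longlonglongrightarrow> fourier D \<xi>"
    unfolding fourier_def
  \<comment> \<open>With exponent \<open>2 * DIM('a)\<close> the Lipschitz property is an integrable
    majorant, uniform over all difference quotients.\<close>
  proof (rule integral_dominated_convergence[where w="\<lambda>x. C * (1 / (1 + norm x) ^ (2 * DIM('a)))"])
    show "integrable lborel (\<lambda>x::'a. C * (1 / (1 + norm x) ^ (2 * DIM('a))))"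
      by (intro integrable_mult_right integrable_decay)
    show "AE x in lborel. (\<lambda>n. q n x) \<longlonglongrightarrow> D x * character x \<xi>"
      unfolding q_def using quot[OF D] by (intro AE_I2 tendsto_mult tendsto_const) simp
    show "AE x in lborel. norm (q n x) \<le> C * (1 / (1 + norm x) ^ (2 * DIM('a)))" for n
    proof (rule AE_I2)
      fix x :: 'a
      have "norm (u (x + \<epsilon> n *\<^sub>R e) - u x) * (1 + norm x) ^ (2 * DIM('a)) \<le> C * \<epsilon> n"
        using C[of "x + \<epsilon> n *\<^sub>R e" x] \<epsilon>[of n] e by simp
      then have "norm (u (x + \<epsilon> n *\<^sub>R e) - u x) / \<epsilon> n \<le> C / (1 + norm x) ^ (2 * DIM('a))"
        using \<epsilon>[of n] zero_less_power[of "1 + norm x"] by (simp add: divide_simps add_pos_nonneg mult_ac)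
      then show "norm (q n x) \<le> C * (1 / (1 + norm x) ^ (2 * DIM('a)))"
        unfolding q_def using \<epsilon>[of n] by (simp add: norm_mult divide_inverse mult_ac)
    qed
    show "q n \<in> borel_measurable lborel" for n unfolding q_def by measurable
  qed measurable
  have "(LINT x|lborel. q n x) = (cis (2 * pi * \<epsilon> n * (e \<bullet> \<xi>)) - 1) /\<^sub>R \<epsilon> n * fourier u \<xi>" for n
  proof -
    have shift: "u (x + \<epsilon> n *\<^sub>R e) * character x \<xi> = cis (2 * pi * \<epsilon> n * (e \<bullet> \<xi>)) * (u (\<epsilon> n *\<^sub>R e + x) * character (\<epsilon> n *\<^sub>R e + x) \<xi>)" for x
    proof -
      have "character x \<xi> = cis (2 * pi * \<epsilon> n * (e \<bullet> \<xi>)) * character (\<epsilon> n *\<^sub>R e + x) \<xi>"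
        unfolding cis_mult by (simp add: inner_add_left algebra_simps)
      then show ?thesis by (simp only: add.commute[of x] mult_ac)
    qed
    have "(LINT x|lborel. u (\<epsilon> n *\<^sub>R e + x) * character (\<epsilon> n *\<^sub>R e + x) \<xi>) = (LINT x|distr lborel borel ((+) (\<epsilon> n *\<^sub>R e)). u x * character x \<xi>)"
      by (rule integral_distr[symmetric]) measurable
    then have s1: "(LINT x|lborel. u (\<epsilon> n *\<^sub>R e + x) * character (\<epsilon> n *\<^sub>R e + x) \<xi>) = fourier u \<xi>"
      unfolding lborel_distr_plus fourier_def .
    have i1: "integrable lborel (\<lambda>x. u (\<epsilon> n *\<^sub>R e + x) * character (\<epsilon> n *\<^sub>R e + x) \<xi>)"
      by (rule integrable_distr[where M=lborel and M'=borel and T="(+) (\<epsilon> n *\<^sub>R e)", unfolded lborel_distr_plus, OF _ Fi]) measurable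
    have "q n x = (cis (2 * pi * \<epsilon> n * (e \<bullet> \<xi>)) * (u (\<epsilon> n *\<^sub>R e + x) * character (\<epsilon> n *\<^sub>R e + x) \<xi>) - u x * character x \<xi>) /\<^sub>R \<epsilon> n" for x
      unfolding q_def shift[symmetric] by (simp add: left_diff_distrib)
    then have "(LINT x|lborel. q n x) = (cis (2 * pi * \<epsilon> n * (e \<bullet> \<xi>)) * fourier u \<xi> - fourier u \<xi>) /\<^sub>R \<epsilon> n"
      using Bochner_Integration.integral_diff[OF integrable_mult_right[OF i1, of "cis (2 * pi * \<epsilon> n * (e \<bullet> \<xi>))"] Fi]
      by (simp only: integral_scaleR_right integral_mult_right_zero s1 fourier_def[symmetric])
    then show ?thesis by (simp add: left_diff_distrib)
  qed
  moreover have "(\<lambda>n. (cis (2 * pi * \<epsilon> n * (e \<bullet> \<xi>)) - 1) /\<^sub>R \<epsilon> n * fourier u \<xi>) \<longlonglongrightarrow> (2 * of_real pi * \<i> * of_real (e \<bullet> \<xi>)) * fourier u \<xi>"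
  proof (rule tendsto_mult[OF _ tendsto_const])
    have "((\<lambda>t. exp (t *\<^sub>R (2 * of_real pi * \<i> * of_real (e \<bullet> \<xi>)))) has_vector_derivative
        exp (0 *\<^sub>R (2 * of_real pi * \<i> * of_real (e \<bullet> \<xi>))) * (2 * of_real pi * \<i> * of_real (e \<bullet> \<xi>))) (at (0::real))"
      by (rule exp_scaleR_has_vector_derivative_right)
    moreover have "exp (t *\<^sub>R (2 * of_real pi * \<i> * of_real (e \<bullet> \<xi>))) = cis (2 * pi * t * (e \<bullet> \<xi>))" for t
      unfolding cis_conv_exp by (simp add: scaleR_conv_of_real mult_ac)
    ultimately show "(\<lambda>n. (cis (2 * pi * \<epsilon> n * (e \<bullet> \<xi>)) - 1) /\<^sub>R \<epsilon> n) \<longlonglongrightarrow> 2 * of_real pi * \<i> * of_real (e \<bullet> \<xi>)"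
      using quot[of "\<lambda>t. cis (2 * pi * t * (e \<bullet> \<xi>))"] by simp
  qed
  ultimately show ?thesis using LIMSEQ_unique[OF L] by simp
qed

text \<open>The coordinate of largest modulus controls the norm up to the dimension. Since that
  coordinate depends on \<open>x\<close>, the constants of all coordinates are added.\<close>

lemma decay_from_coordinates:
  fixes u :: "real^'d \<Rightarrow> complex"
  assumes "\<And>i N. \<exists>C. \<forall>x. \<bar>x $ i\<bar> ^ N * norm (u x) \<le> C"
  shows "\<exists>C. \<forall>x. norm (u x) * (1 + norm x) ^ N \<le> C"
proof -
  obtain C where C: "\<And>i N x. \<bar>x $ i\<bar> ^ N * norm (u x) \<le> C i N" using assms by metis
  have C0: "norm (u x) \<le> C i 0" for x i using C[of x i 0] by simp
  define d where "d = real CARD('d)"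
  define K where "K = (\<Sum>i\<in>UNIV. (1 + d) ^ N * (C i 0 + C i N))"
  have d0: "d \<ge> 0" unfolding d_def by simp
  have "norm (u x) * (1 + norm x) ^ N \<le> K" for x
  proof -
    define M where "M = Max (range (\<lambda>i. \<bar>x $ i\<bar>))"
    have "M \<in> range (\<lambda>i. \<bar>x $ i\<bar>)" unfolding M_def by (intro Max_in) auto
    then obtain i where i: "M = \<bar>x $ i\<bar>" by blast
    have "norm x \<le> (\<Sum>i\<in>UNIV. \<bar>x $ i\<bar>)" by (rule norm_le_l1_cart)
    also have "\<dots> \<le> (\<Sum>i\<in>(UNIV::'d set). M)" by (intro sum_mono) (simp add: M_def)
    also have "\<dots> = d * M" unfolding d_def by simp
    finally have nx: "norm x \<le> d * \<bar>x $ i\<bar>" unfolding i .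
    define t where "t = max 1 \<bar>x $ i\<bar>"
    have "d * \<bar>x $ i\<bar> \<le> d * t" using d0 unfolding t_def by (intro mult_left_mono) auto
    then have "1 + norm x \<le> (1 + d) * t" using nx unfolding t_def distrib_right by linarith
    then have "(1 + norm x) ^ N \<le> ((1 + d) * t) ^ N" by (intro power_mono) auto
    also have "\<dots> = (1 + d) ^ N * t ^ N" by (rule power_mult_distrib)
    also have "t ^ N \<le> 1 + \<bar>x $ i\<bar> ^ N" unfolding t_def by (auto simp: max_def)
    finally have "(1 + norm x) ^ N \<le> (1 + d) ^ N * (1 + \<bar>x $ i\<bar> ^ N)" using d0 by (simp add: mult_left_mono)
    then have "norm (u x) * (1 + norm x) ^ N \<le> norm (u x) * ((1 + d) ^ N * (1 + \<bar>x $ i\<bar> ^ N))" by (intro mult_left_mono) auto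
    also have "\<dots> = (1 + d) ^ N * (norm (u x) + \<bar>x $ i\<bar> ^ N * norm (u x))" by (simp add: algebra_simps)
    also have "\<dots> \<le> (1 + d) ^ N * (C i 0 + C i N)" using d0 by (intro mult_left_mono add_mono C0 C) auto
    also have "\<dots> \<le> K" unfolding K_def
    proof (rule member_le_sum)
      fix j
      have "0 \<le> C j 0" using C0[of x j] norm_ge_zero order_trans by blast
      moreover have "0 \<le> C j N" using C[of x j N] order_trans[OF mult_nonneg_nonneg] by (meson norm_ge_zero zero_le_power abs_ge_zero)
      ultimately show "0 \<le> (1 + d) ^ N * (C j 0 + C j N)" using d0 by simp
    qed auto
    finally show ?thesis .
  qed
  then show ?thesis by blast
qed

text \<open>The last index of the list is differentiated first, so mixed partials of a partial
  derivative are again mixed partials of \<open>f\<close>. This closes the Schwartz space under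
  differentiation.\<close>

lemma mixed_partial_snoc: "mixed_partial is (partial_deriv i f) = mixed_partial (is @ [i]) f"
  unfolding mixed_partial_def by simp

lemma schwartz_partial_deriv: "f \<in> schwartz_space \<Longrightarrow> partial_deriv i f \<in> schwartz_space"
  by (auto simp: schwartz_space_def smooth_def mixed_partial_snoc)

lemma schwartz_differentiable: "f \<in> schwartz_space \<Longrightarrow> f differentiable (at x)"
  unfolding schwartz_space_def smooth_def mixed_partial_def by (metis (mono_tags, lifting) foldr.simps(1) id_apply mem_Collect_eq)

lemma schwartz_rapid:
  fixes f :: "real^'d \<Rightarrow> complex"
  assumes f: "f \<in> schwartz_space"
  shows "rapid f"
  unfolding rapid_def
proof (intro conjI allI)
  show "continuous_on UNIV f"
    using schwartz_differentiable[OF f] differentiable_imp_continuous_within by (auto simp: continuous_on_eq_continuous_at)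
  have "\<exists>C. \<forall>x. \<bar>x $ i\<bar> ^ N * norm (f x) \<le> C" for i N
  proof -
    define a where "a = (\<lambda>j. if j = i then N else 0)"
    have "bounded (range (\<lambda>x. (\<Prod>j\<in>UNIV. (x $ j) ^ a j) *\<^sub>R mixed_partial [] f x))"
      using f unfolding schwartz_space_def by blast
    moreover have "(\<Prod>j\<in>UNIV. (x $ j) ^ a j) = (x $ i) ^ N" for x :: "real^'d"
      unfolding a_def by (simp add: if_distrib[of "power _"] prod.delta cong: if_cong)
    ultimately have "bounded (range (\<lambda>x. (x $ i) ^ N *\<^sub>R f x))" by (simp add: mixed_partial_def)
    then show ?thesis unfolding bounded_iff by (auto simp: power_abs)
  qed
  then show "\<exists>C. \<forall>x. norm (f x) * (1 + norm x) ^ N \<le> C" for N by (rule decay_from_coordinates)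
qed

text \<open>Smoothness is defined through total differentiability, so the derivative is a linear map
  determined by its values on the axis vectors.\<close>

lemma schwartz_partial_has_derivative:
  fixes f :: "real^'d \<Rightarrow> complex"
  assumes f: "f \<in> schwartz_space"
  shows "(f has_derivative (\<lambda>h. \<Sum>i\<in>UNIV. (h $ i) *\<^sub>R partial_deriv i f x)) (at x)"
    and "((\<lambda>t. f (x + t *\<^sub>R axis i 1)) has_vector_derivative partial_deriv i f x) (at 0)"
proof -
  obtain D where D: "(f has_derivative D) (at x)" using schwartz_differentiable[OF f] unfolding differentiable_def by blast
  have v: "((\<lambda>t. f (x + t *\<^sub>R axis i 1)) has_vector_derivative D (axis i 1)) (at 0)" for i
  proof -
    have "((\<lambda>t::real. x + t *\<^sub>R axis i 1) has_derivative (\<lambda>t. t *\<^sub>R axis i 1)) (at 0)"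
      by (auto intro!: derivative_eq_intros)
    from has_derivative_compose[OF this, of f D] D
    have "((\<lambda>t. f (x + t *\<^sub>R axis i 1)) has_derivative (\<lambda>t. D (t *\<^sub>R axis i 1))) (at 0)" by simp
    moreover have "D (t *\<^sub>R axis i 1) = t *\<^sub>R D (axis i 1)" for t
      using has_derivative_linear[OF D] by (simp add: linear_cmul)
    ultimately show ?thesis unfolding has_vector_derivative_def by simp
  qed
  then have p: "partial_deriv i f x = D (axis i 1)" for i unfolding partial_deriv_def by (rule vector_derivative_at)
  show "((\<lambda>t. f (x + t *\<^sub>R axis i 1)) has_vector_derivative partial_deriv i f x) (at 0)" unfolding p by (rule v)
  have "D h = (\<Sum>i\<in>UNIV. (h $ i) *\<^sub>R partial_deriv i f x)" for h
  proof -
    have "h = (\<Sum>i\<in>UNIV. (h $ i) *\<^sub>R axis i 1)" using basis_expansion[of h] by (simp add: scalar_mult_eq_scaleR)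
    then have "D h = D (\<Sum>i\<in>UNIV. (h $ i) *\<^sub>R axis i 1)" by (rule arg_cong)
    also have "\<dots> = (\<Sum>i\<in>UNIV. (h $ i) *\<^sub>R D (axis i 1))"
      using has_derivative_linear[OF D] by (simp add: linear_sum linear_cmul)
    finally show ?thesis unfolding p .
  qed
  then have "D = (\<lambda>h. \<Sum>i\<in>UNIV. (h $ i) *\<^sub>R partial_deriv i f x)" by (rule ext)
  then show "(f has_derivative (\<lambda>h. \<Sum>i\<in>UNIV. (h $ i) *\<^sub>R partial_deriv i f x)) (at x)" using D by simp
qed

text \<open>Mean value inequality on the unit ball around \<open>x\<close>: there
  \<open>1 + norm x\<close> is at most twice \<open>1 + norm z\<close>, so the decay of the gradient
  at \<open>z\<close> can be stated at \<open>x\<close> at the cost of \<open>2 ^ N\<close>.\<close>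

lemma schwartz_rapid_lipschitz:
  fixes f :: "real^'d \<Rightarrow> complex"
  assumes f: "f \<in> schwartz_space"
  shows "rapid_lipschitz f"
  unfolding rapid_lipschitz_def
proof (intro allI)
  fix N :: nat
  have "\<exists>C. \<forall>x. norm (partial_deriv i f x) * (1 + norm x) ^ N \<le> C" for i
    using schwartz_rapid[OF schwartz_partial_deriv[OF f]] unfolding rapid_def by blast
  then obtain C where C: "\<And>i x. norm (partial_deriv i f x) * (1 + norm x) ^ N \<le> C i" by metis
  define K where "K = 2 ^ N * (\<Sum>i\<in>UNIV. C i)"
  have "norm (f y - f x) * (1 + norm x) ^ N \<le> K * norm (y - x)" if xy: "norm (y - x) \<le> 1" for x y
  proof -
    define W where "W = (1 + norm x) ^ N"
    have W: "W > 0" unfolding W_def by (intro zero_less_power) (simp add: add_pos_nonneg)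
    have "norm (f y - f x) \<le> (K / W) * norm (y - x)"
    proof (rule differentiable_bound[of "cball x 1"])
      show "convex (cball x 1)" by simp
      show "y \<in> cball x 1" "x \<in> cball x 1" using xy by (auto simp: dist_norm norm_minus_commute)
      fix z assume z: "z \<in> cball x 1"
      show "(f has_derivative (\<lambda>h. \<Sum>i\<in>UNIV. (h $ i) *\<^sub>R partial_deriv i f z)) (at z within cball x 1)"
        by (rule has_derivative_at_withinI[OF schwartz_partial_has_derivative(1)[OF f]])
      have "norm x \<le> 1 + norm z" using z norm_triangle_ineq2[of x z] by (simp add: dist_norm)
      then have "1 + norm x \<le> 2 * (1 + norm z)" by (rule one_plus_le_double[OF _ norm_ge_zero])
      then have "W \<le> (2 * (1 + norm z)) ^ N" unfolding W_def by (intro power_mono) auto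
      then have Wz: "W \<le> 2 ^ N * (1 + norm z) ^ N" by (simp only: power_mult_distrib)
      have pd: "norm (partial_deriv i f z) \<le> 2 ^ N * C i / W" for i
      proof -
        have "norm (partial_deriv i f z) * W \<le> norm (partial_deriv i f z) * (2 ^ N * (1 + norm z) ^ N)"
          by (intro mult_left_mono Wz) auto
        also have "\<dots> = 2 ^ N * (norm (partial_deriv i f z) * (1 + norm z) ^ N)" by simp
        also have "\<dots> \<le> 2 ^ N * C i" by (intro mult_left_mono C) auto
        finally show ?thesis using W by (simp add: pos_le_divide_eq)
      qed
      have "norm (\<Sum>i\<in>UNIV. (h $ i) *\<^sub>R partial_deriv i f z) \<le> (K / W) * norm h" for h :: "real^'d"
      proof -
        have "norm (\<Sum>i\<in>UNIV. (h $ i) *\<^sub>R partial_deriv i f z) \<le> (\<Sum>i\<in>UNIV. norm h * (2 ^ N * C i / W))"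
        proof (rule sum_norm_le)
          fix i
          have "\<bar>h $ i\<bar> * norm (partial_deriv i f z) \<le> norm h * (2 ^ N * C i / W)"
            by (intro mult_mono component_le_norm_cart pd) auto
          then show "norm ((h $ i) *\<^sub>R partial_deriv i f z) \<le> norm h * (2 ^ N * C i / W)" by simp
        qed
        also have "\<dots> = (K / W) * norm h" unfolding K_def
          by (simp add: sum_distrib_left sum_distrib_right sum_divide_distrib mult_ac)
        finally show ?thesis .
      qed
      moreover have "0 \<le> K / W"
        using W C[of _ 0] unfolding K_def by (intro divide_nonneg_pos mult_nonneg_nonneg sum_nonneg) (auto intro: order_trans[OF norm_ge_zero])
      ultimately show "onorm (\<lambda>h. \<Sum>i\<in>UNIV. (h $ i) *\<^sub>R partial_deriv i f z) \<le> K / W" by (intro onorm_bound)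
    qed
    then show ?thesis unfolding W_def[symmetric] using W by (simp add: pos_le_divide_eq)
  qed
  then show "\<exists>C. \<forall>x y. norm (y - x) \<le> 1 \<longrightarrow> norm (f y - f x) * (1 + norm x) ^ N \<le> C * norm (y - x)" by blast
qed

lemma fourier_transform_eq: "fourier_transform f = fourier f" for f :: "real^'d \<Rightarrow> complex"
proof
  fix \<xi> :: "real^'d"
  have "exp (- 2 * complex_of_real pi * \<i> * complex_of_real (x \<bullet> \<xi>)) = character x \<xi>" for x
    unfolding cis_conv_exp by (simp add: mult_ac)
  then show "fourier_transform f \<xi> = fourier f \<xi>" unfolding fourier_transform_def fourier_def by simp
qed

text \<open>Each power of a coordinate of \<open>\<xi>\<close> is traded for a partial derivative of
  the function, which is again Schwartz; at the end the trivial bound by the integral of the modulus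
  remains.\<close>

lemma schwartz_fourier_rapid:
  fixes f :: "real^'d \<Rightarrow> complex"
  assumes f: "f \<in> schwartz_space"
  shows "rapid (fourier f)"
  unfolding rapid_def
proof (intro conjI allI)
  show "continuous_on UNIV (fourier f)" by (rule fourier_continuous[OF schwartz_rapid[OF f]])
  have decay: "\<exists>C. \<forall>\<xi>. \<bar>\<xi> $ i\<bar> ^ N * norm (fourier u \<xi>) \<le> C" if "u \<in> schwartz_space" for i N and u :: "real^'d \<Rightarrow> complex"
    using that
  proof (induction N arbitrary: u)
    case 0
    show ?case using norm_fourier_le[of u] by auto
  next
    case (Suc N)
    have p: "partial_deriv i u \<in> schwartz_space" by (rule schwartz_partial_deriv[OF Suc.prems])
    obtain C where C: "\<And>\<xi>. \<bar>\<xi> $ i\<bar> ^ N * norm (fourier (partial_deriv i u) \<xi>) \<le> C" using Suc.IH[OF p] by blast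
    have "\<bar>\<xi> $ i\<bar> ^ Suc N * norm (fourier u \<xi>) \<le> C / (2 * pi)" for \<xi>
    proof -
      have "fourier (partial_deriv i u) \<xi> = 2 * of_real pi * \<i> * of_real (axis i 1 \<bullet> \<xi>) * fourier u \<xi>"
        by (rule fourier_derivative[OF schwartz_rapid[OF Suc.prems] schwartz_rapid_lipschitz[OF Suc.prems] _
              schwartz_partial_has_derivative(2)[OF Suc.prems] rapid_measurable[OF schwartz_rapid[OF p]]]) simp
      then have "norm (fourier (partial_deriv i u) \<xi>) = 2 * pi * (\<bar>\<xi> $ i\<bar> * norm (fourier u \<xi>))"
        by (simp add: norm_mult inner_axis' )
      then have "\<bar>\<xi> $ i\<bar> ^ N * (2 * pi * (\<bar>\<xi> $ i\<bar> * norm (fourier u \<xi>))) \<le> C" using C[of \<xi>] by simp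
      then show ?thesis by (simp add: pos_le_divide_eq mult_ac)
    qed
    then show ?case by blast
  qed
  show "\<exists>C. \<forall>\<xi>. norm (fourier f \<xi>) * (1 + norm \<xi>) ^ N \<le> C" for N
    by (rule decay_from_coordinates[OF decay[OF f]])
qed

section \<open>Uniqueness\<close>

lemma csqrt_scale:
  assumes "r > 0"
  shows "csqrt (of_real r * z) = of_real (sqrt r) * csqrt z"
proof (rule csqrt_unique)
  have "(of_real (sqrt r) :: complex)\<^sup>2 = of_real r"
    using assms by (simp only: of_real_power[symmetric] real_sqrt_pow2[OF less_imp_le])
  then show "(of_real (sqrt r) * csqrt z)\<^sup>2 = of_real r * z" by (simp add: power_mult_distrib)
  have "0 < sqrt r" using assms by simp
  then show "0 < Re (of_real (sqrt r) * csqrt z) \<or> Re (of_real (sqrt r) * csqrt z) = 0 \<and> 0 \<le> Im (of_real (sqrt r) * csqrt z)"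
    using csqrt_principal[of z] by (auto simp: zero_less_mult_iff)
qed

text \<open>Used to bring the periods \<open>2 * \<alpha>\<close> and \<open>2 * \<beta>\<close> to
  a common value: rescaling the variable changes the multiplier only by a constant.\<close>

lemma weight_scale:
  assumes "r > 0"
  shows "weight d m (of_real r * z) = of_real (sqrt (1 / r) ^ d / r ^ m) * weight d m z"
proof -
  have "\<i> / (of_real r * z) = of_real (1 / r) * (\<i> / z)" by simp
  then have "csqrt (\<i> / (of_real r * z)) = of_real (sqrt (1 / r)) * csqrt (\<i> / z)"
    using csqrt_scale[of "1 / r" "\<i> / z"] assms by (simp only: zero_less_divide_1_iff)
  then have "weight d m (of_real r * z) = (of_real (sqrt (1 / r)) * csqrt (\<i> / z)) ^ d / (of_real r * z) ^ m"
    unfolding weight_def by (simp only:)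
  also have "\<dots> = of_real (sqrt (1 / r) ^ d / r ^ m) * (csqrt (\<i> / z) ^ d / z ^ m)"
    by (simp only: power_mult_distrib of_real_divide of_real_power times_divide_times_eq)
  finally show ?thesis unfolding weight_def .
qed

lemma i_over_notin_nonpos: "Re z \<noteq> 0 \<Longrightarrow> \<i> / z \<notin> \<real>\<^sub>\<le>\<^sub>0"
proof -
  assume z: "Re z \<noteq> 0"
  have "Im (\<i> / z) = Re z / ((Re z)\<^sup>2 + (Im z)\<^sup>2)" by (simp add: Im_divide)
  moreover have "(Re z)\<^sup>2 + (Im z)\<^sup>2 \<noteq> 0" using z by (simp add: sum_power2_eq_zero_iff)
  ultimately have "Im (\<i> / z) \<noteq> 0" using z by simp
  then show ?thesis by (simp add: complex_nonpos_Reals_iff)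
qed

lemma half_weight_weight:
  assumes "d \<ge> 5"
  shows "half_weight (weight d m) (\<i> ^ d) (d + 2 * m)"
proof
  fix z :: complex assume "z \<noteq> 0"
  have "(weight d m z)\<^sup>2 = ((csqrt (\<i> / z))\<^sup>2) ^ d / (z\<^sup>2) ^ m"
    unfolding weight_def power_divide by (simp only: power_power_commute[of _ _ 2])
  also have "\<dots> = \<i> ^ d / z ^ (d + 2 * m)"
    by (simp only: power2_csqrt power_divide power_add power_mult divide_divide_eq_left)
  finally show "(weight d m z)\<^sup>2 = \<i> ^ d / z ^ (d + 2 * m)" .
next
  show "norm (\<i> ^ d) = 1" by (simp add: norm_power)
  show "5 \<le> d + 2 * m" using assms by simp
  show "weight d m holomorphic_on {z. Re z \<noteq> 0}"
    unfolding weight_def using i_over_notin_nonpos by (intro holomorphic_intros) auto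
qed

text \<open>\<open>s \<mapsto> - 1 / s\<close> replaces \<open>\<i> / s\<close> by its inverse, and
  off the cut the principal root respects inverses; only \<open>s ^ m * (- 1 / s) ^ m\<close> is
  left. So the equation expressing \<open>G\<close> by \<open>F\<close> also gives \<open>F\<close>
  by \<open>G\<close>, with sign \<open>(- 1) ^ m\<close>.\<close>

lemma weight_inversion:
  assumes "s \<noteq> 0"
  shows "weight d m (of_real s) * weight d m (of_real (- 1 / s)) = (- 1) ^ m"
proof -
  have "\<i> / of_real (- 1 / s) = inverse (\<i> / of_real s)" using assms by (simp add: field_simps)
  moreover have ni: "\<i> / of_real s \<notin> \<real>\<^sub>\<le>\<^sub>0" by (rule i_over_notin_nonpos) (simp add: assms)
  ultimately have "csqrt (\<i> / of_real (- 1 / s)) = inverse (csqrt (\<i> / of_real s))"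
    by (simp only: csqrt_inverse[OF ni])
  moreover have c: "csqrt (\<i> / of_real s) \<noteq> 0" using assms by simp
  ultimately have "csqrt (\<i> / of_real s) ^ d * csqrt (\<i> / of_real (- 1 / s)) ^ d = 1"
    by (simp only: power_mult_distrib[symmetric] right_inverse[OF c] power_one)
  moreover have "of_real s ^ m * of_real (- 1 / s) ^ m = ((- 1) ^ m :: complex)"
    unfolding power_mult_distrib[symmetric] of_real_mult[symmetric] using assms by simp
  ultimately show ?thesis unfolding weight_def times_divide_times_eq
    by (simp only:) (simp add: divide_eq_eq power_mult_distrib[symmetric])
qed

text \<open>For \<open>\<bar>s\<bar> > 1\<close> the multiplier is below
  \<open>1 / s\<^sup>2\<close> and the other transform is bounded; for smaller \<open>s\<close> the
  claimed bound is at least \<open>B\<close>. This decay makes the Poisson sums converge.\<close>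

lemma gaussian_transform_decay:
  assumes F: "\<And>s. s \<noteq> 0 \<Longrightarrow> F (of_real s) = c * weight d m (of_real s) * G (of_real (- 1 / s))" and c: "norm c = 1"
    and GB: "\<And>s. norm (G (of_real s)) \<le> B" and FB: "\<And>s. norm (F (of_real s)) \<le> B" and d: "d \<ge> 5"
  shows "\<exists>C. \<forall>s. s \<noteq> 0 \<longrightarrow> norm (F (of_real s) :: complex) \<le> C / s\<^sup>2"
proof (intro exI allI impI)
  fix s :: real assume s: "s \<noteq> 0"
  interpret half_weight "weight d m" "\<i> ^ d" "d + 2 * m" by (rule half_weight_weight[OF d])
  have B0: "B \<ge> 0" using FB[of 0] norm_ge_zero order_trans by blast
  show "norm (F (of_real s)) \<le> B / s\<^sup>2"
  proof (cases "\<bar>s\<bar> > 1")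
    case True
    then have "norm (weight d m (of_real s)) \<le> 1 / s\<^sup>2" using norm_less[of "of_real s"] by simp
    then have "norm (weight d m (of_real s)) * norm (G (of_real (- 1 / s))) \<le> 1 / s\<^sup>2 * B"
      by (intro mult_mono GB) auto
    then show ?thesis unfolding F[OF s] norm_mult c by simp
  next
    case False
    then have s1: "s\<^sup>2 \<le> 1" "s\<^sup>2 > 0" using s by (auto simp: abs_square_le_1)
    then have "B * s\<^sup>2 \<le> B * 1" using B0 by (intro mult_left_mono)
    then have "B \<le> B / s\<^sup>2" using s1 by (simp add: pos_le_divide_eq)
    then show ?thesis using FB[of s] by linarith
  qed
qed

text \<open>The functional equation yields the decay, the decay yields the Poisson sums, and
  together they give the hypotheses of the two fixed point theorems.\<close>

lemma uniqueness_step: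
  fixes f g :: "'a::euclidean_space \<Rightarrow> complex" and w :: 'a
  assumes dim: "DIM('a) \<ge> 5" and f: "rapid f" "rapid_lipschitz f" and g: "rapid g" "rapid_lipschitz g"
    and fg: "g = fourier f" and \<alpha>: "\<alpha> > 0" and \<beta>: "\<beta> > 0" and n0: "n0 \<ge> 1"
    and reg: "\<alpha> * \<beta> > 1 \<or> \<alpha> * \<beta> = 1 \<and> n0 = 1"
    and vf: "\<And>x n. n \<ge> n0 \<Longrightarrow> (norm x)\<^sup>2 = real n / \<alpha> \<Longrightarrow> f x = 0"
    and vg: "\<And>x n. n \<ge> n0 \<Longrightarrow> (norm x)\<^sup>2 = real n / \<beta> \<Longrightarrow> g x = 0"
    and IHf: "\<And>j t. j < m \<Longrightarrow> gaussian_transform (\<lambda>x. f x * of_real (x \<bullet> w) ^ j) (of_real t) = 0"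
    and IHg: "\<And>j t. j < m \<Longrightarrow> gaussian_transform (\<lambda>x. g x * of_real (x \<bullet> w) ^ j) (of_real t) = 0"
  shows "gaussian_transform (\<lambda>x. f x * of_real (x \<bullet> w) ^ m) (of_real t) = 0
    \<and> gaussian_transform (\<lambda>x. g x * of_real (x \<bullet> w) ^ m) (of_real t) = 0"
proof -
  define uf where "uf = (\<lambda>x. f x * of_real (x \<bullet> w) ^ m)"
  define ug where "ug = (\<lambda>x. g x * of_real (x \<bullet> w) ^ m)"
  define F where "F = gaussian_transform uf"
  define G where "G = gaussian_transform ug"
  define \<kappa> where "\<kappa> = weight DIM('a) m"
  interpret half_weight \<kappa> "\<i> ^ DIM('a)" "DIM('a) + 2 * m"
    unfolding \<kappa>_def by (rule half_weight_weight[OF dim])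
  have uf: "rapid uf" "rapid_lipschitz uf" and ug: "rapid ug" "rapid_lipschitz ug"
    unfolding uf_def ug_def by (intro rapid_mult_inner_power rapid_lipschitz_mult_inner_power f g)+
  have feG: "G (of_real s) = \<kappa> (of_real s) * F (of_real (- 1 / s))" if "s \<noteq> 0" for s
    unfolding G_def F_def uf_def ug_def \<kappa>_def
    by (rule gaussian_functional_equation[OF f(1) g(1) fg that IHf IHg])
  have feF: "F (of_real s) = (- 1) ^ m * \<kappa> (of_real s) * G (of_real (- 1 / s))" if s: "s \<noteq> 0" for s
  proof -
    have s': "- 1 / s \<noteq> 0" "- 1 / (- 1 / s) = s" using s by simp_all
    have "(- 1) ^ m * \<kappa> (of_real s) * G (of_real (- 1 / s)) = (- 1) ^ m * (\<kappa> (of_real s) * \<kappa> (of_real (- 1 / s))) * F (of_real s)"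
      unfolding feG[OF s'(1)] s'(2) by (simp only: mult.assoc)
    also have "\<dots> = F (of_real s)"
      unfolding \<kappa>_def weight_inversion[OF s] power_mult_distrib[symmetric] by simp
    finally show ?thesis ..
  qed
  define B where "B = max (LINT x|lborel. norm (uf x)) (LINT x|lborel. norm (ug x))"
  have FB: "norm (F (of_real s)) \<le> B" and GB: "norm (G (of_real s)) \<le> B" for s
    using norm_gaussian_transform_le[OF uf(1), of "of_real s"] norm_gaussian_transform_le[OF ug(1), of "of_real s"]
    unfolding F_def G_def B_def by simp_all
  have decF: "\<exists>C. \<forall>s. s \<noteq> 0 \<longrightarrow> norm (F (of_real s)) \<le> C / s\<^sup>2"
  proof (rule gaussian_transform_decay[where c="(- 1) ^ m" and F=F and G=G and m=m, OF _ _ GB FB dim])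
    show "F (of_real s) = (- 1) ^ m * weight DIM('a) m (of_real s) * G (of_real (- 1 / s))" if "s \<noteq> 0" for s
      using feF[OF that] unfolding \<kappa>_def .
  qed (simp add: norm_power)
  have decG: "\<exists>C. \<forall>s. s \<noteq> 0 \<longrightarrow> norm (G (of_real s)) \<le> C / s\<^sup>2"
  proof (rule gaussian_transform_decay[where c=1 and F=G and G=F and m=m, OF _ _ FB GB dim])
    show "G (of_real s) = 1 * weight DIM('a) m (of_real s) * F (of_real (- 1 / s))" if "s \<noteq> 0" for s
      using feG[OF that] unfolding \<kappa>_def mult_1 .
  qed simp
  have dim3: "DIM('a) \<ge> 3" using dim by simp
  have vuf: "uf x = 0" if "n \<ge> n0" "(norm x)\<^sup>2 = real n / \<alpha>" for x n using vf[OF that] unfolding uf_def by simp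
  have vug: "ug x = 0" if "n \<ge> n0" "(norm x)\<^sup>2 = real n / \<beta>" for x n using vg[OF that] unfolding ug_def by simp
  obtain cf where cf: "\<And>t. (\<lambda>n. F (of_real (t + 2 * \<alpha> * real (Suc n))) + F (of_real (t - 2 * \<alpha> * real (Suc n))))
      sums ((\<Sum>n\<in>{1..<n0}. cf n * cis (pi * t * (real n / \<alpha>))) - F (of_real t))"
  proof (rule poisson_sum_squared_radius[OF uf(1) \<alpha> uf(2) dim3 n0 _ decF[unfolded F_def], folded F_def])
    show "uf x = 0" if "n0 \<le> n" "(norm x)\<^sup>2 = real n / \<alpha>" for x n by (rule vuf[OF that])
  qed (rule that)
  obtain cg where cg: "\<And>t. (\<lambda>n. G (of_real (t + 2 * \<beta> * real (Suc n))) + G (of_real (t - 2 * \<beta> * real (Suc n))))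
      sums ((\<Sum>n\<in>{1..<n0}. cg n * cis (pi * t * (real n / \<beta>))) - G (of_real t))"
  proof (rule poisson_sum_squared_radius[OF ug(1) \<beta> ug(2) dim3 n0 _ decG[unfolded G_def], folded G_def])
    show "ug x = 0" if "n0 \<le> n" "(norm x)\<^sup>2 = real n / \<beta>" for x n by (rule vug[OF that])
  qed (rule that)
  \<comment> \<open>With \<open>a * r = \<alpha>\<close> and \<open>a / r = \<beta>\<close>, the
    functions \<open>F (r * t)\<close> and \<open>G (t / r)\<close> both have translates by
    multiples of \<open>2 * a\<close>, and inversion still exchanges their arguments.\<close>
  define a where "a = sqrt (\<alpha> * \<beta>)"
  define r where "r = sqrt (\<alpha> / \<beta>)"
  have r: "r > 0" unfolding r_def using \<alpha> \<beta> by simp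
  have ar: "a * r = \<alpha>"
    unfolding a_def r_def real_sqrt_mult[symmetric] using \<alpha> \<beta> by (simp add: real_sqrt_abs2)
  have ar': "a / r = \<beta>"
    unfolding a_def r_def real_sqrt_divide[symmetric] using \<alpha> \<beta> by (simp add: real_sqrt_abs2)
  have a: "a \<ge> 1" unfolding a_def using reg by auto
  \<comment> \<open>The constant by which rescaling changes \<open>\<kappa>\<close>. It is absorbed
    into the second function, so that both equations keep the multiplier \<open>\<kappa>\<close> up
    to the sign \<open>\<sigma>\<close>.\<close>
  define \<rho> :: complex where "\<rho> = of_real (sqrt (1 / r) ^ DIM('a) / r ^ m)"
  have \<rho>: "\<rho> \<noteq> 0" unfolding \<rho>_def using r by simp
  have scale: "\<kappa> (of_real r * z) = \<rho> * \<kappa> z" for z unfolding \<kappa>_def \<rho>_def by (rule weight_scale[OF r])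
  define H where "H = (\<lambda>b t. if b then F (of_real (r * t)) else \<rho> * G (of_real (t / r)))"
  define \<sigma> :: "bool \<Rightarrow> complex" where "\<sigma> = (\<lambda>b. if b then (- 1) ^ m else 1)"
  \<comment> \<open>The trigonometric polynomials from the Poisson sums, written with
    \<open>exp\<close> of a complex argument so that they are entire.\<close>
  define P where "P = (\<lambda>b z. if b then (\<Sum>n\<in>{1..<n0}. cf n * exp (\<i> * (of_real (pi * r * (real n / \<alpha>)) * z)))
      else \<rho> * (\<Sum>n\<in>{1..<n0}. cg n * exp (\<i> * (of_real (pi / r * (real n / \<beta>)) * z))))"
  have contH: "continuous_on UNIV (H b)" for b
  proof -
    have "continuous_on UNIV (\<lambda>t::real. complex_of_real (r * t))" "continuous_on UNIV (\<lambda>t::real. complex_of_real (t / r))"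
      using r by (auto intro!: continuous_intros)
    then have "continuous_on UNIV (\<lambda>t::real. F (of_real (r * t)))" "continuous_on UNIV (\<lambda>t::real. G (of_real (t / r)))"
      unfolding F_def G_def
      using continuous_on_compose2[OF gaussian_transform_continuous[OF uf(1)], of UNIV "\<lambda>t::real. complex_of_real (r * t)"]
        continuous_on_compose2[OF gaussian_transform_continuous[OF ug(1)], of UNIV "\<lambda>t::real. complex_of_real (t / r)"]
      by (simp_all add: image_subset_iff)
    then show ?thesis unfolding H_def by (cases b) (auto intro!: continuous_intros)
  qed
  have sigma: "norm (\<sigma> b) = 1" for b unfolding \<sigma>_def by (simp add: norm_power)
  have feH: "H b t = \<sigma> b * \<kappa> (of_real t) * H (\<not> b) (- 1 / t)" if t: "t \<noteq> 0" for b t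
  proof (cases b)
    case True
    have rt: "r * t \<noteq> 0" "- 1 / (r * t) = - 1 / t / r" using r t by auto
    have k: "\<kappa> (of_real (r * t)) = \<rho> * \<kappa> (of_real t)" unfolding of_real_mult by (rule scale)
    have "F (of_real (r * t)) = (- 1) ^ m * (\<rho> * \<kappa> (of_real t)) * G (of_real (- 1 / t / r))"
      unfolding feF[OF rt(1)] rt(2) k by (rule refl)
    then show ?thesis using True unfolding H_def \<sigma>_def by simp
  next
    case False
    have tr: "t / r \<noteq> 0" "- 1 / (t / r) = r * (- 1 / t)" using r t by auto
    have "of_real r * of_real (t / r) = (of_real t :: complex)" using r by simp
    then have "\<rho> * \<kappa> (of_real (t / r)) = \<kappa> (of_real t)" using scale[of "of_real (t / r)"] by simp
    then have "\<rho> * G (of_real (t / r)) = \<kappa> (of_real t) * F (of_real (r * (- 1 / t)))"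
      unfolding feG[OF tr(1)] tr(2) mult.assoc[symmetric] by (simp only:)
    then show ?thesis using False unfolding H_def \<sigma>_def by simp
  qed
  have perH: "(\<lambda>n. H b (t + 2 * a * real (Suc n)) + H b (t - 2 * a * real (Suc n))) sums (P b (of_real t) - H b t)" for b t
  proof (cases b)
    case True
    have e: "r * (t + 2 * a * k) = r * t + 2 * \<alpha> * k" "r * (t - 2 * a * k) = r * t - 2 * \<alpha> * k" for k
      unfolding ar[symmetric] by (simp_all add: algebra_simps)
    have "exp (\<i> * (of_real (pi * r * (real n / \<alpha>)) * of_real t)) = cis (pi * (r * t) * (real n / \<alpha>))" for n
      unfolding cis_conv_exp of_real_mult[symmetric] by (simp add: mult_ac)
    then show ?thesis using True cf[of "r * t"] unfolding H_def P_def e by (simp only: if_True)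
  next
    case False
    have e: "(t + 2 * a * k) / r = t / r + 2 * \<beta> * k" "(t - 2 * a * k) / r = t / r - 2 * \<beta> * k" for k
      unfolding ar'[symmetric] by (simp_all add: add_divide_distrib diff_divide_distrib)
    have x: "exp (\<i> * (of_real (pi / r * (real n / \<beta>)) * of_real t)) = cis (pi * (t / r) * (real n / \<beta>))" for n
      unfolding cis_conv_exp of_real_mult[symmetric] by (simp add: mult_ac)
    show ?thesis using False sums_mult[OF cg[of "t / r"], of \<rho>] unfolding H_def P_def e x
      by (simp only: if_False right_diff_distrib distrib_left)
  qed
  have holP: "P b holomorphic_on UNIV" for b
    unfolding P_def by (cases b) (auto intro!: holomorphic_intros)
  have zero: "H b t = 0" for b t
  proof (cases "a > 1")
    case True
    show ?thesis
      by (rule supercritical_uniqueness[where a=a and H=H and P=P and \<sigma>=\<sigma>, OF a contH sigma feH perH holP True])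
  next
    case False
    then have a1: "a = 1" using a by simp
    then have "\<alpha> * \<beta> = 1" unfolding a_def by simp
    then have "n0 = 1" using reg by simp
    then have P0: "P b z = 0" for b z unfolding P_def by simp
    show ?thesis
      by (rule critical_uniqueness[where a=a and H=H and P=P and \<sigma>=\<sigma>, OF a contH sigma feH perH holP a1 P0])
  qed
  have "F (of_real t) = 0" using zero[of True "t / r"] r unfolding H_def by simp
  moreover have "G (of_real t) = 0" using zero[of False "t * r"] r \<rho> unfolding H_def by simp
  ultimately show ?thesis unfolding F_def G_def uf_def ug_def by simp
qed

text \<open>The functional equation of order \<open>m\<close> presupposes that all lower orders
  vanish for both functions and the same \<open>w\<close>; hence strong induction on the joint
  statement.\<close>

theorem rapid_uniqueness:
  fixes f g :: "'a::euclidean_space \<Rightarrow> complex"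
  assumes dim: "DIM('a) \<ge> 5" and f: "rapid f" "rapid_lipschitz f" and g: "rapid g" "rapid_lipschitz g"
    and fg: "g = fourier f" and \<alpha>: "\<alpha> > 0" and \<beta>: "\<beta> > 0" and n0: "n0 \<ge> 1"
    and reg: "\<alpha> * \<beta> > 1 \<or> \<alpha> * \<beta> = 1 \<and> n0 = 1"
    and vf: "\<And>x n. n \<ge> n0 \<Longrightarrow> (norm x)\<^sup>2 = real n / \<alpha> \<Longrightarrow> f x = 0"
    and vg: "\<And>x n. n \<ge> n0 \<Longrightarrow> (norm x)\<^sup>2 = real n / \<beta> \<Longrightarrow> g x = 0"
  shows "f x = 0"
proof (rule rapid_zero_if_transforms_zero[OF f(1)])
  fix w :: 'a and m :: nat and t :: real
  have "\<forall>t. gaussian_transform (\<lambda>x. f x * of_real (x \<bullet> w) ^ m) (of_real t) = 0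
    \<and> gaussian_transform (\<lambda>x. g x * of_real (x \<bullet> w) ^ m) (of_real t) = 0"
  proof (induction m rule: less_induct)
    case (less m)
    show ?case
    proof
      fix t
      have IHf: "gaussian_transform (\<lambda>x. f x * of_real (x \<bullet> w) ^ j) (of_real t) = 0"
        and IHg: "gaussian_transform (\<lambda>x. g x * of_real (x \<bullet> w) ^ j) (of_real t) = 0" if "j < m" for j t
        using less.IH[OF that] by (simp_all only:)
      show "gaussian_transform (\<lambda>x. f x * of_real (x \<bullet> w) ^ m) (of_real t) = 0
        \<and> gaussian_transform (\<lambda>x. g x * of_real (x \<bullet> w) ^ m) (of_real t) = 0"
        by (rule uniqueness_step[OF dim f g fg \<alpha> \<beta> n0 reg vf vg IHf IHg])
    qed
  qed
  then show "gaussian_transform (\<lambda>x. f x * of_real (x \<bullet> w) ^ m) (of_real t) = 0" by (simp only:)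
qed

section \<open>Reduction to differences of Schwartz functions\<close>

lemma rapid_diff:
  assumes "rapid u" "rapid v"
  shows "rapid (\<lambda>x. u x - v x)"
  unfolding rapid_def
proof (intro conjI allI)
  show "continuous_on UNIV (\<lambda>x. u x - v x)" by (intro continuous_intros rapid_continuous assms)
  fix N
  obtain C D where C: "\<And>x. norm (u x) * (1 + norm x) ^ N \<le> C" and D: "\<And>x. norm (v x) * (1 + norm x) ^ N \<le> D"
    using rapidE[OF assms(1)] rapidE[OF assms(2)] by metis
  have "norm (u x - v x) * (1 + norm x) ^ N \<le> C + D" for x
  proof -
    have "norm (u x - v x) * (1 + norm x) ^ N \<le> (norm (u x) + norm (v x)) * (1 + norm x) ^ N"
      by (intro mult_right_mono norm_triangle_ineq4) auto
    then show ?thesis using C[of x] D[of x] unfolding distrib_right by linarith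
  qed
  then show "\<exists>C. \<forall>x. norm (u x - v x) * (1 + norm x) ^ N \<le> C" by blast
qed

lemma rapid_lipschitz_diff:
  fixes u v :: "'a::euclidean_space \<Rightarrow> complex"
  assumes "rapid_lipschitz u" "rapid_lipschitz v"
  shows "rapid_lipschitz (\<lambda>x. u x - v x)"
  unfolding rapid_lipschitz_def
proof (intro allI)
  fix N
  obtain C where C: "\<And>x y. norm (y - x) \<le> 1 \<Longrightarrow> norm (u y - u x) * (1 + norm x) ^ N \<le> C * norm (y - x)"
    using assms(1) unfolding rapid_lipschitz_def by metis
  obtain D where D: "\<And>x y. norm (y - x) \<le> 1 \<Longrightarrow> norm (v y - v x) * (1 + norm x) ^ N \<le> D * norm (y - x)"
    using assms(2) unfolding rapid_lipschitz_def by metis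
  have "norm (u y - v y - (u x - v x)) * (1 + norm x) ^ N \<le> (C + D) * norm (y - x)" if xy: "norm (y - x) \<le> 1" for x y :: 'a
  proof -
    have "u y - v y - (u x - v x) = (u y - u x) - (v y - v x)" by simp
    then have "norm (u y - v y - (u x - v x)) * (1 + norm x) ^ N \<le> (norm (u y - u x) + norm (v y - v x)) * (1 + norm x) ^ N"
      by (metis mult_right_mono norm_triangle_ineq4 zero_le_power add_nonneg_nonneg norm_ge_zero zero_le_one)
    then show ?thesis using C[OF xy] D[OF xy] unfolding distrib_right by linarith
  qed
  then show "\<exists>C. \<forall>x y. norm (y - x) \<le> 1 \<longrightarrow> norm (u y - v y - (u x - v x)) * (1 + norm x) ^ N \<le> C * norm (y - x)" by blast
qed

lemma fourier_diff:
  fixes u v :: "'a::euclidean_space \<Rightarrow> complex"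
  assumes "rapid u" "rapid v"
  shows "fourier (\<lambda>x. u x - v x) = (\<lambda>\<xi>. fourier u \<xi> - fourier v \<xi>)"
proof
  fix \<xi> :: 'a
  have i: "integrable lborel (\<lambda>x. h x * character x \<xi>)" if "rapid h" for h :: "'a \<Rightarrow> complex"
    by (intro rapid_integrable_mult[of _ _ 1] that) simp_all
  show "fourier (\<lambda>x. u x - v x) \<xi> = fourier u \<xi> - fourier v \<xi>"
    unfolding fourier_def left_diff_distrib by (rule Bochner_Integration.integral_diff[OF i[OF assms(1)] i[OF assms(2)]])
qed

lemma schwartz_uniqueness_pair:
  fixes \<alpha> \<beta> :: real and n0 :: int
  assumes dim: "CARD('d::finite) \<ge> 5" and \<alpha>: "\<alpha> > 0" and \<beta>: "\<beta> > 0" and n0: "n0 \<ge> 1"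
    and reg: "\<alpha> * \<beta> > 1 \<or> \<alpha> * \<beta> = 1 \<and> n0 = 1"
  shows "fourier_uniqueness_pair
    (\<Union>n\<in>{n0..}. sphere (0 :: real^'d) (sqrt (of_int n / \<alpha>)))
    (\<Union>n\<in>{n0..}. sphere (0 :: real^'d) (sqrt (of_int n / \<beta>))) schwartz_space"
  unfolding fourier_uniqueness_pair_def
proof (rule inj_onI)
  fix p q :: "real^'d \<Rightarrow> complex"
  let ?A = "\<lambda>\<gamma>. \<Union>n\<in>{n0..}. sphere (0 :: real^'d) (sqrt (of_int n / \<gamma>))"
  assume p: "p \<in> schwartz_space" and q: "q \<in> schwartz_space"
    and eq: "(restrict p (?A \<alpha>), restrict (fourier_transform p) (?A \<beta>))
      = (restrict q (?A \<alpha>), restrict (fourier_transform q) (?A \<beta>))"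
  \<comment> \<open>\<open>restrict\<close> is extensional, so equal restrictions mean equality at
    each point of the union; the sphere of index \<open>int n\<close> contains every
    \<open>x\<close> of the given squared norm.\<close>
  have on: "h x = k x" if "restrict h (?A \<gamma>) = restrict k (?A \<gamma>)" "n \<ge> nat n0" "(norm x)\<^sup>2 = real n / \<gamma>"
    for h k :: "real^'d \<Rightarrow> complex" and \<gamma> n x
  proof -
    have "norm x = sqrt (of_int (int n) / \<gamma>)" using that(3) by (metis norm_ge_zero of_int_of_nat_eq real_sqrt_unique)
    then have "x \<in> sphere 0 (sqrt (of_int (int n) / \<gamma>))" by simp
    moreover have "int n \<in> {n0..}" using that(2) by simp
    ultimately have "x \<in> ?A \<gamma>" by (intro UN_I)
    then show ?thesis using fun_cong[OF that(1), of x] by (simp only: restrict_apply if_True)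
  qed
  define f where "f = (\<lambda>x. p x - q x)"
  define g where "g = (\<lambda>x. fourier p x - fourier q x)"
  have rp: "rapid p" "rapid q" "rapid (fourier p)" "rapid (fourier q)"
    by (intro schwartz_rapid schwartz_fourier_rapid p q)+
  have "f x = 0" for x
  proof (rule rapid_uniqueness[where f=f and g=g and \<alpha>=\<alpha> and \<beta>=\<beta> and ?n0.0="nat n0"])
    show "DIM(real^'d) \<ge> 5" using dim by simp
    show "rapid f" "rapid g" unfolding f_def g_def by (intro rapid_diff rp)+
    show "rapid_lipschitz f" unfolding f_def by (intro rapid_lipschitz_diff schwartz_rapid_lipschitz p q)
    show "rapid_lipschitz g" unfolding g_def by (intro rapid_lipschitz_diff rapid_lipschitz_fourier rp)
    show "g = fourier f" unfolding f_def g_def fourier_diff[OF rp(1,2)] ..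
    show "\<alpha> > 0" "\<beta> > 0" by fact+
    show "nat n0 \<ge> 1" using n0 by simp
    show "\<alpha> * \<beta> > 1 \<or> \<alpha> * \<beta> = 1 \<and> nat n0 = 1" using reg by auto
    fix x :: "real^'d" and n assume n: "n \<ge> nat n0"
    show "f x = 0" if "(norm x)\<^sup>2 = real n / \<alpha>"
      using on[of p \<alpha> q, OF _ n that] eq unfolding f_def by simp
    show "g x = 0" if "(norm x)\<^sup>2 = real n / \<beta>"
      using on[of "fourier_transform p" \<beta> "fourier_transform q", OF _ n that] eq unfolding g_def fourier_transform_eq by simp
  qed
  then show "p = q" unfolding f_def by (simp add: fun_eq_iff)
qed

theorem corollary5p1:
  fixes \<alpha> \<beta> :: real
  assumes "CARD('d::finite) \<ge> 5"
    and "\<alpha> > 0" and "\<beta> > 0"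
  shows "(\<alpha> * \<beta> > 1 \<longrightarrow>
           (\<forall>n\<^sub>0::int. n\<^sub>0 \<ge> 1 \<longrightarrow>
              fourier_uniqueness_pair
                (\<Union>n\<in>{n\<^sub>0..}. sphere (0 :: real^'d) (sqrt (of_int n / \<alpha>)))
                (\<Union>n\<in>{n\<^sub>0..}. sphere (0 :: real^'d) (sqrt (of_int n / \<beta>)))
                schwartz_space)) \<and>
         (\<alpha> * \<beta> = 1 \<longrightarrow>
            fourier_uniqueness_pair
              (\<Union>n\<in>{1::int..}. sphere (0 :: real^'d) (sqrt (of_int n / \<alpha>)))
              (\<Union>n\<in>{1::int..}. sphere (0 :: real^'d) (sqrt (of_int n / \<beta>)))
              schwartz_space)"
  using schwartz_uniqueness_pair[where 'd='d, OF assms] by blast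

end
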